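(* Let $\Omega\subset\mathbb{R}^N$ be a bounded open set with Lipschitz boundary, $T>0$ and $Q_T=\Omega\times(0,T)$. For $i=1,2$, let $u_i$ denote the solution of the variational inequality with gradient constraint (defined in the context) with data $(\boldsymbol b_i,c_i,f_i,g_i,u_{0i})$ satisfying: $\boldsymbol b_i\in L^2(Q_T)^N$ and $c_i\in L^2(Q_T)$; there exists $l\in\mathbb{R}$ such that $c_i-\frac12\nabla\cdot\boldsymbol b_i\ge l$ in $Q_T$ in the sense of distributions; $f_i\in L^2(Q_T)$ and $u_{0i}\in\mathbb{K}_{g_i(0)}$; $g_i\in W^{1,\infty}(0,T;L^\infty(\Omega))$ and $g_i\ge m>0$ for some constant $m$. Then there exists a positive constant $C=C(T)$, depending on $T$, such that $$\|u_1-u_2\|_{L^\infty(0,T;L^2(\Omega))}^2\le C\Big(\|u_{01}-u_{02}\|_{L^2(\Omega)}^2+\|\boldsymbol b_1-\boldsymbol b_2\|_{L^1(Q_T)}+\|c_1-c_2\|_{L^1(Q_T)}+\|f_1-f_2\|_{L^1(Q_T)}+\|g_1-g_2\|_{L^\infty(Q_T)}\Big).$$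
   Context: For $t\ge0$ and a function $g$ on $Q_T$, $\mathbb{K}_{g(t)}=\{v\in H^1_0(\Omega): |\nabla v(x)|\le g(x,t)\text{ for a.e. }x\in\Omega\}$. The symbols $\nabla$ and $\nabla\cdot$ denote gradient and divergence in the space variable only. The inequality $c-\frac12\nabla\cdot\boldsymbol b\ge l$ is understood in the distributional sense, since $\nabla\cdot\boldsymbol b$ need not be a function: $\int_{Q_T}\big(c\,\varphi+\frac12\boldsymbol b\cdot\nabla\varphi\big)\ge l\int_{Q_T}\varphi$ for all nonnegative $\varphi\in C_c^\infty(Q_T)$. For data $(\boldsymbol b,c,f,g,u_0)$ satisfying the hypotheses listed in the claim, the solution of the variational inequality with gradient constraint is the unique function $u\in L^\infty(0,T;W^{1,\infty}_0(\Omega))\cap C(\overline{Q}_T)$ with $\partial_tu\in L^2(Q_T)$ such that $u(t)\in\mathbb{K}_{g(t)}$ for a.e. $t\in(0,T)$, $u(0)=u_0$, and, for all $v\in\mathbb{K}_{g(t)}$ and a.e. $t\in(0,T)$, $$\int_\Omega \partial_t u(t)(v-u(t))+\int_\Omega\boldsymbol b(t)\cdot\nabla u(t)(v-u(t))+\int_\Omega c(t)u(t)(v-u(t))\ge\int_\Omega f(t)(v-u(t)).$$ Here $W^{1,\infty}_0(\Omega)$ denotes the functions of $W^{1,\infty}(\Omega)$ vanishing on $\partial\Omega$. (Existence and uniqueness of this solution hold under these hypotheses.)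
   Formalization: The constant C depends not on T alone (impossible, by scaling f, g, u_0, u) but on Omega, T, l, m and a bound R on the norms of b_i, c_i, f_i in L^2(Q_T) and of g_i in W^{1,infty}(0,T;L^infty(Omega)); it is uniform over all such data. *)

theory Defs
  imports "HOL-Analysis.Analysis" "HOL-Probability.Essential_Supremum"
begin

section \<open>Lebesgue spaces\<close>

definition in_L2 :: "'a measure \<Rightarrow> ('a \<Rightarrow> 'b::real_normed_vector) \<Rightarrow> bool" where
  "in_L2 M f \<longleftrightarrow> f \<in> borel_measurable M \<and> integrable M (\<lambda>x. (norm (f x))\<^sup>2)"

definition L1_norm :: "'a measure \<Rightarrow> ('a \<Rightarrow> 'b::real_normed_vector) \<Rightarrow> real" where
  "L1_norm M f = (\<integral>x. norm (f x) \<partial>M)"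

definition L2_norm :: "'a measure \<Rightarrow> ('a \<Rightarrow> 'b::real_normed_vector) \<Rightarrow> real" where
  "L2_norm M f = sqrt (\<integral>x. (norm (f x))\<^sup>2 \<partial>M)"

definition in_Linf :: "'a measure \<Rightarrow> ('a \<Rightarrow> 'b::real_normed_vector) \<Rightarrow> bool" where
  "in_Linf M f \<longleftrightarrow> f \<in> borel_measurable M \<and> (\<exists>K. AE x in M. norm (f x) \<le> K)"

text \<open>Meaningful for functions satisfying \<^const>\<open>in_Linf\<close>. On a null space \<^const>\<open>esssup\<close> is
  \<open>-\<infinity>\<close>, which is mapped to \<open>0\<close>, as it should be.\<close>

definition Linf_norm :: "'a measure \<Rightarrow> ('a \<Rightarrow> 'b::real_normed_vector) \<Rightarrow> real" where
  "Linf_norm M f = real_of_ereal (esssup M (\<lambda>x. ereal (norm (f x))))"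

definition locally_integrable :: "'a::euclidean_space set \<Rightarrow> ('a \<Rightarrow> 'b::euclidean_space) \<Rightarrow> bool" where
  "locally_integrable \<Omega> f \<longleftrightarrow> (\<forall>K. compact K \<and> K \<subseteq> \<Omega> \<longrightarrow> integrable (lebesgue_on K) f)"


section \<open>Test functions\<close>

primrec iterated_deriv :: "'a::real_normed_vector list \<Rightarrow> ('a \<Rightarrow> real) \<Rightarrow> 'a \<Rightarrow> real" where
  "iterated_deriv [] f = f"
| "iterated_deriv (d # ds) f = (\<lambda>x. frechet_derivative (iterated_deriv ds f) (at x) d)"

text \<open>\<open>C\<^sup>\<infinity>\<close>: all iterated directional derivatives exist and are again (Frechet) differentiable,
  hence continuous.\<close>

definition smooth :: "('a::real_normed_vector \<Rightarrow> real) \<Rightarrow> bool" where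
  "smooth f \<longleftrightarrow> (\<forall>ds x. iterated_deriv ds f differentiable (at x))"

text \<open>\<open>C\<^sub>c\<^sup>\<infinity>(U)\<close> for open \<open>U\<close>; its elements are extended by zero to the whole space.\<close>

definition test_functions :: "'a::real_normed_vector set \<Rightarrow> ('a \<Rightarrow> real) set" where
  "test_functions U = {\<phi>. smooth \<phi> \<and> compact (closure {x. \<phi> x \<noteq> 0}) \<and> closure {x. \<phi> x \<noteq> 0} \<subseteq> U}"

definition grad :: "('a::euclidean_space \<Rightarrow> real) \<Rightarrow> 'a \<Rightarrow> 'a" where
  "grad \<phi> x = (\<Sum>i\<in>Basis. frechet_derivative \<phi> (at x) i *\<^sub>R i)"


section \<open>Domains and Sobolev spaces in the space variable\<close>

text \<open>Near each boundary point, \<open>\<Omega>\<close> is the region above the graph of a Lipschitz function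
  over the hyperplane orthogonal to some unit vector \<open>e\<close>.\<close>

definition lipschitz_boundary :: "'a::euclidean_space set \<Rightarrow> bool" where
  "lipschitz_boundary \<Omega> \<longleftrightarrow>
    (\<forall>p\<in>frontier \<Omega>. \<exists>r>0. \<exists>e L. \<exists>h::'a \<Rightarrow> real. norm e = 1 \<and> L-lipschitz_on {z. z \<bullet> e = 0} h \<and>
       \<Omega> \<inter> ball p r = {x \<in> ball p r. h (x - (x \<bullet> e) *\<^sub>R e) < x \<bullet> e})"

definition has_weak_gradient ::
  "'a::euclidean_space set \<Rightarrow> ('a \<Rightarrow> real) \<Rightarrow> ('a \<Rightarrow> 'a) \<Rightarrow> bool" where
  "has_weak_gradient \<Omega> v G \<longleftrightarrow> locally_integrable \<Omega> v \<and> locally_integrable \<Omega> G \<and>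
    (\<forall>\<phi>\<in>test_functions \<Omega>.
       (\<integral>x. v x *\<^sub>R grad \<phi> x \<partial>lebesgue_on \<Omega>) = - (\<integral>x. \<phi> x *\<^sub>R G x \<partial>lebesgue_on \<Omega>))"

text \<open>\<open>H\<^sup>1\<^sub>0(\<Omega>)\<close>, the closure of the test functions in \<open>H\<^sup>1(\<Omega>)\<close>.\<close>

definition H10 :: "'a::euclidean_space set \<Rightarrow> ('a \<Rightarrow> real) set" where
  "H10 \<Omega> = {v. in_L2 (lebesgue_on \<Omega>) v \<and>
     (\<exists>G. in_L2 (lebesgue_on \<Omega>) G \<and> has_weak_gradient \<Omega> v G \<and>
       (\<exists>\<phi>::nat \<Rightarrow> 'a \<Rightarrow> real. range \<phi> \<subseteq> test_functions \<Omega> \<and>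
          (\<lambda>n. L2_norm (lebesgue_on \<Omega>) (\<lambda>x. \<phi> n x - v x)) \<longlonglongrightarrow> 0 \<and>
          (\<lambda>n. L2_norm (lebesgue_on \<Omega>) (\<lambda>x. grad (\<phi> n) x - G x)) \<longlonglongrightarrow> 0))}"

text \<open>\<open>W\<^sup>1\<^sup>,\<^sup>\<infinity>\<^sub>0(\<Omega>)\<close>: the boundary values are those of the continuous representative.\<close>

definition W1inf0 :: "'a::euclidean_space set \<Rightarrow> ('a \<Rightarrow> real) set" where
  "W1inf0 \<Omega> = {v. in_Linf (lebesgue_on \<Omega>) v \<and>
     (\<exists>G. in_Linf (lebesgue_on \<Omega>) G \<and> has_weak_gradient \<Omega> v G) \<and>
     (\<exists>w. continuous_on (closure \<Omega>) w \<and> (\<forall>x\<in>frontier \<Omega>. w x = 0) \<and>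
          (AE x in lebesgue_on \<Omega>. v x = w x))}"

text \<open>The set \<open>\<bbbK>\<^sub>\<gamma>\<close> for a threshold \<open>\<gamma>\<close> on \<open>\<Omega>\<close>.\<close>

definition gradient_constraint ::
  "'a::euclidean_space set \<Rightarrow> ('a \<Rightarrow> real) \<Rightarrow> ('a \<Rightarrow> real) set" where
  "gradient_constraint \<Omega> \<gamma> = {v \<in> H10 \<Omega>.
     \<exists>G. has_weak_gradient \<Omega> v G \<and> (AE x in lebesgue_on \<Omega>. norm (G x) \<le> \<gamma> x)}"


section \<open>Spaces on the cylinder\<close>

definition cylinder :: "'a set \<Rightarrow> real \<Rightarrow> ('a \<times> real) set" where
  "cylinder \<Omega> T = \<Omega> \<times> {0<..<T}"

definition has_weak_time_deriv ::
  "'a::euclidean_space set \<Rightarrow> real \<Rightarrow> ('a \<times> real \<Rightarrow> real) \<Rightarrow> ('a \<times> real \<Rightarrow> real) \<Rightarrow> bool" where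
  "has_weak_time_deriv \<Omega> T u u' \<longleftrightarrow>
    locally_integrable (cylinder \<Omega> T) u \<and> locally_integrable (cylinder \<Omega> T) u' \<and>
    (\<forall>\<phi>\<in>test_functions (cylinder \<Omega> T).
       (\<integral>(x, t). u (x, t) * deriv (\<lambda>s. \<phi> (x, s)) t \<partial>lebesgue_on (cylinder \<Omega> T)) =
       - (\<integral>z. u' z * \<phi> z \<partial>lebesgue_on (cylinder \<Omega> T)))"

text \<open>\<open>W\<^sup>1\<^sup>,\<^sup>\<infinity>(0,T;L\<^sup>\<infinity>(\<Omega>))\<close>. As \<open>L\<^sup>\<infinity>(\<Omega>)\<close> is not separable, measurability in time is understood
  in the usual weak-* sense, i.e. \<open>L\<^sup>\<infinity>(0,T;L\<^sup>\<infinity>(\<Omega>))\<close> is identified with \<open>L\<^sup>\<infinity>(\<Omega> \<times> (0,T))\<close>.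
  The last condition fixes the representative that is continuous from \<open>[0,T]\<close> to \<open>L\<^sup>\<infinity>(\<Omega>)\<close>, so
  that \<open>g(0)\<close> has a meaning.\<close>

definition time_W1inf :: "'a::euclidean_space set \<Rightarrow> real \<Rightarrow> ('a \<times> real \<Rightarrow> real) \<Rightarrow> bool" where
  "time_W1inf \<Omega> T g \<longleftrightarrow>
    in_Linf (lebesgue_on (cylinder \<Omega> T)) g \<and>
    (\<exists>g'. in_Linf (lebesgue_on (cylinder \<Omega> T)) g' \<and> has_weak_time_deriv \<Omega> T g g') \<and>
    (\<forall>t\<in>{0..T}. in_Linf (lebesgue_on \<Omega>) (\<lambda>x. g (x, t)) \<and>
       ((\<lambda>s. Linf_norm (lebesgue_on \<Omega>) (\<lambda>x. g (x, s) - g (x, t))) \<longlongrightarrow> 0) (at t within {0..T}))"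

text \<open>The norm of \<open>W\<^sup>1\<^sup>,\<^sup>\<infinity>(0,T;L\<^sup>\<infinity>(\<Omega>))\<close> is at most \<open>R\<close>.\<close>

definition time_W1inf_norm_le ::
  "'a::euclidean_space set \<Rightarrow> real \<Rightarrow> ('a \<times> real \<Rightarrow> real) \<Rightarrow> real \<Rightarrow> bool" where
  "time_W1inf_norm_le \<Omega> T g R \<longleftrightarrow>
    (\<exists>g'. in_Linf (lebesgue_on (cylinder \<Omega> T)) g' \<and> has_weak_time_deriv \<Omega> T g g' \<and>
       Linf_norm (lebesgue_on (cylinder \<Omega> T)) g + Linf_norm (lebesgue_on (cylinder \<Omega> T)) g' \<le> R)"

text \<open>\<open>u \<in> L\<^sup>\<infinity>(0,T;W\<^sup>1\<^sup>,\<^sup>\<infinity>\<^sub>0(\<Omega>))\<close> (again weak-* measurable in time) with spatial gradient \<open>Du\<close>.\<close>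

definition Linf_W1inf0 ::
  "'a::euclidean_space set \<Rightarrow> real \<Rightarrow> ('a \<times> real \<Rightarrow> real) \<Rightarrow> ('a \<times> real \<Rightarrow> 'a) \<Rightarrow> bool" where
  "Linf_W1inf0 \<Omega> T u Du \<longleftrightarrow>
    in_Linf (lebesgue_on (cylinder \<Omega> T)) u \<and> in_Linf (lebesgue_on (cylinder \<Omega> T)) Du \<and>
    (AE t in lebesgue_on {0<..<T}. (\<lambda>x. u (x, t)) \<in> W1inf0 \<Omega> \<and>
       has_weak_gradient \<Omega> (\<lambda>x. u (x, t)) (\<lambda>x. Du (x, t)))"

definition Linf_L2_norm :: "'a::euclidean_space set \<Rightarrow> real \<Rightarrow> ('a \<times> real \<Rightarrow> real) \<Rightarrow> real" where
  "Linf_L2_norm \<Omega> T u =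
    Linf_norm (lebesgue_on {0<..<T}) (\<lambda>t. L2_norm (lebesgue_on \<Omega>) (\<lambda>x. u (x, t)))"


section \<open>The variational inequality\<close>

text \<open>\<open>c - \<onehalf> \<nabla>\<cdot>b \<ge> l\<close> in the sense of distributions.\<close>

definition coercivity_condition ::
  "'a::euclidean_space set \<Rightarrow> real \<Rightarrow> real \<Rightarrow> ('a \<times> real \<Rightarrow> 'a) \<Rightarrow> ('a \<times> real \<Rightarrow> real) \<Rightarrow> bool" where
  "coercivity_condition \<Omega> T l b c \<longleftrightarrow>
    (\<forall>\<phi>\<in>test_functions (cylinder \<Omega> T). (\<forall>z. 0 \<le> \<phi> z) \<longrightarrow>
       l * (\<integral>z. \<phi> z \<partial>lebesgue_on (cylinder \<Omega> T)) \<le>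
       (\<integral>(x, t). c (x, t) * \<phi> (x, t) + 1/2 * (b (x, t) \<bullet> grad (\<lambda>y. \<phi> (y, t)) x)
          \<partial>lebesgue_on (cylinder \<Omega> T)))"

definition admissible_data ::
  "'a::euclidean_space set \<Rightarrow> real \<Rightarrow> real \<Rightarrow> real \<Rightarrow> ('a \<times> real \<Rightarrow> 'a) \<Rightarrow> ('a \<times> real \<Rightarrow> real) \<Rightarrow>
   ('a \<times> real \<Rightarrow> real) \<Rightarrow> ('a \<times> real \<Rightarrow> real) \<Rightarrow> ('a \<Rightarrow> real) \<Rightarrow> bool" where
  "admissible_data \<Omega> T l m b c f g u0 \<longleftrightarrow>
    in_L2 (lebesgue_on (cylinder \<Omega> T)) b \<and> in_L2 (lebesgue_on (cylinder \<Omega> T)) c \<and>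
    coercivity_condition \<Omega> T l b c \<and>
    in_L2 (lebesgue_on (cylinder \<Omega> T)) f \<and>
    time_W1inf \<Omega> T g \<and> (AE z in lebesgue_on (cylinder \<Omega> T). m \<le> g z) \<and>
    u0 \<in> gradient_constraint \<Omega> (\<lambda>x. g (x, 0))"

text \<open>The norms of \<open>b\<close>, \<open>c\<close>, \<open>f\<close>, \<open>g\<close> in their respective spaces are at most \<open>R\<close>. No bound on the
  initial datum is needed, since \<open>\<bbbK>\<^bsub>g(0)\<^esub>\<close> is bounded in terms of \<open>g\<close>.
  This makes precise on what, besides \<open>T\<close>, the constant of the stability estimate may depend:
  scaling \<open>(f, g, u\<^sub>0, u)\<close> shows that it cannot be independent of the size of the data, while a
  constant chosen after the data would only express uniqueness.\<close>

definition data_bounded_by ::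
  "'a::euclidean_space set \<Rightarrow> real \<Rightarrow> real \<Rightarrow> ('a \<times> real \<Rightarrow> 'a) \<Rightarrow> ('a \<times> real \<Rightarrow> real) \<Rightarrow>
   ('a \<times> real \<Rightarrow> real) \<Rightarrow> ('a \<times> real \<Rightarrow> real) \<Rightarrow> bool" where
  "data_bounded_by \<Omega> T R b c f g \<longleftrightarrow>
    L2_norm (lebesgue_on (cylinder \<Omega> T)) b \<le> R \<and> L2_norm (lebesgue_on (cylinder \<Omega> T)) c \<le> R \<and>
    L2_norm (lebesgue_on (cylinder \<Omega> T)) f \<le> R \<and> time_W1inf_norm_le \<Omega> T g R"

text \<open>In the inequality the test set depends on \<open>t\<close>, so it is read as: for a.e. \<open>t\<close> and all
  \<open>v \<in> \<bbbK>\<^bsub>g(t)\<^esub>\<close>. The weak derivatives \<open>ut\<close> and \<open>Du\<close> are unique up to null sets.\<close>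

definition is_solution ::
  "'a::euclidean_space set \<Rightarrow> real \<Rightarrow> ('a \<times> real \<Rightarrow> 'a) \<Rightarrow> ('a \<times> real \<Rightarrow> real) \<Rightarrow>
   ('a \<times> real \<Rightarrow> real) \<Rightarrow> ('a \<times> real \<Rightarrow> real) \<Rightarrow> ('a \<Rightarrow> real) \<Rightarrow> ('a \<times> real \<Rightarrow> real) \<Rightarrow> bool" where
  "is_solution \<Omega> T b c f g u0 u \<longleftrightarrow>
    continuous_on (closure (cylinder \<Omega> T)) u \<and>
    (AE x in lebesgue_on \<Omega>. u (x, 0) = u0 x) \<and>
    (AE t in lebesgue_on {0<..<T}. (\<lambda>x. u (x, t)) \<in> gradient_constraint \<Omega> (\<lambda>x. g (x, t))) \<and>
    (\<exists>ut Du. in_L2 (lebesgue_on (cylinder \<Omega> T)) ut \<and> has_weak_time_deriv \<Omega> T u ut \<and>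
       Linf_W1inf0 \<Omega> T u Du \<and>
       (AE t in lebesgue_on {0<..<T}. \<forall>v\<in>gradient_constraint \<Omega> (\<lambda>x. g (x, t)).
          (\<integral>x. f (x, t) * (v x - u (x, t)) \<partial>lebesgue_on \<Omega>) \<le>
          (\<integral>x. ut (x, t) * (v x - u (x, t)) \<partial>lebesgue_on \<Omega>) +
          (\<integral>x. (b (x, t) \<bullet> Du (x, t)) * (v x - u (x, t)) \<partial>lebesgue_on \<Omega>) +
          (\<integral>x. c (x, t) * u (x, t) * (v x - u (x, t)) \<partial>lebesgue_on \<Omega>)))"

end

theory Submission
  imports Defs
begin

text \<open>
Let \<open>\<beta> = \<parallel>g\<^sub>1 - g\<^sub>2\<parallel>\<close> and \<open>\<alpha> = m / (m + \<beta>)\<close>, so that \<open>\<alpha> u\<^sub>2\<close> and \<open>\<alpha> u\<^sub>1\<close> are admissible in the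
inequalities for \<open>u\<^sub>1\<close> and \<open>u\<^sub>2\<close>. In the sum of the two inequalities the time derivatives form, since
\<open>\<alpha>\<close> is constant, the total derivative of \<open>- \<onehalf> \<parallel>w\<parallel>\<^sup>2 - (1 - \<alpha>) \<integral> u\<^sub>1 u\<^sub>2\<close> with \<open>w = u\<^sub>1 - u\<^sub>2\<close>; hence no
a priori bound on \<open>\<partial>\<^sub>t u\<^sub>i\<close> is needed, only one on \<open>u\<^sub>i\<close> and \<open>\<nabla>u\<^sub>i\<close>, which the gradient constraint
provides. The coercivity condition is used with \<open>w\<^sup>2\<close> in place of a test function: at a fixed time
\<open>w\<close> is a limit of test functions in \<open>H\<^sup>1\<close>, and in time the gradient of \<open>w\<close> is weakly continuous because
\<open>w\<close> is continuous. The estimate follows from Gronwall's inequality.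
\<close>

section \<open>Calculus of smooth functions\<close>

text \<open>The choice of \<open>\<alpha>\<close> rests on
  \<open>m * g2 \<le> m * (g1 + \<beta>) \<le> g1 * (m + \<beta>)\<close>, and
  \<open>1 - \<alpha> \<le> \<beta> / m\<close> makes the cost of the scaling linear in
  \<open>\<beta>\<close>. As the differences of \<open>b\<close>, \<open>c\<close> and
  \<open>f\<close> are measured in L1, every factor they meet must be bounded uniformly. The
  gradients are bounded by \<open>R\<close>; since the solutions vanish on the boundary and a
  segment of length \<open>2 * \<rho>\<close> leads out of the domain,
  \<open>\<bar>u\<bar> \<le> 2 * \<rho> * R\<close> follows. The sup bound also makes
  \<open>c\<close> times the square of \<open>w\<close> integrable. In the coercivity condition the
  obstacle is one of null sets: each test function in space has its own exceptional set of times,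
  while the functions that approximate \<open>w\<close> change with time, so all families involved
  are kept countable. In time, the derivatives are only weak, and the product rule for two solutions
  has to be derived from their increments. The constant depends on \<open>l\<close>,
  \<open>m\<close>, \<open>R\<close>, \<open>T\<close> and the domain, the latter through
  \<open>\<rho>\<close> and the measures of \<open>\<Omega>\<close> and of the cylinder.\<close>

lemma smoothI_invariant:
  fixes f :: "'a::real_normed_vector \<Rightarrow> real"
  assumes "P f"
    and step: "\<And>g. P g \<Longrightarrow> (\<forall>x. g differentiable (at x)) \<and> (\<forall>d. P (\<lambda>x. frechet_derivative g (at x) d))"
  shows "smooth f"
proof -
  \<comment> \<open>The head of the list is the outermost derivative, so each \<open>Cons\<close>
    costs one use of \<open>step\<close>; \<open>P\<close> acts as a coinduction invariant.\<close>
  have "P (iterated_deriv ds f)" for ds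
    by (induction ds) (use assms in auto)
  then show ?thesis
    using step by (auto simp: smooth_def)
qed

lemma smooth_differentiable: "smooth f \<Longrightarrow> f differentiable (at x)"
  unfolding smooth_def by (metis iterated_deriv.simps(1))

lemma smooth_has_derivative: "smooth f \<Longrightarrow> (f has_derivative frechet_derivative f (at x)) (at x)"
  by (simp add: smooth_differentiable frechet_derivative_works[symmetric])

lemma smooth_continuous_on: "smooth f \<Longrightarrow> continuous_on S f"
  by (meson continuous_at_imp_continuous_on differentiable_imp_continuous_within smooth_differentiable)

text \<open>The recursion differentiates along the last list element first, so a derivative taken
  beforehand is appended at the end of the list.\<close>

lemma smooth_frechet_derivative:
  assumes "smooth f" shows "smooth (\<lambda>x. frechet_derivative f (at x) d)"
proof -
  have "iterated_deriv ds (\<lambda>x. frechet_derivative f (at x) d) = iterated_deriv (ds @ [d]) f" for ds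
    by (induction ds) auto
  with assms show ?thesis by (simp add: smooth_def)
qed

text \<open>Products alone are not closed under differentiation, sums of products are. Closing under
  both operations gives an invariant that the Leibniz rule respects, without any formula for higher
  derivatives.\<close>

inductive generated_algebra :: "('a \<Rightarrow> real) set \<Rightarrow> ('a \<Rightarrow> real) \<Rightarrow> bool" for A where
  base: "f \<in> A \<Longrightarrow> generated_algebra A f"
| add: "generated_algebra A f \<Longrightarrow> generated_algebra A g \<Longrightarrow> generated_algebra A (\<lambda>x. f x + g x)"
| mult: "generated_algebra A f \<Longrightarrow> generated_algebra A g \<Longrightarrow> generated_algebra A (\<lambda>x. f x * g x)"

text \<open>Only the generators have to be examined: if their directional derivatives lie in the
  algebra, the rules for sums and products carry this to every member.\<close>

lemma smooth_generated_algebra: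
  fixes f :: "'a::real_normed_vector \<Rightarrow> real"
  assumes f: "generated_algebra A f"
    and A: "\<And>f. f \<in> A \<Longrightarrow> (\<forall>x. f differentiable (at x)) \<and>
              (\<forall>d. generated_algebra A (\<lambda>x. frechet_derivative f (at x) d))"
  shows "smooth f"
proof (rule smoothI_invariant[where P="generated_algebra A", OF f])
  fix g assume "generated_algebra A g"
  then show "(\<forall>x. g differentiable (at x)) \<and> (\<forall>d. generated_algebra A (\<lambda>x. frechet_derivative g (at x) d))"
  proof induction
    case (base f) then show ?case using A by auto
  next
    case (add f g)
    then have "frechet_derivative (\<lambda>x. f x + g x) (at x) d
      = frechet_derivative f (at x) d + frechet_derivative g (at x) d" for x d
    proof -
      have "((\<lambda>x. f x + g x) has_derivative
          (\<lambda>d. frechet_derivative f (at x) d + frechet_derivative g (at x) d)) (at x)"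
        by (rule has_derivative_add) (use add frechet_derivative_works in blast)+
      then show ?thesis
        by (simp add: frechet_derivative_at[symmetric])
    qed
    with add show ?case by (simp add: generated_algebra.add)
  next
    case (mult f g)
    have "frechet_derivative (\<lambda>x. f x * g x) (at x) d
      = f x * frechet_derivative g (at x) d + frechet_derivative f (at x) d * g x" for x d
    proof -
      have "((\<lambda>x. f x * g x) has_derivative
          (\<lambda>d. f x * frechet_derivative g (at x) d + frechet_derivative f (at x) d * g x)) (at x)"
        by (rule has_derivative_mult) (use mult frechet_derivative_works in blast)+
      then show ?thesis
        by (simp add: frechet_derivative_at[symmetric])
    qed
    with mult show ?case by (simp add: generated_algebra.add generated_algebra.mult)
  qed
qed

text \<open>With all smooth functions as generators, the derivatives of generators are generators
  again.\<close>

lemma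
  assumes "smooth f" "smooth g"
  shows smooth_add: "smooth (\<lambda>x. f x + g x)" and smooth_mult: "smooth (\<lambda>x. f x * g x)"
proof -
  have gen: "generated_algebra (Collect smooth) f" if "smooth f" for f :: "'a \<Rightarrow> real"
    using that by (simp add: generated_algebra.base)
  have smooth: "smooth f" if "generated_algebra (Collect smooth) f" for f :: "'a \<Rightarrow> real"
    using that by (rule smooth_generated_algebra) (simp add: smooth_differentiable gen smooth_frechet_derivative)
  show "smooth (\<lambda>x. f x + g x)" "smooth (\<lambda>x. f x * g x)"
    by (rule smooth, rule generated_algebra.intros; rule gen, fact)+
qed

text \<open>The chain rule yields the product of the derivative of \<open>k\<close> at
  \<open>f x\<close> with a derivative of \<open>f\<close>. Taking as generators all smooth
  functions together with all \<open>k (f x)\<close> for smooth \<open>k\<close> puts both factors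
  among the generators.\<close>

lemma smooth_compose:
  fixes f :: "'a::real_normed_vector \<Rightarrow> real" and h :: "real \<Rightarrow> real"
  assumes f: "smooth f" and h: "smooth h"
  shows "smooth (\<lambda>x. h (f x))"
proof (rule smooth_generated_algebra[where A="Collect smooth \<union> {\<lambda>x. k (f x) |k. smooth k}"])
  let ?A = "Collect smooth \<union> {\<lambda>x. k (f x) |k. smooth k}"
  show "generated_algebra ?A (\<lambda>x. h (f x))"
    using h by (auto intro!: generated_algebra.base)
  fix g assume "g \<in> ?A"
  then consider "smooth g" | k where "smooth k" "g = (\<lambda>x. k (f x))" by auto
  then show "(\<forall>x. g differentiable at x) \<and> (\<forall>d. generated_algebra ?A (\<lambda>x. frechet_derivative g (at x) d))"
  proof cases
    case 1
    then show ?thesis by (simp add: generated_algebra.base smooth_differentiable smooth_frechet_derivative)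
  next
    case 2
    have D: "(g has_derivative (\<lambda>d. frechet_derivative k (at (f x)) 1 * frechet_derivative f (at x) d)) (at x)" for x
    proof -
      have "(g has_derivative (\<lambda>d. frechet_derivative k (at (f x)) (frechet_derivative f (at x) d))) (at x)"
        unfolding 2 using diff_chain_at[OF smooth_has_derivative[OF f] smooth_has_derivative[OF 2(1)]]
        by (simp add: o_def)
      moreover have "frechet_derivative k (at (f x)) r = frechet_derivative k (at (f x)) 1 * r" for r
        using linear_cmul[OF linear_frechet_derivative[OF smooth_differentiable[OF 2(1)]], of "f x" r 1]
        by (simp add: mult.commute)
      then have "frechet_derivative k (at (f x)) = (\<lambda>r. frechet_derivative k (at (f x)) 1 * r)"
        by (rule ext)
      ultimately show ?thesis by (rule subst[where P="\<lambda>h. (g has_derivative (\<lambda>d. h (frechet_derivative f (at x) d))) (at x)", rotated])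
    qed
    have "(\<lambda>x. frechet_derivative g (at x) d)
        = (\<lambda>x. frechet_derivative k (at (f x)) 1 * frechet_derivative f (at x) d)" for d
      by (simp add: frechet_derivative_at[OF D, symmetric])
    moreover have "(\<lambda>x. frechet_derivative k (at (f x)) 1) \<in> ?A"
      by (intro UnI2 CollectI exI[of _ "\<lambda>r. frechet_derivative k (at r) 1"])
         (simp add: smooth_frechet_derivative[OF 2(1)])
    ultimately have "generated_algebra ?A (\<lambda>x. frechet_derivative g (at x) d)" for d
      using smooth_frechet_derivative[OF f, of d] by (simp add: generated_algebra.mult generated_algebra.base)
    with D show ?thesis by (auto simp: differentiable_def)
  qed
qed

lemma smooth_const: "smooth (\<lambda>x. c)"
  by (rule smoothI_invariant[where P="\<lambda>g. \<exists>c. g = (\<lambda>x. c)"]) (auto simp: frechet_derivative_const)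

lemma smooth_bounded_linear:
  assumes "bounded_linear L" shows "smooth (L :: 'a::real_normed_vector \<Rightarrow> real)"
proof (rule smoothI_invariant[where P="\<lambda>g. g = L \<or> (\<exists>c. g = (\<lambda>x. c))"])
  fix g assume "g = L \<or> (\<exists>c. g = (\<lambda>x. c))"
  moreover have "frechet_derivative L (at x) = L" for x
    using frechet_derivative_at[OF bounded_linear_imp_has_derivative[OF assms]] by metis
  ultimately show "(\<forall>x. g differentiable at x) \<and> (\<forall>d. (\<lambda>x. frechet_derivative g (at x) d) = L \<or>
      (\<exists>c. (\<lambda>x. frechet_derivative g (at x) d) = (\<lambda>x. c)))"
    using assms by (auto simp: frechet_derivative_const bounded_linear_imp_differentiable)
qed auto

lemma smooth_uminus: "smooth f \<Longrightarrow> smooth (\<lambda>x. - f x)"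
  using smooth_mult[OF smooth_const[of "-1"]] by simp

lemma smooth_diff: "smooth f \<Longrightarrow> smooth g \<Longrightarrow> smooth (\<lambda>x. f x - g x)"
  using smooth_add[OF _ smooth_uminus, of f g] by simp

lemma smooth_sum: "(\<And>i. i \<in> I \<Longrightarrow> smooth (f i)) \<Longrightarrow> smooth (\<lambda>x. \<Sum>i\<in>I. f i x)"
  by (induction I rule: infinite_finite_induct) (auto intro: smooth_const smooth_add)

lemma smooth_inner: "smooth (\<lambda>x::'a::euclidean_space. x \<bullet> a)"
  by (intro smooth_bounded_linear bounded_linear_intros)

lemma smooth_inner_self: "smooth (\<lambda>x::'a::euclidean_space. x \<bullet> x)"
  by (subst euclidean_inner) (intro smooth_sum smooth_mult smooth_inner)

text \<open>A derivative of the composition in direction \<open>d\<close> is the derivative of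
  \<open>k\<close> in direction \<open>L d\<close>, again composed with \<open>L\<close>. The class
  of such compositions is its own invariant and no products arise.\<close>

lemma smooth_compose_linear:
  fixes f :: "'b::real_normed_vector \<Rightarrow> real" and L :: "'a::real_normed_vector \<Rightarrow> 'b"
  assumes f: "smooth f" and L: "bounded_linear L"
  shows "smooth (\<lambda>x. f (L x))"
proof (rule smoothI_invariant[where P="\<lambda>g. \<exists>k. smooth k \<and> g = (\<lambda>x. k (L x))"])
  fix g assume "\<exists>k. smooth k \<and> g = (\<lambda>x. k (L x))"
  then obtain k where k: "smooth k" "g = (\<lambda>x. k (L x))" by auto
  have D: "(g has_derivative (\<lambda>d. frechet_derivative k (at (L x)) (L d))) (at x)" for x
    unfolding k using diff_chain_at[OF bounded_linear_imp_has_derivative[OF L] smooth_has_derivative[OF k(1)]]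
    by (simp add: o_def)
  have "(\<lambda>x. frechet_derivative g (at x) d) = (\<lambda>x. frechet_derivative k (at (L x)) (L d))" for d
    by (simp add: frechet_derivative_at[OF D, symmetric])
  then have "\<exists>k. smooth k \<and> (\<lambda>x. frechet_derivative g (at x) d) = (\<lambda>x. k (L x))" for d
    using smooth_frechet_derivative[OF k(1), of "L d"] by blast
  then show "(\<forall>x. g differentiable at x) \<and>
      (\<forall>d. \<exists>k. smooth k \<and> (\<lambda>x. frechet_derivative g (at x) d) = (\<lambda>x. k (L x)))"
    using D by (auto simp: differentiable_def)
qed (use f in auto)

section \<open>Smooth cutoff functions on the real line\<close>

lemma smooth_DERIV_I:
  fixes f :: "real \<Rightarrow> real"
  assumes "P f" and step: "\<And>g. P g \<Longrightarrow> \<exists>g'. (\<forall>x. (g has_real_derivative g' x) (at x)) \<and> P g'"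
    and cmul: "\<And>g c. P g \<Longrightarrow> P (\<lambda>x. c * g x)"
  shows "smooth f"
proof (rule smoothI_invariant[where P=P, OF \<open>P f\<close>])
  fix g assume "P g"
  then obtain g' where g': "\<And>x. (g has_real_derivative g' x) (at x)" "P g'" using step by blast
  \<comment> \<open>On the line a directional derivative is \<open>d\<close> times the ordinary one,
    which is why the invariant must also be closed under constant multiples.\<close>
  have "(\<lambda>x. frechet_derivative g (at x) d) = (\<lambda>x. d * g' x)" for d
    using frechet_derivative_at[OF g'(1)[unfolded has_field_derivative_def], symmetric]
    by (simp add: mult.commute)
  then show "(\<forall>x. g differentiable at x) \<and> (\<forall>d. P (\<lambda>x. frechet_derivative g (at x) d))"
    using g' cmul by (auto simp: differentiable_def has_field_derivative_def)
qed

lemma smooth_exp: "smooth (exp :: real \<Rightarrow> real)"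
proof (rule smooth_DERIV_I[where P="\<lambda>g. \<exists>c. g = (\<lambda>x. c * exp x)"])
  show "\<exists>c. exp = (\<lambda>x::real. c * exp x)" by (rule exI[of _ 1]) auto
  show "\<exists>g'. (\<forall>x. (g has_real_derivative g' x) (at x)) \<and> (\<exists>c. g' = (\<lambda>x. c * exp x))"
    if g: "\<exists>c. g = (\<lambda>x::real. c * exp x)" for g :: "real \<Rightarrow> real"
  proof -
    from g obtain c where c: "g = (\<lambda>x. c * exp x)" by auto
    show ?thesis unfolding c
      by (intro exI[of _ "\<lambda>x. c * exp x"] conjI allI exI[of _ c] refl) (auto intro!: derivative_eq_intros)
  qed
  show "\<exists>c'. (\<lambda>x. c * g x) = (\<lambda>x. c' * exp x)"
    if "\<exists>c. g = (\<lambda>x::real. c * exp x)" for g :: "real \<Rightarrow> real" and c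
  proof -
    from that obtain c' where "g = (\<lambda>x. c' * exp x)" by auto
    then show ?thesis by (intro exI[of _ "c * c'"]) (simp add: fun_eq_iff)
  qed
qed

definition flat_exp :: "real \<Rightarrow> real" where
  "flat_exp t = (if t \<le> 0 then 0 else exp (- (1 / t)))"

lemma poly_times_exp_neg_tendsto_0: "((\<lambda>x::real. poly p x * exp (- x)) \<longlongrightarrow> 0) at_top"
proof -
  have "((\<lambda>x::real. \<Sum>i\<le>degree p. coeff p i * (x ^ i / exp x)) \<longlongrightarrow> (\<Sum>i\<le>degree p. coeff p i * 0)) at_top"
    by (intro tendsto_intros tendsto_power_div_exp_0)
  moreover have "poly p x * exp (- x) = (\<Sum>i\<le>degree p. coeff p i * (x ^ i / exp x))" for x :: real
    by (simp add: poly_altdef sum_distrib_right exp_minus divide_inverse mult.assoc)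
  ultimately show ?thesis by simp
qed

text \<open>The functions that vanish for \<open>t \<le> 0\<close> and equal
  \<open>poly p (1 / t) * exp (- (1 / t))\<close> for \<open>t > 0\<close> are closed under
  differentiation: \<open>p\<close> is replaced by \<open>X^2 * (p - p')\<close>, the factor
  \<open>X^2\<close> coming from the derivative of \<open>1 / t\<close>.\<close>

lemma smooth_flat_exp: "smooth flat_exp"
proof (rule smooth_DERIV_I[where P="\<lambda>g. \<exists>p. g = (\<lambda>t. if t \<le> 0 then 0 else poly p (1 / t) * exp (- (1 / t)))"])
  let ?F = "\<lambda>p t::real. if t \<le> 0 then 0 else poly p (1 / t) * exp (- (1 / t))"
  show "\<exists>p. flat_exp = ?F p"
    by (rule exI[of _ 1]) (auto simp: flat_exp_def)
  show "\<exists>p. (\<lambda>x. c * g x) = ?F p" if "\<exists>p. g = ?F p" for g c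
  proof -
    from that obtain p where "g = ?F p" by auto
    then show ?thesis by (intro exI[of _ "smult c p"]) (auto simp: fun_eq_iff)
  qed
  have D: "(?F p has_real_derivative ?F ([:0, 0, 1:] * (p - pderiv p)) t) (at t)" for p t
  proof -
    consider "t < 0" | "t > 0" | "t = 0" by linarith
    then show ?thesis
    proof cases
      case 1
      have "((\<lambda>t::real. 0) has_real_derivative 0) (at t)" by simp
      then have "(?F p has_real_derivative 0) (at t)"
        by (rule has_field_derivative_transform_within_open[where S="{..<0}"]) (use 1 in auto)
      then show ?thesis using 1 by simp
    next
      case 2
      have "((\<lambda>t. poly p (1 / t) * exp (- (1 / t))) has_real_derivative
          poly ([:0, 0, 1:] * (p - pderiv p)) (1 / t) * exp (- (1 / t))) (at t)"
        using 2 by (auto intro!: derivative_eq_intros DERIV_chain2[OF poly_DERIV]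
            simp: field_simps power2_eq_square)
      then have "(?F p has_real_derivative poly ([:0, 0, 1:] * (p - pderiv p)) (1 / t) * exp (- (1 / t))) (at t)"
        by (rule has_field_derivative_transform_within_open[where S="{0<..}"]) (use 2 in auto)
      then show ?thesis using 2 by simp
    next
      case 3
      \<comment> \<open>The difference quotient at \<open>0\<close> is of the same form, with the
        polynomial \<open>X * p\<close> in \<open>1 / t\<close>; the exponential beats every
        polynomial as \<open>1 / t\<close> tends to infinity.\<close>
      have "((\<lambda>t. poly ([:0, 1:] * p) (inverse t) * exp (- (inverse t))) \<longlongrightarrow> 0) (at_right 0)"
        using filterlim_compose[OF poly_times_exp_neg_tendsto_0 filterlim_inverse_at_top_right] .
      then have "((\<lambda>t. (?F p t - ?F p 0) / (t - 0)) \<longlongrightarrow> 0) (at_right 0)"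
        by (rule Lim_transform_eventually)
           (auto simp: eventually_at_filter field_simps intro!: eventuallyI)
      moreover have "((\<lambda>t. (?F p t - ?F p 0) / (t - 0)) \<longlongrightarrow> 0) (at_left 0)"
        by (rule Lim_transform_eventually[OF tendsto_const])
           (auto simp: eventually_at_filter intro!: eventuallyI)
      ultimately have "((\<lambda>t. (?F p t - ?F p 0) / (t - 0)) \<longlongrightarrow> 0) (at 0)"
        using filterlim_split_at by blast
      then show ?thesis unfolding 3 has_field_derivative_iff by simp
    qed
  qed
  show "\<exists>g'. (\<forall>x. (g has_real_derivative g' x) (at x)) \<and> (\<exists>p. g' = ?F p)"
    if g: "\<exists>p. g = ?F p" for g
  proof -
    from g obtain p where p: "g = ?F p" by auto
    show ?thesis unfolding p
      by (rule exI[of _ "?F ([:0, 0, 1:] * (p - pderiv p))"]) (use D in blast)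
  qed
qed

lemma flat_exp_simps: "t \<le> 0 \<Longrightarrow> flat_exp t = 0" "t > 0 \<Longrightarrow> flat_exp t > 0" "0 \<le> flat_exp t" "flat_exp t \<le> 1"
  by (auto simp: flat_exp_def)

lemma flat_exp_mono: "s \<le> t \<Longrightarrow> flat_exp s \<le> flat_exp t"
  by (auto simp: flat_exp_def intro!: divide_left_mono)

lemma flat_exp_at_top: "(flat_exp \<longlongrightarrow> 1) at_top"
proof -
  have "((\<lambda>t::real. exp (- (1 / t))) \<longlongrightarrow> exp (- 0)) at_top"
    by (intro tendsto_intros tendsto_divide_0[OF tendsto_const] filterlim_at_top_imp_at_infinity filterlim_ident)
  then have "((\<lambda>t::real. exp (- (1 / t))) \<longlongrightarrow> 1) at_top" by simp
  then show ?thesis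
    by (rule Lim_transform_eventually)
       (auto simp: flat_exp_def intro: eventually_mono[OF eventually_gt_at_top[of 0]])
qed

text \<open>The usual quotient of flat functions is avoided: nesting \<open>flat_exp\<close> inside
  itself needs only composition. For \<open>r \<le> 0\<close> the inner value is at least
  \<open>e\<close>, so the outer argument is nonpositive; for \<open>r \<ge> 1\<close> the inner
  value is \<open>0\<close> and the normalisation gives \<open>1\<close>.\<close>

lemma smooth_step_exists:
  obtains s :: "real \<Rightarrow> real" where "smooth s" "\<And>r. r \<le> 0 \<Longrightarrow> s r = 0" "\<And>r. r \<ge> 1 \<Longrightarrow> s r = 1"
    "\<And>r. 0 \<le> s r" "\<And>r. s r \<le> 1" "mono s"
proof
  define e where "e = flat_exp 1"
  have e: "e > 0" by (simp add: e_def flat_exp_simps)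
  then have p: "flat_exp e > 0" by (simp add: flat_exp_simps)
  define s where "s r = 1 / flat_exp e * flat_exp (e - flat_exp (1 - r))" for r
  show "smooth s"
    unfolding s_def
    by (intro smooth_mult smooth_const smooth_compose[OF _ smooth_flat_exp] smooth_diff)
       (simp add: smooth_bounded_linear bounded_linear_ident)
  show "s r = 0" if "r \<le> 0" for r
    using flat_exp_mono[of 1 "1 - r"] that by (simp add: s_def e_def flat_exp_simps)
  show "s r = 1" if "r \<ge> 1" for r
    using that p by (simp add: s_def flat_exp_simps)
  show "0 \<le> s r" for r using p by (simp add: s_def flat_exp_simps)
  show "s r \<le> 1" for r
    using flat_exp_mono[of "e - flat_exp (1 - r)" e] p flat_exp_simps(3)[of "1 - r"] by (simp add: s_def divide_simps)
  show "mono s"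
  proof (rule monoI)
    fix x y :: real assume "x \<le> y"
    then have "flat_exp (e - flat_exp (1 - x)) \<le> flat_exp (e - flat_exp (1 - y))"
      using flat_exp_mono[of "1 - y" "1 - x"] by (intro flat_exp_mono) simp
    then show "s x \<le> s y" using p unfolding s_def by (intro mult_left_mono) simp_all
  qed
qed

section \<open>Test functions and the fundamental lemma\<close>

lemma test_functionsI:
  assumes "smooth \<phi>" "compact K" "K \<subseteq> U" "\<And>x. x \<notin> K \<Longrightarrow> \<phi> x = 0"
  shows "\<phi> \<in> test_functions U"
proof -
  have "{x. \<phi> x \<noteq> 0} \<subseteq> K" using assms(4) by auto
  then have sub: "closure {x. \<phi> x \<noteq> 0} \<subseteq> K"
    using assms(2) by (simp add: closure_minimal compact_imp_closed)
  moreover have "compact (closure {x. \<phi> x \<noteq> 0})"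
    using compact_Int_closed[OF assms(2), of "closure {x. \<phi> x \<noteq> 0}"] sub by (simp add: Int_absorb1)
  ultimately show ?thesis
    using assms(1,3) by (auto simp: test_functions_def)
qed

lemma test_functions_smooth: "\<phi> \<in> test_functions U \<Longrightarrow> smooth \<phi>"
  by (simp add: test_functions_def)

lemma test_functions_support:
  assumes "\<phi> \<in> test_functions U"
  obtains K where "compact K" "K \<subseteq> U" "\<And>x. x \<notin> K \<Longrightarrow> \<phi> x = 0"
proof
  show "\<phi> x = 0" if "x \<notin> closure {x. \<phi> x \<noteq> 0}" for x
    using that closure_subset[of "{x. \<phi> x \<noteq> 0}"] by blast
qed (use assms in \<open>auto simp: test_functions_def\<close>)

lemma test_functions_mono: "U \<subseteq> V \<Longrightarrow> test_functions U \<subseteq> test_functions V"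
  by (auto simp: test_functions_def)

lemma test_functions_zero: "(\<lambda>x. 0) \<in> test_functions U"
  by (rule test_functionsI[where K="{}"]) (auto intro: smooth_const)

lemma test_functions_add:
  assumes "\<phi> \<in> test_functions U" "\<psi> \<in> test_functions U"
  shows "(\<lambda>x. \<phi> x + \<psi> x) \<in> test_functions U"
proof -
  obtain K where K: "compact K" "K \<subseteq> U" "\<And>x. x \<notin> K \<Longrightarrow> \<phi> x = 0"
    by (rule test_functions_support[OF assms(1)]) blast
  obtain L where L: "compact L" "L \<subseteq> U" "\<And>x. x \<notin> L \<Longrightarrow> \<psi> x = 0"
    by (rule test_functions_support[OF assms(2)]) blast
  from K L show ?thesis
    by (intro test_functionsI[where K="K \<union> L"] smooth_add assms[THEN test_functions_smooth]) auto
qed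

lemma test_functions_mult_smooth:
  assumes "\<phi> \<in> test_functions U" "smooth \<psi>"
  shows "(\<lambda>x. \<psi> x * \<phi> x) \<in> test_functions U"
proof -
  obtain K where "compact K" "K \<subseteq> U" "\<And>x. x \<notin> K \<Longrightarrow> \<phi> x = 0"
    by (rule test_functions_support[OF assms(1)]) blast
  then show ?thesis
    by (intro test_functionsI[where K=K] smooth_mult assms test_functions_smooth[OF assms(1)]) auto
qed

lemma test_functions_cmult: "\<phi> \<in> test_functions U \<Longrightarrow> (\<lambda>x. c * \<phi> x) \<in> test_functions U"
  by (rule test_functions_mult_smooth[OF _ smooth_const])

lemma test_functions_compose:
  assumes "\<phi> \<in> test_functions U" "smooth h" "h 0 = 0"
  shows "(\<lambda>x. h (\<phi> x)) \<in> test_functions U"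
proof -
  obtain K where "compact K" "K \<subseteq> U" "\<And>x. x \<notin> K \<Longrightarrow> \<phi> x = 0"
    by (rule test_functions_support[OF assms(1)]) blast
  then show ?thesis
    using assms(3) by (intro test_functionsI[where K=K] smooth_compose[OF test_functions_smooth[OF assms(1)] assms(2)]) auto
qed

section \<open>Gradients of test functions\<close>

lemma continuous_on_frechet_derivative: "smooth f \<Longrightarrow> continuous_on S (\<lambda>x. frechet_derivative f (at x) d)"
  by (intro smooth_continuous_on smooth_frechet_derivative)

lemma continuous_on_grad: "smooth f \<Longrightarrow> continuous_on S (grad f)"
  unfolding grad_def by (intro continuous_intros continuous_on_frechet_derivative)

lemma frechet_derivative_eq_grad:
  fixes f :: "'a::euclidean_space \<Rightarrow> real"
  assumes "f differentiable (at x)" shows "frechet_derivative f (at x) d = grad f x \<bullet> d"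
proof -
  have lin: "linear (frechet_derivative f (at x))"
    using assms by (rule linear_frechet_derivative)
  have "frechet_derivative f (at x) d = frechet_derivative f (at x) (\<Sum>i\<in>Basis. (d \<bullet> i) *\<^sub>R i)"
    by (simp add: euclidean_representation)
  also have "\<dots> = (\<Sum>i\<in>Basis. (d \<bullet> i) * frechet_derivative f (at x) i)"
    by (simp add: linear_sum[OF lin] linear_cmul[OF lin])
  finally show ?thesis
    by (simp add: grad_def inner_sum_right inner_commute[of _ d] mult.commute)
qed

lemma grad_eqI:
  fixes f :: "'a::euclidean_space \<Rightarrow> real"
  assumes "(f has_derivative (\<lambda>d. g \<bullet> d)) (at x)"
  shows "grad f x = g"
  by (simp add: grad_def frechet_derivative_at[OF assms, symmetric] euclidean_representation)

lemma has_derivative_grad: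
  fixes f :: "'a::euclidean_space \<Rightarrow> real"
  assumes "smooth f" shows "(f has_derivative (\<lambda>d. grad f x \<bullet> d)) (at x)"
  using smooth_has_derivative[OF assms] frechet_derivative_eq_grad[OF smooth_differentiable[OF assms]]
  by (metis (no_types, lifting) ext)

lemma grad_eq_0_off_support:
  fixes \<phi> :: "'a::euclidean_space \<Rightarrow> real"
  assumes "compact K" "\<And>x. x \<notin> K \<Longrightarrow> \<phi> x = 0" "x \<notin> K"
  shows "grad \<phi> x = 0"
proof (rule grad_eqI)
  have "((\<lambda>x. 0) has_derivative (\<lambda>d. 0)) (at x)" by simp
  then have "(\<phi> has_derivative (\<lambda>d. 0)) (at x)"
    by (rule has_derivative_transform_within_open[where s="- K"])
       (use assms in \<open>auto simp: compact_imp_closed\<close>)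
  then show "(\<phi> has_derivative (\<lambda>d. 0 \<bullet> d)) (at x)" by simp
qed

lemma grad_add:
  fixes f :: "'a::euclidean_space \<Rightarrow> real"
  assumes "smooth f" "smooth g" shows "grad (\<lambda>x. f x + g x) x = grad f x + grad g x"
  using has_derivative_add[OF has_derivative_grad[OF assms(1)] has_derivative_grad[OF assms(2)]]
  by (intro grad_eqI) (simp add: inner_add_left)

lemma grad_cmult:
  fixes f :: "'a::euclidean_space \<Rightarrow> real"
  assumes "smooth f" shows "grad (\<lambda>x. c * f x) x = c *\<^sub>R grad f x"
  using has_derivative_mult_right[OF has_derivative_grad[OF assms], of c]
  by (intro grad_eqI) simp

lemma test_functions_grad_bounded:
  fixes \<phi> :: "'a::euclidean_space \<Rightarrow> real"
  assumes \<phi>: "\<phi> \<in> test_functions U"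
  obtains B where "\<And>x. \<bar>\<phi> x\<bar> \<le> B" "\<And>x. norm (grad \<phi> x) \<le> B"
proof -
  obtain K where K: "compact K" "K \<subseteq> U" "\<And>x. x \<notin> K \<Longrightarrow> \<phi> x = 0"
    by (rule test_functions_support[OF \<phi>]) blast
  have "bounded (\<phi> ` K)" "bounded (grad \<phi> ` K)"
    using K(1) test_functions_smooth[OF \<phi>]
    by (intro compact_imp_bounded compact_continuous_image smooth_continuous_on continuous_on_grad; simp)+
  then obtain B B' where "\<And>x. x \<in> K \<Longrightarrow> \<bar>\<phi> x\<bar> \<le> B" "\<And>x. x \<in> K \<Longrightarrow> norm (grad \<phi> x) \<le> B'"
    unfolding bounded_iff by force
  then have "\<bar>\<phi> x\<bar> \<le> max (max B B') 0" "norm (grad \<phi> x) \<le> max (max B B') 0" for x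
    using K grad_eq_0_off_support[where K=K and \<phi>=\<phi> and x=x] by (cases "x \<in> K"; force)+
  then show thesis using that by blast
qed

lemma test_functions_directional_derivative:
  fixes \<phi> :: "'a::euclidean_space \<Rightarrow> real"
  assumes "\<phi> \<in> test_functions U"
  shows "(\<lambda>x. frechet_derivative \<phi> (at x) d) \<in> test_functions U"
proof -
  obtain K where K: "compact K" "K \<subseteq> U" "\<And>x. x \<notin> K \<Longrightarrow> \<phi> x = 0"
    by (rule test_functions_support[OF assms]) blast
  have sm: "smooth \<phi>" by (rule test_functions_smooth[OF assms])
  show ?thesis
  proof (rule test_functionsI[OF smooth_frechet_derivative[OF sm] K(1,2)])
    fix x assume "x \<notin> K"
    then have "grad \<phi> x = 0" by (intro grad_eq_0_off_support[where K=K] K)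
    then show "frechet_derivative \<phi> (at x) d = 0"
      by (simp add: frechet_derivative_eq_grad[OF smooth_differentiable[OF sm]])
  qed
qed

text \<open>Countably many balls with closure in \<open>U\<close> cover \<open>U\<close>, and
  \<open>h n\<close> is a bump positive exactly on the \<open>n\<close>-th ball. The factor
  \<open>real n\<close> inside \<open>flat_exp\<close> drives the value to \<open>1\<close> wherever
  some bump is positive, while only finitely many closed balls carry the support; the values stay in
  the unit interval because those of \<open>flat_exp\<close> do.\<close>

lemma open_exhausting_test_functions:
  fixes U :: "'a::euclidean_space set"
  assumes "open U"
  obtains \<theta> :: "nat \<Rightarrow> 'a \<Rightarrow> real" where "\<And>n. \<theta> n \<in> test_functions U" "\<And>n x. 0 \<le> \<theta> n x" "\<And>n x. \<theta> n x \<le> 1"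
    "\<And>x. (\<lambda>n. \<theta> n x) \<longlonglongrightarrow> indicator U x"
proof (cases "U = {}")
  case True
  then show ?thesis
    using test_functions_zero[of U] by (intro that[of "\<lambda>n x. 0"]) auto
next
  case False
  define F where "F = {ball a r |a r. cball a r \<subseteq> U}"
  obtain F' where F': "F' \<subseteq> F" "countable F'" "\<Union>F' = \<Union>F"
    by (rule Lindelof[of F]) (auto simp: F_def)
  have "\<Union>F = U"
  proof
    show "U \<subseteq> \<Union>F"
    proof
      fix x assume "x \<in> U"
      then obtain r where "r > 0" "cball x r \<subseteq> U"
        using assms open_contains_cball by blast
      then show "x \<in> \<Union>F" by (auto simp: F_def intro!: exI[of _ "ball x r"])
    qed
  qed (use ball_subset_cball in \<open>auto simp: F_def\<close>)
  with F' False have "F' \<noteq> {}" by auto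
  have "\<exists>a r. from_nat_into F' n = ball a r \<and> cball a r \<subseteq> U" for n
    using from_nat_into[OF \<open>F' \<noteq> {}\<close>, of n] F'(1) by (auto simp: F_def)
  then obtain a r where ar: "\<And>n. from_nat_into F' n = ball (a n) (r n)" "\<And>n. cball (a n) (r n) \<subseteq> U"
    by metis
  have cover: "\<exists>n. x \<in> ball (a n) (r n)" if "x \<in> U" for x
  proof -
    have "x \<in> \<Union>F'" unfolding F'(3) \<open>\<Union>F = U\<close> by (rule that)
    then obtain B where "B \<in> F'" "x \<in> B" by (rule UnionE)
    moreover obtain n where "from_nat_into F' n = B" using from_nat_into_surj[OF F'(2) \<open>B \<in> F'\<close>] by auto
    ultimately show ?thesis using ar(1)[of n] by auto
  qed
  \<comment> \<open>Radii in \<open>F\<close> may be negative, with an empty ball; the case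
    distinction prevents the square of such a radius from producing a bump on a ball that need not
    lie in \<open>U\<close>.\<close>
  define h where "h n x = (if r n > 0 then flat_exp ((r n)\<^sup>2 - (x - a n) \<bullet> (x - a n)) else 0)" for n x
  have h_smooth: "smooth (h n)" for n
  proof -
    have "smooth (\<lambda>x. (r n)\<^sup>2 - (x - a n) \<bullet> (x - a n))"
    proof -
      have "(x - a n) \<bullet> (x - a n) = x \<bullet> x - (x \<bullet> a n + (x \<bullet> a n - a n \<bullet> a n))" for x
        by (simp add: inner_diff_left inner_diff_right inner_commute[of "a n" x])
      then show ?thesis
        by (simp only:) (intro smooth_diff smooth_add smooth_const smooth_inner smooth_inner_self)
    qed
    from smooth_compose[OF this smooth_flat_exp] show ?thesis
      by (cases "r n > 0") (simp_all add: h_def[abs_def] smooth_const)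
  qed
  have h_nonneg: "0 \<le> h n x" for n x by (simp add: h_def flat_exp_simps)
  have h_pos: "h n x > 0 \<longleftrightarrow> x \<in> ball (a n) (r n)" for n x
  proof (cases "r n > 0")
    case True
    have "h n x > 0 \<longleftrightarrow> (r n)\<^sup>2 - (norm (x - a n))\<^sup>2 > 0"
      using True flat_exp_simps(1,2)[of "(r n)\<^sup>2 - (norm (x - a n))\<^sup>2"]
      by (cases "(r n)\<^sup>2 - (norm (x - a n))\<^sup>2 > 0") (auto simp: h_def power2_norm_eq_inner)
    also have "\<dots> \<longleftrightarrow> norm (x - a n) < r n"
      using True power2_less_imp_less[of "norm (x - a n)" "r n"] power_strict_mono[of "norm (x - a n)" "r n" 2] by auto
    finally show ?thesis by (simp add: dist_norm norm_minus_commute)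
  next
    case False
    have "\<not> dist (a n) x < r n" using zero_le_dist[of "a n" x] False by linarith
    with False show ?thesis by (simp add: h_def)
  qed
  define \<theta> where "\<theta> n x = flat_exp (real n * (\<Sum>j<n. h j x))" for n x
  show thesis
  proof (rule that[of \<theta>])
    show "\<theta> n \<in> test_functions U" for n
    proof (rule test_functionsI[where K="\<Union>j<n. cball (a j) (r j)"])
      show "smooth (\<theta> n)"
        unfolding \<theta>_def by (intro smooth_compose[OF _ smooth_flat_exp] smooth_mult smooth_const smooth_sum h_smooth)
      show "\<theta> n x = 0" if "x \<notin> (\<Union>j<n. cball (a j) (r j))" for x
      proof -
        have "h j x = 0" if "j < n" for j
          using \<open>x \<notin> _\<close> that h_pos[of j x] h_nonneg[of j x] by (auto simp: less_le)
        then show ?thesis by (simp add: \<theta>_def flat_exp_simps)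
      qed
    qed (use ar(2) in auto)
    show "0 \<le> \<theta> n x" "\<theta> n x \<le> 1" for n x by (simp_all add: \<theta>_def flat_exp_simps)
    show "(\<lambda>n. \<theta> n x) \<longlonglongrightarrow> indicator U x" for x
    proof (cases "x \<in> U")
      case True
      then obtain j where j: "h j x > 0" using cover h_pos by blast
      have "(\<lambda>n. flat_exp (h j x * real n)) \<longlonglongrightarrow> 1"
        using j by (intro filterlim_compose[OF flat_exp_at_top]
            filterlim_tendsto_pos_mult_at_top[OF tendsto_const] filterlim_real_sequentially)
      moreover have "\<forall>\<^sub>F n in sequentially. flat_exp (h j x * real n) \<le> \<theta> n x"
        using eventually_gt_at_top[of j]
      proof eventually_elim
        case (elim n)
        then have "h j x \<le> (\<Sum>j<n. h j x)"
          by (intro member_le_sum) (auto simp: h_nonneg)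
        then show ?case
          unfolding \<theta>_def by (intro flat_exp_mono) (simp add: mult.commute mult_left_mono)
      qed
      ultimately have "(\<lambda>n. \<theta> n x) \<longlonglongrightarrow> 1"
        by (rule tendsto_sandwich[rotated 2, OF _ tendsto_const]) (auto simp: \<theta>_def flat_exp_simps)
      with True show ?thesis by simp
    next
      case False
      then have "h n x = 0" for n
        using ar(2)[of n] ball_subset_cball[of "a n" "r n"] h_pos[of n x] h_nonneg[of n x] by (auto simp: less_le)
      with False show ?thesis by (simp add: \<theta>_def flat_exp_simps)
    qed
  qed
qed

section \<open>The fundamental lemma and density of test functions\<close>

lemma integral_bounded_convergence:
  fixes H :: "'a \<Rightarrow> 'b::{banach, second_countable_topology}" and s :: "nat \<Rightarrow> 'a \<Rightarrow> real"
  assumes H: "integrable M H" and s: "\<And>n. s n \<in> borel_measurable M" "s' \<in> borel_measurable M"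
    and bd: "\<And>n. AE x in M. \<bar>s n x\<bar> \<le> K" and lim: "AE x in M. (\<lambda>n. s n x) \<longlonglongrightarrow> s' x"
  shows "(\<lambda>n. \<integral>x. s n x *\<^sub>R H x \<partial>M) \<longlonglongrightarrow> (\<integral>x. s' x *\<^sub>R H x \<partial>M)"
proof (rule integral_dominated_convergence[where w="\<lambda>x. K * norm (H x)"])
  have [measurable]: "H \<in> borel_measurable M" using H by auto
  show "(\<lambda>x. s' x *\<^sub>R H x) \<in> borel_measurable M" "(\<lambda>x. s n x *\<^sub>R H x) \<in> borel_measurable M" for n
    using s by (auto intro!: borel_measurable_scaleR)
  show "integrable M (\<lambda>x. K * norm (H x))" using H by auto
  show "AE x in M. (\<lambda>n. s n x *\<^sub>R H x) \<longlonglongrightarrow> s' x *\<^sub>R H x"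
    using lim by eventually_elim (intro tendsto_intros)
  show "AE x in M. norm (s n x *\<^sub>R H x) \<le> K * norm (H x)" for n
    using bd[of n] by eventually_elim (simp add: mult_right_mono)
qed

lemma lebesgue_on_continuous_measurable:
  fixes f :: "'a::euclidean_space \<Rightarrow> 'b::euclidean_space"
  shows "open S \<Longrightarrow> continuous_on S f \<Longrightarrow> f \<in> borel_measurable (lebesgue_on S)"
  by (intro continuous_imp_measurable_on_sets_lebesgue) auto

lemma lebesgue_on_indicator_measurable:
  "A \<in> sets lebesgue \<Longrightarrow> indicat_real A \<in> borel_measurable (lebesgue_on S)"
  by (intro measurable_restrict_space1 borel_measurable_indicator) auto

lemma test_functions_measurable:
  fixes \<phi> :: "'a::euclidean_space \<Rightarrow> real"
  assumes "open S" "\<phi> \<in> test_functions U"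
  shows "\<phi> \<in> borel_measurable (lebesgue_on S)" "grad \<phi> \<in> borel_measurable (lebesgue_on S)"
  using assms test_functions_smooth
  by (auto intro!: lebesgue_on_continuous_measurable smooth_continuous_on continuous_on_grad)

text \<open>Intersecting the first open supersets makes the approximation decreasing, so the
  indicators converge at every point outside the null set \<open>(\<Inter>n. T n) - A\<close>,
  without passing to a subsequence.\<close>

lemma outer_open_approximation:
  fixes A :: "'a::euclidean_space set"
  assumes A: "A \<in> sets lebesgue" "A \<subseteq> \<Omega>" and "open \<Omega>"
  obtains U :: "nat \<Rightarrow> 'a set" where "\<And>n. open (U n)" "\<And>n. A \<subseteq> U n" "\<And>n. U n \<subseteq> \<Omega>"
    "AE x in lebesgue. (\<lambda>n. indicat_real (U n) x) \<longlonglongrightarrow> indicator A x"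
proof -
  have "\<exists>T. open T \<and> A \<subseteq> T \<and> (T - A) \<in> lmeasurable \<and> emeasure lebesgue (T - A) < ennreal (1 / Suc n)" for n
    using sets_lebesgue_outer_open[OF A(1), of "1 / Suc n"] by (metis of_nat_0_less_iff zero_less_Suc zero_less_divide_1_iff)
  then obtain T where T: "\<And>n. open (T n)" "\<And>n. A \<subseteq> T n" "\<And>n. (T n - A) \<in> lmeasurable"
    "\<And>n. emeasure lebesgue (T n - A) < ennreal (1 / Suc n)" by metis
  define U where "U n = \<Omega> \<inter> (\<Inter>k\<le>n. T k)" for n
  have null: "(\<Inter>n. T n) - A \<in> null_sets lebesgue"
  proof -
    have sets: "(\<Inter>n. T n) - A \<in> sets lebesgue"
      using A T(1) by (intro sets.Diff sets.countable_INT) auto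
    have "emeasure lebesgue ((\<Inter>n. T n) - A) \<le> ennreal e" if "e > 0" for e
    proof -
      obtain n where n: "1 / Suc n < e" using nat_approx_posE[OF \<open>e > 0\<close>] by blast
      have "emeasure lebesgue ((\<Inter>n. T n) - A) \<le> emeasure lebesgue (T n - A)"
        using T(3) by (intro emeasure_mono) (auto simp: fmeasurable_def)
      also have "\<dots> \<le> ennreal e"
        using T(4)[of n] n by (meson dual_order.trans ennreal_leI less_imp_le)
      finally show ?thesis .
    qed
    then have "emeasure lebesgue ((\<Inter>n. T n) - A) \<le> 0"
      by - (rule ennreal_le_epsilon, simp)
    with sets show ?thesis by (simp add: null_sets_def)
  qed
  show thesis
  proof (rule that[of U])
    show "open (U n)" for n unfolding U_def using \<open>open \<Omega>\<close> T by (intro open_Int open_INT) auto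
    show "A \<subseteq> U n" "U n \<subseteq> \<Omega>" for n using A T by (auto simp: U_def)
    have "AE x in lebesgue. x \<notin> (\<Inter>n. T n) - A" using null by (rule AE_not_in)
    then show "AE x in lebesgue. (\<lambda>n. indicat_real (U n) x) \<longlonglongrightarrow> indicator A x"
    proof eventually_elim
      case (elim x)
      show ?case
      proof (cases "x \<in> A")
        case True
        then have "x \<in> U n" for n using A T by (auto simp: U_def)
        with True show ?thesis by simp
      next
        case False
        then obtain m where m: "x \<notin> T m" using elim by auto
        have "\<forall>\<^sub>F n in sequentially. indicator A x = indicat_real (U n) x"
          using eventually_ge_at_top[of m] by eventually_elim (use m False in \<open>auto simp: U_def indicator_def\<close>)
        then show ?thesis by (rule tendsto_eventually[OF eventually_mono]) auto
      qed
    qed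
  qed
qed

lemma test_functions_integrable_mult:
  fixes H :: "'a::euclidean_space \<Rightarrow> 'b::euclidean_space"
  assumes "open S" "\<phi> \<in> test_functions U" and H: "integrable (lebesgue_on S) H"
  shows "integrable (lebesgue_on S) (\<lambda>x. \<phi> x *\<^sub>R H x)"
proof -
  obtain B where B: "\<And>x. \<bar>\<phi> x\<bar> \<le> B" using test_functions_grad_bounded[OF assms(2)] by metis
  show ?thesis
  proof (rule Bochner_Integration.integrable_bound)
    show "integrable (lebesgue_on S) (\<lambda>x. B *\<^sub>R H x)" using H by auto
    show "(\<lambda>x. \<phi> x *\<^sub>R H x) \<in> borel_measurable (lebesgue_on S)"
      using H assms by (intro borel_measurable_scaleR test_functions_measurable) auto
    show "AE x in lebesgue_on S. norm (\<phi> x *\<^sub>R H x) \<le> norm (B *\<^sub>R H x)"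
      using B by (intro AE_I2) (simp add: mult_right_mono order_trans[OF B abs_ge_self])
  qed
qed

text \<open>The inequality is extended from test functions to indicators of open sets by exhaustion,
  and then to the indicator of the measurable set \<open>A\<close> where \<open>H\<close> is
  negative by outer approximation. There the integral is both nonnegative and nonpositive, which
  forces \<open>A\<close> to be null. No mollification is involved.\<close>

lemma fundamental_lemma_nonneg:
  fixes H :: "'a::euclidean_space \<Rightarrow> real"
  assumes "open \<Omega>" and H: "integrable (lebesgue_on \<Omega>) H"
    and test: "\<And>\<phi>. \<phi> \<in> test_functions \<Omega> \<Longrightarrow> (\<And>x. 0 \<le> \<phi> x) \<Longrightarrow> 0 \<le> (\<integral>x. \<phi> x * H x \<partial>lebesgue_on \<Omega>)"
  shows "AE x in lebesgue_on \<Omega>. 0 \<le> H x"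
proof -
  let ?M = "lebesgue_on \<Omega>"
  have \<Omega>: "\<Omega> \<in> sets lebesgue" using \<open>open \<Omega>\<close> by auto
  have U: "0 \<le> (\<integral>x. indicator U x * H x \<partial>?M)" if "open U" "U \<subseteq> \<Omega>" for U
  proof -
    obtain \<theta> where \<theta>: "\<And>n. \<theta> n \<in> test_functions U" "\<And>n x. 0 \<le> \<theta> n x" "\<And>n x. \<theta> n x \<le> 1"
      "\<And>x. (\<lambda>n. \<theta> n x) \<longlonglongrightarrow> indicator U x"
      using open_exhausting_test_functions[OF \<open>open U\<close>] by metis
    have "(\<lambda>n. \<integral>x. \<theta> n x *\<^sub>R H x \<partial>?M) \<longlonglongrightarrow> (\<integral>x. indicator U x *\<^sub>R H x \<partial>?M)"
      by (rule integral_bounded_convergence[OF H, where K=1])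
         (use \<theta> that \<open>open \<Omega>\<close> in \<open>auto intro!: test_functions_measurable(1) lebesgue_on_indicator_measurable\<close>)
    moreover have "0 \<le> (\<integral>x. \<theta> n x *\<^sub>R H x \<partial>?M)" for n
      using test[of "\<theta> n"] \<theta> test_functions_mono[OF \<open>U \<subseteq> \<Omega>\<close>] by (simp add: subset_iff)
    ultimately show ?thesis by (simp add: LIMSEQ_le_const)
  qed
  define A where "A = {x \<in> \<Omega>. H x < 0}"
  have [measurable]: "H \<in> borel_measurable ?M" using H by auto
  have A_on: "A \<in> sets ?M"
  proof -
    have "{x \<in> space ?M. H x < 0} \<in> sets ?M" by measurable
    then show ?thesis by (simp add: A_def)
  qed
  then have A: "A \<in> sets lebesgue" "A \<subseteq> \<Omega>"
    using \<Omega> by (auto simp: sets_restrict_space_iff A_def)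
  obtain V where V: "\<And>n. open (V n)" "\<And>n. V n \<subseteq> \<Omega>"
    "AE x in lebesgue. (\<lambda>n. indicat_real (V n) x) \<longlonglongrightarrow> indicator A x"
    using outer_open_approximation[OF A \<open>open \<Omega>\<close>] by metis
  have "(\<lambda>n. \<integral>x. indicat_real (V n) x *\<^sub>R H x \<partial>?M) \<longlonglongrightarrow> (\<integral>x. indicator A x *\<^sub>R H x \<partial>?M)"
    by (rule integral_bounded_convergence[OF H, where K=1])
       (use V A \<Omega> in \<open>auto intro!: lebesgue_on_indicator_measurable AE_restrict_space_iff[THEN iffD2] elim: eventually_mono simp: indicator_le_1\<close>)
  moreover have "0 \<le> (\<integral>x. indicat_real (V n) x *\<^sub>R H x \<partial>?M)" for n
    using U[of "V n"] V by auto
  ultimately have "0 \<le> (\<integral>x. indicator A x *\<^sub>R H x \<partial>?M)"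
    by (simp add: LIMSEQ_le_const)
  moreover have int: "integrable ?M (\<lambda>x. - (indicator A x *\<^sub>R H x))"
    using H A_on by (intro Bochner_Integration.integrable_minus integrable_mult_indicator)
  moreover have nn: "0 \<le> - (indicator A x *\<^sub>R H x)" for x
    by (auto simp: A_def indicator_def)
  ultimately have "(\<integral>x. - (indicator A x *\<^sub>R H x) \<partial>?M) = 0"
    using Bochner_Integration.integral_nonneg[of ?M "\<lambda>x. - (indicator A x *\<^sub>R H x)"] by simp
  then have "AE x in ?M. - (indicator A x *\<^sub>R H x) = 0"
    using integral_nonneg_eq_0_iff_AE[OF int] nn by simp
  moreover have "AE x in ?M. x \<in> \<Omega>" by (rule AE_I2) simp
  ultimately show ?thesis
  proof eventually_elim
    case (elim x)
    then show ?case by (cases "x \<in> A") (simp_all add: A_def)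
  qed
qed

lemma fundamental_lemma_real:
  fixes H :: "'a::euclidean_space \<Rightarrow> real"
  assumes "open \<Omega>" and H: "integrable (lebesgue_on \<Omega>) H"
    and test: "\<And>\<phi>. \<phi> \<in> test_functions \<Omega> \<Longrightarrow> (\<integral>x. \<phi> x * H x \<partial>lebesgue_on \<Omega>) = 0"
  shows "AE x in lebesgue_on \<Omega>. H x = 0"
proof -
  have "AE x in lebesgue_on \<Omega>. 0 \<le> H x" "AE x in lebesgue_on \<Omega>. 0 \<le> - H x"
    using test H by (intro fundamental_lemma_nonneg assms; simp)+
  then show ?thesis by eventually_elim auto
qed

lemma fundamental_lemma:
  fixes H :: "'a::euclidean_space \<Rightarrow> 'b::euclidean_space"
  assumes "open \<Omega>" and H: "integrable (lebesgue_on \<Omega>) H"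
    and test: "\<And>\<phi>. \<phi> \<in> test_functions \<Omega> \<Longrightarrow> (\<integral>x. \<phi> x *\<^sub>R H x \<partial>lebesgue_on \<Omega>) = 0"
  shows "AE x in lebesgue_on \<Omega>. H x = 0"
proof -
  have "AE x in lebesgue_on \<Omega>. H x \<bullet> i = 0" for i
  proof (rule fundamental_lemma_real[OF \<open>open \<Omega>\<close>])
    show "integrable (lebesgue_on \<Omega>) (\<lambda>x. H x \<bullet> i)" using H by auto
    show "(\<integral>x. \<phi> x * (H x \<bullet> i) \<partial>lebesgue_on \<Omega>) = 0" if "\<phi> \<in> test_functions \<Omega>" for \<phi>
    proof -
      have "integrable (lebesgue_on \<Omega>) (\<lambda>x. \<phi> x *\<^sub>R H x)"
        by (rule test_functions_integrable_mult[OF \<open>open \<Omega>\<close> that H])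
      then have "(\<integral>x. (\<phi> x *\<^sub>R H x) \<bullet> i \<partial>lebesgue_on \<Omega>) = 0"
        by (subst integral_inner_left) (auto simp: test[OF that])
      then show ?thesis by simp
    qed
  qed
  then have "AE x in lebesgue_on \<Omega>. \<forall>i\<in>Basis. H x \<bullet> i = 0"
    by (intro AE_finite_allI) auto
  then show ?thesis
    by eventually_elim (simp add: euclidean_all_zero_iff)
qed

text \<open>Induction over integrable functions: an indicator is approximated by the indicator of an
  open superset, and this in turn by an exhausting test function; sums and dominated limits keep the
  property.\<close>

lemma test_functions_dense_L1:
  fixes f :: "'a::euclidean_space \<Rightarrow> real"
  assumes "open \<Omega>" "bounded \<Omega>" and f: "integrable (lebesgue_on \<Omega>) f" and "e > 0"
  obtains \<phi> where "\<phi> \<in> test_functions \<Omega>" "(\<integral>x. \<bar>f x - \<phi> x\<bar> \<partial>lebesgue_on \<Omega>) < e"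
proof -
  let ?M = "lebesgue_on \<Omega>"
  have \<Omega>: "\<Omega> \<in> sets lebesgue" "\<Omega> \<in> lmeasurable"
    using assms by (auto simp: bounded_set_imp_lmeasurable)
  have one: "integrable ?M (\<lambda>x. 1::real)"
    using finite_measure.integrable_const[OF finite_measure_lebesgue_on[OF \<Omega>(2)]] .
  have test_int: "integrable ?M \<phi>" if "\<phi> \<in> test_functions \<Omega>" for \<phi> :: "'a \<Rightarrow> real"
    using test_functions_integrable_mult[OF \<open>open \<Omega>\<close> that one] by simp
  have "\<forall>e>0. \<exists>\<phi>\<in>test_functions \<Omega>. (\<integral>x. \<bar>f x - \<phi> x\<bar> \<partial>?M) < e"
    using f
  proof (induction rule: integrable_induct)
    case (base A c)
    have A: "A \<in> sets lebesgue" "A \<subseteq> \<Omega>"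
      using base \<Omega> by (auto simp: sets_restrict_space_iff)
    show ?case
    proof (intro allI impI)
      fix e :: real assume "e > 0"
      \<comment> \<open>Two approximations are made, each with error below \<open>e'\<close>, and
        scaled by \<open>\<bar>c\<bar>\<close>; the \<open>+ 1\<close> covers \<open>c = 0\<close>
        and makes the final inequality strict.\<close>
      define e' where "e' = e / (\<bar>c\<bar> + 1) / 2"
      have "e' > 0" using \<open>e > 0\<close> by (simp add: e'_def add_nonneg_pos)
      have "2 * (e / K / 2) * K = e" if "K \<noteq> 0" for K :: real using that by simp
      from this[of "\<bar>c\<bar> + 1"] have "2 * e' * (\<bar>c\<bar> + 1) = e" unfolding e'_def by linarith
      obtain U where U: "\<And>n. open (U n)" "\<And>n. U n \<subseteq> \<Omega>"
        "AE x in lebesgue. (\<lambda>n. indicat_real (U n) x) \<longlonglongrightarrow> indicator A x"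
        using outer_open_approximation[OF A \<open>open \<Omega>\<close>] by metis
      have "(\<lambda>n. \<integral>x. \<bar>indicator A x - indicat_real (U n) x\<bar> *\<^sub>R (1::real) \<partial>?M) \<longlonglongrightarrow> (\<integral>x. 0 *\<^sub>R (1::real) \<partial>?M)"
      proof (rule integral_bounded_convergence[OF one, where K=1])
        have "AE x in ?M. (\<lambda>n. indicat_real (U n) x) \<longlonglongrightarrow> indicator A x"
          using U(3) \<Omega> by (simp add: AE_restrict_space_iff) (auto elim: eventually_mono)
        then show "AE x in ?M. (\<lambda>n. \<bar>indicator A x - indicat_real (U n) x\<bar>) \<longlonglongrightarrow> 0"
          by eventually_elim (rule tendsto_eq_intros refl | simp)+
        show "(\<lambda>x. \<bar>indicator A x - indicat_real (U n) x\<bar>) \<in> borel_measurable ?M" for n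
          using A U(1) by (intro borel_measurable_abs borel_measurable_diff lebesgue_on_indicator_measurable) auto
      qed (auto simp: indicator_def)
      then have "\<forall>\<^sub>F n in sequentially. (\<integral>x. \<bar>indicator A x - indicat_real (U n) x\<bar> \<partial>?M) < e'"
        using \<open>e' > 0\<close> by (intro order_tendstoD(2)[where y=0]) auto
      then obtain n where n: "(\<integral>x. \<bar>indicator A x - indicat_real (U n) x\<bar> \<partial>?M) < e'"
        using eventually_happens by fastforce
      obtain \<theta> where \<theta>: "\<And>k. \<theta> k \<in> test_functions (U n)" "\<And>k x. 0 \<le> \<theta> k x" "\<And>k x. \<theta> k x \<le> 1"
        "\<And>x. (\<lambda>k. \<theta> k x) \<longlonglongrightarrow> indicator (U n) x"
        using open_exhausting_test_functions[OF U(1)] by metis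
      have "(\<lambda>k. \<integral>x. \<bar>indicator (U n) x - \<theta> k x\<bar> *\<^sub>R (1::real) \<partial>?M) \<longlonglongrightarrow> (\<integral>x. 0 *\<^sub>R (1::real) \<partial>?M)"
      proof (rule integral_bounded_convergence[OF one, where K=1])
        show "AE x in ?M. (\<lambda>k. \<bar>indicator (U n) x - \<theta> k x\<bar>) \<longlonglongrightarrow> 0"
          by (rule AE_I2) (rule tendsto_eq_intros \<theta>(4) refl | simp)+
        show "(\<lambda>x. \<bar>indicator (U n) x - \<theta> k x\<bar>) \<in> borel_measurable ?M" for k
          using \<theta> U(1) \<open>open \<Omega>\<close>
          by (intro borel_measurable_abs borel_measurable_diff lebesgue_on_indicator_measurable test_functions_measurable(1)) auto
        show "AE x in ?M. \<bar>\<bar>indicator (U n) x - \<theta> k x\<bar>\<bar> \<le> 1" for k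
        proof (rule AE_I2)
          fix x show "\<bar>\<bar>indicator (U n) x - \<theta> k x\<bar>\<bar> \<le> 1"
            using \<theta>(2,3)[of k x] by (cases "x \<in> U n") auto
        qed
      qed auto
      then have "\<forall>\<^sub>F k in sequentially. (\<integral>x. \<bar>indicator (U n) x - \<theta> k x\<bar> \<partial>?M) < e'"
        using \<open>e' > 0\<close> by (intro order_tendstoD(2)[where y=0]) auto
      then obtain k where k: "(\<integral>x. \<bar>indicator (U n) x - \<theta> k x\<bar> \<partial>?M) < e'"
        using eventually_happens by fastforce
      have \<theta>k: "\<theta> k \<in> test_functions \<Omega>" using \<theta>(1) test_functions_mono[OF U(2)] by blast
      have int: "integrable ?M (indicat_real A)" "integrable ?M (indicat_real (U n))" "integrable ?M (\<theta> k)"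
        using integrable_mult_indicator[OF _ one, of A] integrable_mult_indicator[OF _ one, of "U n"] U(1,2)[of n] A \<Omega> test_int[OF \<theta>k]
        by (auto simp: sets_restrict_space_iff)
      have "(\<integral>x. \<bar>indicator A x *\<^sub>R c - c * \<theta> k x\<bar> \<partial>?M)
        \<le> (\<integral>x. \<bar>c\<bar> * (\<bar>indicator A x - indicat_real (U n) x\<bar> + \<bar>indicator (U n) x - \<theta> k x\<bar>) \<partial>?M)"
      proof (rule integral_mono)
        show "\<bar>indicator A x *\<^sub>R c - c * \<theta> k x\<bar>
          \<le> \<bar>c\<bar> * (\<bar>indicator A x - indicat_real (U n) x\<bar> + \<bar>indicator (U n) x - \<theta> k x\<bar>)" for x
        proof -
          have "\<bar>indicator A x *\<^sub>R c - c * \<theta> k x\<bar> = \<bar>c\<bar> * \<bar>indicator A x - \<theta> k x\<bar>"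
            by (simp add: abs_mult[symmetric] algebra_simps)
          also have "\<dots> \<le> \<bar>c\<bar> * (\<bar>indicator A x - indicat_real (U n) x\<bar> + \<bar>indicator (U n) x - \<theta> k x\<bar>)"
            by (intro mult_left_mono) auto
          finally show ?thesis .
        qed
      qed (use int in auto)
      also have "\<dots> = \<bar>c\<bar> * ((\<integral>x. \<bar>indicator A x - indicat_real (U n) x\<bar> \<partial>?M) + (\<integral>x. \<bar>indicator (U n) x - \<theta> k x\<bar> \<partial>?M))"
        using int by (subst integral_mult_right_zero, subst Bochner_Integration.integral_add) auto
      also have "\<dots> \<le> \<bar>c\<bar> * (e' + e')" using n k by (intro mult_left_mono) auto
      also have "\<dots> < e" using \<open>2 * e' * (\<bar>c\<bar> + 1) = e\<close> \<open>e' > 0\<close> by (simp add: algebra_simps)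
      finally show "\<exists>\<phi>\<in>test_functions \<Omega>. (\<integral>x. \<bar>indicator A x *\<^sub>R c - \<phi> x\<bar> \<partial>?M) < e"
        by (intro bexI[of _ "\<lambda>x. c * \<theta> k x"] test_functions_cmult[OF \<theta>k])
    qed
  next
    case (add f g)
    show ?case
    proof (intro allI impI)
      fix e :: real assume "e > 0"
      then obtain \<phi> \<psi> where \<phi>: "\<phi> \<in> test_functions \<Omega>" "(\<integral>x. \<bar>f x - \<phi> x\<bar> \<partial>?M) < e / 2"
        and \<psi>: "\<psi> \<in> test_functions \<Omega>" "(\<integral>x. \<bar>g x - \<psi> x\<bar> \<partial>?M) < e / 2"
        using add(3,4) by (metis half_gt_zero)
      note int = add(1,2) test_int[OF \<phi>(1)] test_int[OF \<psi>(1)]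
      have "(\<integral>x. \<bar>f x + g x - (\<phi> x + \<psi> x)\<bar> \<partial>?M) \<le> (\<integral>x. \<bar>f x - \<phi> x\<bar> + \<bar>g x - \<psi> x\<bar> \<partial>?M)"
        using int by (intro integral_mono) auto
      also have "\<dots> < e"
        using \<phi> \<psi> int by (subst Bochner_Integration.integral_add) auto
      finally show "\<exists>\<phi>\<in>test_functions \<Omega>. (\<integral>x. \<bar>f x + g x - \<phi> x\<bar> \<partial>?M) < e"
        by (intro bexI[of _ "\<lambda>x. \<phi> x + \<psi> x"] test_functions_add[OF \<phi>(1) \<psi>(1)])
    qed
  next
    case (lim f s)
    show ?case
    proof (intro allI impI)
      fix e :: real assume "e > 0"
      have "(\<lambda>i. \<integral>x. \<bar>f x - s i x\<bar> \<partial>?M) \<longlonglongrightarrow> (\<integral>x. 0 \<partial>?M)"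
      \<comment> \<open>The induction supplies
        \<open>\<bar>s i x\<bar> \<le> 2 * \<bar>f x\<bar>\<close>, whence a majorant with factor
        3.\<close>
      proof (rule integral_dominated_convergence[where w="\<lambda>x. 3 * \<bar>f x\<bar>"])
        show "AE x in ?M. (\<lambda>i. \<bar>f x - s i x\<bar>) \<longlonglongrightarrow> 0"
        proof (rule AE_I2)
          fix x assume "x \<in> space ?M"
          then have "(\<lambda>i. \<bar>f x - s i x\<bar>) \<longlonglongrightarrow> \<bar>f x - f x\<bar>" using lim by (intro tendsto_intros)
          then show "(\<lambda>i. \<bar>f x - s i x\<bar>) \<longlonglongrightarrow> 0" by simp
        qed
        show "AE x in ?M. norm \<bar>f x - s i x\<bar> \<le> 3 * \<bar>f x\<bar>" for i
          using lim.hyps(3)[of _ i] by (intro AE_I2) force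
      qed (use lim in auto)
      then have "\<forall>\<^sub>F i in sequentially. (\<integral>x. \<bar>f x - s i x\<bar> \<partial>?M) < e / 2"
        using \<open>e > 0\<close> by (intro order_tendstoD(2)[where y=0]) auto
      then obtain i where i: "(\<integral>x. \<bar>f x - s i x\<bar> \<partial>?M) < e / 2"
        using eventually_happens by fastforce
      obtain \<phi> where \<phi>: "\<phi> \<in> test_functions \<Omega>" "(\<integral>x. \<bar>s i x - \<phi> x\<bar> \<partial>?M) < e / 2"
        using lim.IH[of i] \<open>e > 0\<close> by (metis half_gt_zero)
      note int = lim.hyps(1)[of i] lim.hyps(4) test_int[OF \<phi>(1)]
      have "(\<integral>x. \<bar>f x - \<phi> x\<bar> \<partial>?M) \<le> (\<integral>x. \<bar>f x - s i x\<bar> + \<bar>s i x - \<phi> x\<bar> \<partial>?M)"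
        using int by (intro integral_mono) auto
      also have "\<dots> < e"
        using \<phi> i int by (subst Bochner_Integration.integral_add) auto
      finally show "\<exists>\<phi>\<in>test_functions \<Omega>. (\<integral>x. \<bar>f x - \<phi> x\<bar> \<partial>?M) < e"
        using \<phi>(1) by blast
    qed
  qed
  then show thesis using \<open>e > 0\<close> that by blast
qed

section \<open>Lebesgue spaces and Fubini's theorem\<close>

lemma in_Linf_AE_le_norm:
  fixes f :: "'a \<Rightarrow> 'b::euclidean_space"
  assumes "in_Linf M f"
  shows "AE x in M. norm (f x) \<le> Linf_norm M f" and "0 \<le> Linf_norm M f"
proof -
  have [measurable]: "f \<in> borel_measurable M" using assms by (simp add: in_Linf_def)
  obtain K where K: "AE x in M. norm (f x) \<le> K" using assms by (auto simp: in_Linf_def)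
  let ?g = "\<lambda>x. ereal (norm (f x))"
  have g[measurable]: "?g \<in> borel_measurable M" by measurable
  have le: "esssup M ?g \<le> ereal K"
    by (rule esssup_I[OF g]) (use K in simp)
  have "(AE x in M. norm (f x) \<le> Linf_norm M f) \<and> 0 \<le> Linf_norm M f"
  proof (cases "emeasure M (space M) = 0")
    \<comment> \<open>On a null space every property holds almost everywhere, and the norm is the
      default \<open>0\<close> that \<open>real_of_ereal\<close> assigns to
      \<open>-\<infinity>\<close>.\<close>
    case True
    then have bot: "ae_filter M = bot" using ae_filter_eq_bot_iff[of M] by blast
    have *: "AE x in M. P x" for P unfolding bot by simp
    have "esssup M ?g \<le> ereal k" for k
      by (rule esssup_I[OF g *])
    then have "esssup M ?g = -\<infinity>" by (metis ereal_bot)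
    with * show ?thesis by (simp add: Linf_norm_def)
  next
    case False
    have "esssup M (\<lambda>x. 0::ereal) \<le> esssup M ?g" by (rule esssup_mono) auto
    then have "0 \<le> esssup M ?g" using esssup_const[OF False, of "0::ereal"] by simp
    with le obtain r where "esssup M ?g = ereal r" "0 \<le> r" by (cases "esssup M ?g") auto
    with esssup_AE[of ?g M] show ?thesis by (simp add: Linf_norm_def)
  qed
  then show "AE x in M. norm (f x) \<le> Linf_norm M f" "0 \<le> Linf_norm M f" by auto
qed

text \<open>Here \<open>0 \<le> K\<close> accounts for null spaces, where the norm is
  \<open>0\<close> and every \<open>K\<close> is an essential bound.\<close>

lemma Linf_norm_le:
  fixes f :: "'a \<Rightarrow> 'b::euclidean_space"
  assumes f: "f \<in> borel_measurable M" and "AE x in M. norm (f x) \<le> K" "0 \<le> K"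
  shows "Linf_norm M f \<le> K"
proof -
  have g[measurable]: "(\<lambda>x. ereal (norm (f x))) \<in> borel_measurable M" using f by measurable
  have "esssup M (\<lambda>x. ereal (norm (f x))) \<le> ereal K"
    by (rule esssup_I[OF g]) (use assms in simp)
  then show ?thesis
    unfolding Linf_norm_def using \<open>0 \<le> K\<close> by (cases "esssup M (\<lambda>x. ereal (norm (f x)))") auto
qed

lemma in_L2_integrable:
  fixes f :: "'a \<Rightarrow> 'b::euclidean_space"
  assumes "finite_measure M" "in_L2 M f" shows "integrable M f"
proof (rule Bochner_Integration.integrable_bound)
  show "integrable M (\<lambda>x. 1 + (norm (f x))\<^sup>2)"
    using assms by (intro Bochner_Integration.integrable_add finite_measure.integrable_const) (auto simp: in_L2_def)
  show "f \<in> borel_measurable M" using assms by (simp add: in_L2_def)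
  have "r \<le> 1 + r\<^sup>2" for r :: real
    using sum_power2_ge_zero[of "r - 1" 0] zero_le_power2[of r] by (simp add: power2_eq_square algebra_simps) (smt (verit) zero_le_square)
  then show "AE x in M. norm (f x) \<le> norm (1 + (norm (f x))\<^sup>2)"
    by (intro AE_I2) (metis abs_ge_self order_trans real_norm_def)
qed

lemma in_L2_mult_integrable:
  fixes f :: "'a \<Rightarrow> 'b::euclidean_space" and g :: "'a \<Rightarrow> 'b"
  assumes "in_L2 M f" "in_L2 M g"
  shows "integrable M (\<lambda>x. f x \<bullet> g x)" "integrable M (\<lambda>x. norm (f x) * norm (g x))"
proof -
  have [measurable]: "f \<in> borel_measurable M" "g \<in> borel_measurable M"
    using assms by (auto simp: in_L2_def)
  have int: "integrable M (\<lambda>x. (norm (f x))\<^sup>2 + (norm (g x))\<^sup>2)"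
    using assms by (intro Bochner_Integration.integrable_add) (auto simp: in_L2_def)
  have le: "norm (f x) * norm (g x) \<le> (norm (f x))\<^sup>2 + (norm (g x))\<^sup>2" for x
    using sum_squares_bound[of "norm (f x)" "norm (g x)"] mult_nonneg_nonneg[OF norm_ge_zero norm_ge_zero, of "f x" "g x"]
    by linarith
  show "integrable M (\<lambda>x. norm (f x) * norm (g x))"
    by (rule Bochner_Integration.integrable_bound[OF int]) (use le in \<open>auto intro!: AE_I2\<close>)
  show "integrable M (\<lambda>x. f x \<bullet> g x)"
  proof (rule Bochner_Integration.integrable_bound[OF int])
    show "AE x in M. norm (f x \<bullet> g x) \<le> norm ((norm (f x))\<^sup>2 + (norm (g x))\<^sup>2)"
      by (intro AE_I2) (use le Cauchy_Schwarz_ineq2 order_trans in \<open>fastforce\<close>)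
  qed measurable
qed

text \<open>Instead of the Cauchy-Schwarz inequality, Young's inequality with a small parameter is
  enough to pass to the limit.\<close>

lemma L2_null_sequence:
  fixes f :: "'a \<Rightarrow> real" and h :: "nat \<Rightarrow> 'a \<Rightarrow> 'b::euclidean_space"
  assumes f: "in_L2 M f" and h: "\<And>n. in_L2 M (h n)"
    and lim: "(\<lambda>n. \<integral>x. (norm (h n x))\<^sup>2 \<partial>M) \<longlonglongrightarrow> 0"
  shows "(\<lambda>n. \<integral>x. \<bar>f x\<bar> * norm (h n x) \<partial>M) \<longlonglongrightarrow> 0"
proof (rule LIMSEQ_I)
  fix e :: real assume "e > 0"
  define F where "F = (\<integral>x. (f x)\<^sup>2 \<partial>M)"
  have [measurable]: "f \<in> borel_measurable M" "h n \<in> borel_measurable M" for n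
    using f h by (auto simp: in_L2_def)
  have intf: "integrable M (\<lambda>x. (f x)\<^sup>2)" and inth: "integrable M (\<lambda>x. (norm (h n x))\<^sup>2)" for n
    using f h by (auto simp: in_L2_def)
  have "F \<ge> 0" unfolding F_def by simp
  \<comment> \<open>The parameter in Young's inequality: it makes \<open>d * F\<close> smaller than
    \<open>e\<close>, where the \<open>+ 1\<close> covers \<open>F = 0\<close>. The remaining margin
    \<open>e - d * F\<close> is given to the term with \<open>h n\<close>.\<close>
  define d where "d = e / (2 * (F + 1))"
  have "d > 0" using \<open>e > 0\<close> \<open>F \<ge> 0\<close> by (simp add: d_def)
  have div: "e / K * K = e" if "K > 0" for K :: real using that by simp
  have "0 < 2 * (F + 1)" using \<open>F \<ge> 0\<close> by simp
  from div[OF this] have "d * (2 * (F + 1)) = e" by (simp only: d_def)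
  then have "e = 2 * (d * F) + 2 * d" by (simp add: algebra_simps)
  moreover have "0 \<le> d * F" using \<open>F \<ge> 0\<close> \<open>d > 0\<close> by simp
  ultimately have "d * F < e" using \<open>d > 0\<close> by linarith
  have "\<forall>\<^sub>F n in sequentially. (\<integral>x. (norm (h n x))\<^sup>2 \<partial>M) < d * (e - d * F)"
    using lim \<open>d > 0\<close> \<open>d * F < e\<close> by (intro order_tendstoD(2)) auto
  then obtain N where N: "\<And>n. n \<ge> N \<Longrightarrow> (\<integral>x. (norm (h n x))\<^sup>2 \<partial>M) < d * (e - d * F)"
    by (auto simp: eventually_sequentially)
  have "norm ((\<integral>x. \<bar>f x\<bar> * norm (h n x) \<partial>M) - 0) < e" if "n \<ge> N" for n
  proof -
    have young: "\<bar>f x\<bar> * norm (h n x) \<le> d * (f x)\<^sup>2 + (norm (h n x))\<^sup>2 / d" for x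
    proof -
      have "d * (\<bar>f x\<bar> * norm (h n x)) * 2 \<le> (d * \<bar>f x\<bar>)\<^sup>2 + (norm (h n x))\<^sup>2"
        using sum_squares_bound[of "d * \<bar>f x\<bar>" "norm (h n x)"] by (simp add: algebra_simps)
      moreover have "0 \<le> d * (\<bar>f x\<bar> * norm (h n x))" using \<open>d > 0\<close> by simp
      ultimately have "d * (\<bar>f x\<bar> * norm (h n x)) \<le> (d * \<bar>f x\<bar>)\<^sup>2 + (norm (h n x))\<^sup>2"
        by linarith
      also have "\<dots> = d * (d * (f x)\<^sup>2 + (norm (h n x))\<^sup>2 / d)"
        using \<open>d > 0\<close> by (simp add: power_mult_distrib distrib_left power2_eq_square)
      finally have "d * (\<bar>f x\<bar> * norm (h n x)) \<le> d * (d * (f x)\<^sup>2 + (norm (h n x))\<^sup>2 / d)" .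
      then show ?thesis using \<open>d > 0\<close> by (simp only: mult_le_cancel_left_pos)
    qed
    have "(\<integral>x. \<bar>f x\<bar> * norm (h n x) \<partial>M) \<le> (\<integral>x. d * (f x)\<^sup>2 + (norm (h n x))\<^sup>2 / d \<partial>M)"
    proof (rule integral_mono)
      show "integrable M (\<lambda>x. d * (f x)\<^sup>2 + (norm (h n x))\<^sup>2 / d)" using intf inth by auto
      then show "integrable M (\<lambda>x. \<bar>f x\<bar> * norm (h n x))"
        by (rule Bochner_Integration.integrable_bound) (use young in \<open>auto intro!: AE_I2 order_trans[OF young abs_ge_self]\<close>)
    qed (use young in auto)
    also have "\<dots> = d * F + (\<integral>x. (norm (h n x))\<^sup>2 \<partial>M) / d"
      using intf inth by (subst Bochner_Integration.integral_add) (auto simp: F_def)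
    also have "\<dots> < e"
      using N[OF that] \<open>d > 0\<close> by (simp add: field_simps)
    finally have "(\<integral>x. \<bar>f x\<bar> * norm (h n x) \<partial>M) < e" .
    moreover have "0 \<le> (\<integral>x. \<bar>f x\<bar> * norm (h n x) \<partial>M)" by simp
    ultimately show ?thesis by simp
  qed
  then show "\<exists>no. \<forall>n\<ge>no. norm ((\<integral>x. \<bar>f x\<bar> * norm (h n x) \<partial>M) - 0) < e" by blast
qed

lemma L2_norm_tendsto_0_iff:
  "(\<lambda>n. L2_norm M (h n)) \<longlonglongrightarrow> 0 \<longleftrightarrow> (\<lambda>n. \<integral>x. (norm (h n x))\<^sup>2 \<partial>M) \<longlonglongrightarrow> 0"
proof
  assume "(\<lambda>n. L2_norm M (h n)) \<longlonglongrightarrow> 0"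
  then have "(\<lambda>n. (L2_norm M (h n))\<^sup>2) \<longlonglongrightarrow> 0\<^sup>2" by (intro tendsto_power)
  then show "(\<lambda>n. \<integral>x. (norm (h n x))\<^sup>2 \<partial>M) \<longlonglongrightarrow> 0" by (simp add: L2_norm_def)
next
  assume "(\<lambda>n. \<integral>x. (norm (h n x))\<^sup>2 \<partial>M) \<longlonglongrightarrow> 0"
  then have "(\<lambda>n. sqrt (\<integral>x. (norm (h n x))\<^sup>2 \<partial>M)) \<longlonglongrightarrow> sqrt 0" by (intro tendsto_real_sqrt)
  then show "(\<lambda>n. L2_norm M (h n)) \<longlonglongrightarrow> 0" by (simp add: L2_norm_def)
qed

lemma in_L2_add:
  fixes f g :: "'a \<Rightarrow> 'b::euclidean_space"
  assumes "in_L2 M f" "in_L2 M g"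
  shows "in_L2 M (\<lambda>x. f x + g x)"
    and "(\<integral>x. (norm (f x + g x))\<^sup>2 \<partial>M) \<le> 2 * (\<integral>x. (norm (f x))\<^sup>2 \<partial>M) + 2 * (\<integral>x. (norm (g x))\<^sup>2 \<partial>M)"
proof -
  have [measurable]: "f \<in> borel_measurable M" "g \<in> borel_measurable M"
    using assms by (auto simp: in_L2_def)
  have int: "integrable M (\<lambda>x. (norm (f x))\<^sup>2)" "integrable M (\<lambda>x. (norm (g x))\<^sup>2)"
    using assms by (auto simp: in_L2_def)
  have le: "(norm (f x + g x))\<^sup>2 \<le> 2 * (norm (f x))\<^sup>2 + 2 * (norm (g x))\<^sup>2" for x
  proof -
    have "(norm (f x + g x))\<^sup>2 \<le> (norm (f x) + norm (g x))\<^sup>2"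
      by (intro power_mono norm_triangle_ineq) auto
    also have "\<dots> \<le> 2 * (norm (f x))\<^sup>2 + 2 * (norm (g x))\<^sup>2"
      using sum_squares_bound[of "norm (f x)" "norm (g x)"] by (simp add: power2_sum)
    finally show ?thesis .
  qed
  have int': "integrable M (\<lambda>x. 2 * (norm (f x))\<^sup>2 + 2 * (norm (g x))\<^sup>2)" using int by auto
  have sq: "integrable M (\<lambda>x. (norm (f x + g x))\<^sup>2)"
    by (rule Bochner_Integration.integrable_bound[OF int']) (use le in \<open>auto intro!: AE_I2 order_trans[OF le abs_ge_self]\<close>)
  then show "in_L2 M (\<lambda>x. f x + g x)" by (simp add: in_L2_def)
  show "(\<integral>x. (norm (f x + g x))\<^sup>2 \<partial>M) \<le> 2 * (\<integral>x. (norm (f x))\<^sup>2 \<partial>M) + 2 * (\<integral>x. (norm (g x))\<^sup>2 \<partial>M)"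
    using integral_mono[OF sq int' le] int by simp
qed

lemma in_L2_cmult:
  fixes f :: "'a \<Rightarrow> 'b::euclidean_space"
  shows "in_L2 M f \<Longrightarrow> in_L2 M (\<lambda>x. c *\<^sub>R f x)"
  by (auto simp: in_L2_def power_mult_distrib)

lemma in_L2_diff:
  fixes f g :: "'a \<Rightarrow> 'b::euclidean_space"
  shows "in_L2 M f \<Longrightarrow> in_L2 M g \<Longrightarrow> in_L2 M (\<lambda>x. f x - g x)"
  using in_L2_add(1)[OF _ in_L2_cmult, of M f g "-1"] by simp

lemma in_L2_bounded:
  fixes f :: "'a \<Rightarrow> 'b::euclidean_space"
  assumes "finite_measure M" "f \<in> borel_measurable M" "AE x in M. norm (f x) \<le> K"
  shows "in_L2 M f"
  unfolding in_L2_def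
proof
  show "integrable M (\<lambda>x. (norm (f x))\<^sup>2)"
  proof (rule Bochner_Integration.integrable_bound[OF finite_measure.integrable_const[OF assms(1), of "K\<^sup>2"]])
    show "AE x in M. norm ((norm (f x))\<^sup>2) \<le> norm (K\<^sup>2)"
      using assms(3) by eventually_elim (simp add: power_mono)
  qed (use assms in measurable)
qed fact

lemma integrable_mult_bounded:
  fixes f :: "'a \<Rightarrow> real" and g :: "'a \<Rightarrow> real"
  assumes f: "integrable M f" and g: "g \<in> borel_measurable M" "AE x in M. \<bar>g x\<bar> \<le> K"
  shows "integrable M (\<lambda>x. f x * g x)"
proof (rule Bochner_Integration.integrable_bound)
  show "integrable M (\<lambda>x. K * f x)" using f by auto
  show "(\<lambda>x. f x * g x) \<in> borel_measurable M" using f g by auto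
  show "AE x in M. norm (f x * g x) \<le> norm (K * f x)"
    using g(2)
  proof eventually_elim
    case (elim x)
    have "\<bar>f x\<bar> * \<bar>g x\<bar> \<le> \<bar>f x\<bar> * \<bar>K\<bar>" using elim by (intro mult_left_mono) auto
    then show ?case by (simp add: abs_mult mult.commute)
  qed
qed

section \<open>Slices and Fubini's theorem for the completed Lebesgue measure\<close>

lemma borel_measurable_lebesgue_on_AE:
  fixes f :: "'a::euclidean_space \<Rightarrow> 'b::euclidean_space"
  assumes f: "f \<in> borel_measurable (lebesgue_on S)" and S: "S \<in> sets lebesgue"
    and ae: "AE x in lebesgue_on S. f x = g x"
  shows "g \<in> borel_measurable (lebesgue_on S)"
proof -
  have "(\<lambda>x. indicator S x *\<^sub>R f x) \<in> borel_measurable lebesgue"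
    using f S by (simp add: borel_measurable_restrict_space_iff)
  moreover have "AE x in lebesgue. indicator S x *\<^sub>R f x = indicator S x *\<^sub>R g x"
    using ae S by (simp add: AE_restrict_space_iff) (auto elim!: eventually_mono simp: indicator_def)
  \<comment> \<open>Completeness of Lebesgue measure is what makes an almost everywhere modification
    measurable.\<close>
  ultimately have "(\<lambda>x. indicator S x *\<^sub>R g x) \<in> borel_measurable lebesgue"
    by (rule borel_measurable_AE)
  then show ?thesis using S by (simp add: borel_measurable_restrict_space_iff)
qed

text \<open>On the product space \<open>lebesgue\<close> is a completion, not the product of the two
  \<open>lebesgue\<close> measures. The exceptional set is therefore enlarged to a Borel null set,
  sliced with respect to \<open>lborel\<close>, and the result is completed in each factor.\<close>

lemma AE_lebesgue_prod:
  fixes P :: "'a::euclidean_space \<times> 'b::euclidean_space \<Rightarrow> bool"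
  assumes "AE z in lebesgue. P z"
  shows "AE x in lebesgue. AE y in lebesgue. P (x, y)" "AE y in lebesgue. AE x in lebesgue. P (x, y)"
proof -
  have "AE z in lborel. P z" using assms by (simp add: AE_completion_iff)
  then obtain N where N: "\<And>z. z \<in> space lborel - N \<Longrightarrow> P z" "N \<in> null_sets (lborel :: ('a \<times> 'b) measure)"
    by (rule AE_E3) blast
  have sets: "N \<in> sets (lborel \<Otimes>\<^sub>M lborel)" using N(2) unfolding lborel_prod by auto
  have "AE z in lborel \<Otimes>\<^sub>M lborel. z \<notin> N" unfolding lborel_prod using N(2) by (rule AE_not_in)
  from lborel_pair.AE_pair[OF this]
  have 1: "AE x in lborel. AE y in lborel. (x, y) \<notin> N" .
  have "{z \<in> space (lborel \<Otimes>\<^sub>M lborel). (fst z, snd z) \<notin> N} = space (lborel \<Otimes>\<^sub>M lborel) - N" by auto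
  then have "{z \<in> space (lborel \<Otimes>\<^sub>M lborel). (fst z, snd z) \<notin> N} \<in> sets (lborel \<Otimes>\<^sub>M lborel)"
    using sets by (simp only: sets.compl_sets)
  from lborel_pair.AE_commute[of "\<lambda>x y. (x, y) \<notin> N", OF this] 1
  have 2: "AE y in lborel. AE x in lborel. (x, y) \<notin> N" by blast
  have P: "P (x, y)" if "(x, y) \<notin> N" for x y using that N(1) by auto
  show "AE x in lebesgue. AE y in lebesgue. P (x, y)"
    by (rule AE_completion, rule eventually_mono[OF 1], rule AE_completion, erule eventually_mono) (rule P)
  show "AE y in lebesgue. AE x in lebesgue. P (x, y)"
    by (rule AE_completion, rule eventually_mono[OF 2], rule AE_completion, erule eventually_mono) (rule P)
qed

lemma integral_lebesgue_AE_eq_lborel: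
  fixes f g :: "'a::euclidean_space \<Rightarrow> real"
  assumes g: "integrable lborel g" and ae: "AE x in lebesgue. f x = g x"
  shows "integrable lebesgue f" "integral\<^sup>L lebesgue f = integral\<^sup>L lborel g"
proof -
  have gm: "g \<in> borel_measurable lborel" using g by auto
  have gl: "integrable lebesgue g" "integral\<^sup>L lebesgue g = integral\<^sup>L lborel g"
    using integrable_completion[OF gm] integral_completion[OF gm] g by auto
  have fm: "f \<in> borel_measurable lebesgue"
    by (rule borel_measurable_AE[of g]) (use gl ae in \<open>auto elim: eventually_mono\<close>)
  show "integrable lebesgue f"
    by (rule integrable_cong_AE_imp[OF gl(1) fm]) (use ae in \<open>auto elim: eventually_mono\<close>)
  have "integral\<^sup>L lebesgue f = integral\<^sup>L lebesgue g"
    by (rule integral_cong_AE) (use fm gl ae in auto)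
  with gl show "integral\<^sup>L lebesgue f = integral\<^sup>L lborel g" by simp
qed

text \<open>Fubini's theorem for product measures applies to a Borel function that equals
  \<open>f\<close> almost everywhere. Slicing the exceptional null set shows that almost every slice
  of \<open>f\<close> equals the corresponding slice of that function almost everywhere, so
  integrability and integrals agree.\<close>

lemma Fubini_lebesgue:
  fixes f :: "'a::euclidean_space \<times> 'b::euclidean_space \<Rightarrow> real"
  assumes "integrable lebesgue f"
  shows "AE y in lebesgue. integrable lebesgue (\<lambda>x. f (x, y))"
    and "integrable lebesgue (\<lambda>y. \<integral>x. f (x, y) \<partial>lebesgue)"
    and "(\<integral>y. (\<integral>x. f (x, y) \<partial>lebesgue) \<partial>lebesgue) = (\<integral>z. f z \<partial>lebesgue)"
    and "AE x in lebesgue. integrable lebesgue (\<lambda>y. f (x, y))"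
    and "integrable lebesgue (\<lambda>x. \<integral>y. f (x, y) \<partial>lebesgue)"
    and "(\<integral>x. (\<integral>y. f (x, y) \<partial>lebesgue) \<partial>lebesgue) = (\<integral>z. f z \<partial>lebesgue)"
proof -
  obtain g where g[measurable]: "g \<in> borel_measurable lborel" and ae: "AE z in lborel. f z = g z"
    using completion_ex_borel_measurable_real[of f lborel] assms by auto
  have aeL: "AE z in lebesgue. f z = g z" using ae by (rule AE_completion)
  have "integrable lebesgue g"
    by (rule integrable_cong_AE_imp[OF assms _ aeL]) (use measurable_completion[OF g] in auto)
  then have gi: "integrable lborel g" using integrable_completion[OF g] by simp
  have gp: "integrable (lborel \<Otimes>\<^sub>M lborel) (case_prod (\<lambda>x y. g (x, y)))"
    using gi by (simp add: lborel_prod)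
  have gint: "(\<integral>z. f z \<partial>lebesgue) = (\<integral>z. g z \<partial>lborel)"
    by (rule integral_lebesgue_AE_eq_lborel[OF gi aeL])
  note ae1 = AE_lebesgue_prod(1)[OF aeL] and ae2 = AE_lebesgue_prod(2)[OF aeL]
  have s: "AE y in lebesgue. integrable lborel (\<lambda>x. g (x, y))"
    using lborel_pair.AE_integrable_snd[OF gp] by (rule AE_completion)
  with ae2 have s': "AE y in lebesgue. integrable lebesgue (\<lambda>x. f (x, y)) \<and>
      (\<integral>x. f (x, y) \<partial>lebesgue) = (\<integral>x. g (x, y) \<partial>lborel)"
  proof eventually_elim
    case (elim y)
    show ?case using integral_lebesgue_AE_eq_lborel[OF elim(2,1)] by simp
  qed
  then show "AE y in lebesgue. integrable lebesgue (\<lambda>x. f (x, y))"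
    by eventually_elim simp
  have s'': "AE y in lebesgue. (\<integral>x. f (x, y) \<partial>lebesgue) = (\<integral>x. g (x, y) \<partial>lborel)"
    using s' by eventually_elim simp
  show "integrable lebesgue (\<lambda>y. \<integral>x. f (x, y) \<partial>lebesgue)"
    by (rule integral_lebesgue_AE_eq_lborel(1)[OF lborel_pair.integrable_snd[OF gp] s''])
  show "(\<integral>y. (\<integral>x. f (x, y) \<partial>lebesgue) \<partial>lebesgue) = (\<integral>z. f z \<partial>lebesgue)"
    using integral_lebesgue_AE_eq_lborel(2)[OF lborel_pair.integrable_snd[OF gp] s'']
      lborel_pair.integral_snd[OF gp] gint by (simp add: lborel_prod)
  have t: "AE x in lebesgue. integrable lborel (\<lambda>y. g (x, y))"
    using lborel_pair.AE_integrable_fst[OF gp] by (rule AE_completion)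
  with ae1 have t': "AE x in lebesgue. integrable lebesgue (\<lambda>y. f (x, y)) \<and>
      (\<integral>y. f (x, y) \<partial>lebesgue) = (\<integral>y. g (x, y) \<partial>lborel)"
  proof eventually_elim
    case (elim x)
    show ?case using integral_lebesgue_AE_eq_lborel[OF elim(2,1)] by simp
  qed
  then show "AE x in lebesgue. integrable lebesgue (\<lambda>y. f (x, y))"
    by eventually_elim simp
  have t'': "AE x in lebesgue. (\<integral>y. f (x, y) \<partial>lebesgue) = (\<integral>y. g (x, y) \<partial>lborel)"
    using t' by eventually_elim simp
  show "integrable lebesgue (\<lambda>x. \<integral>y. f (x, y) \<partial>lebesgue)"
    by (rule integral_lebesgue_AE_eq_lborel(1)[OF lborel_pair.integrable_fst[OF gp] t''])
  show "(\<integral>x. (\<integral>y. f (x, y) \<partial>lebesgue) \<partial>lebesgue) = (\<integral>z. f z \<partial>lebesgue)"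
    using integral_lebesgue_AE_eq_lborel(2)[OF lborel_pair.integrable_fst[OF gp] t'']
      lborel_pair.integral_fst[OF gp] gint by (simp add: lborel_prod)
qed

lemma AE_lebesgue_on_prod:
  fixes A :: "'a::euclidean_space set" and B :: "'b::euclidean_space set"
  assumes "open A" "open B" and P: "AE z in lebesgue_on (A \<times> B). P z"
  shows "AE x in lebesgue_on A. AE y in lebesgue_on B. P (x, y)"
    and "AE y in lebesgue_on B. AE x in lebesgue_on A. P (x, y)"
proof -
  have AB: "A \<in> sets lebesgue" "B \<in> sets lebesgue" "A \<times> B \<in> sets lebesgue"
    using assms by (auto intro!: borel_open open_Times)
  have "AE z in lebesgue. z \<in> A \<times> B \<longrightarrow> P z"
    using P AB by (simp add: AE_restrict_space_iff)
  note * = AE_lebesgue_prod[OF this]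
  have "AE x in lebesgue. x \<in> A \<longrightarrow> (AE y in lebesgue. y \<in> B \<longrightarrow> P (x, y))"
    using *(1)
  proof eventually_elim
    case (elim x)
    show ?case
    proof
      assume "x \<in> A"
      with elim show "AE y in lebesgue. y \<in> B \<longrightarrow> P (x, y)" by simp
    qed
  qed
  then show "AE x in lebesgue_on A. AE y in lebesgue_on B. P (x, y)"
    using AB by (simp add: AE_restrict_space_iff)
  have "AE y in lebesgue. y \<in> B \<longrightarrow> (AE x in lebesgue. x \<in> A \<longrightarrow> P (x, y))"
    using *(2)
  proof eventually_elim
    case (elim y)
    show ?case
    proof
      assume "y \<in> B"
      with elim show "AE x in lebesgue. x \<in> A \<longrightarrow> P (x, y)" by simp
    qed
  qed
  then show "AE y in lebesgue_on B. AE x in lebesgue_on A. P (x, y)"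
    using AB by (simp add: AE_restrict_space_iff)
qed

lemma Fubini_lebesgue_on:
  fixes f :: "'a::euclidean_space \<times> 'b::euclidean_space \<Rightarrow> real"
  assumes "open A" "open B" and f: "integrable (lebesgue_on (A \<times> B)) f"
  shows "AE y in lebesgue_on B. integrable (lebesgue_on A) (\<lambda>x. f (x, y))"
    and "integrable (lebesgue_on B) (\<lambda>y. \<integral>x. f (x, y) \<partial>lebesgue_on A)"
    and "(\<integral>y. (\<integral>x. f (x, y) \<partial>lebesgue_on A) \<partial>lebesgue_on B) = (\<integral>z. f z \<partial>lebesgue_on (A \<times> B))"
    and "AE x in lebesgue_on A. integrable (lebesgue_on B) (\<lambda>y. f (x, y))"
    and "integrable (lebesgue_on A) (\<lambda>x. \<integral>y. f (x, y) \<partial>lebesgue_on B)"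
    and "(\<integral>x. (\<integral>y. f (x, y) \<partial>lebesgue_on B) \<partial>lebesgue_on A) = (\<integral>z. f z \<partial>lebesgue_on (A \<times> B))"
proof -
  have AB: "A \<inter> space lebesgue \<in> sets lebesgue" "B \<inter> space lebesgue \<in> sets lebesgue"
    "(A \<times> B) \<inter> space lebesgue \<in> sets lebesgue"
    using assms by (auto intro!: borel_open open_Times)
  define F where "F z = indicator (A \<times> B) z *\<^sub>R f z" for z
  have F: "integrable lebesgue F"
    using f unfolding F_def by (simp only: integrable_restrict_space[OF AB(3)])
  have Fx: "F (x, y) = indicator B y * (indicator A x *\<^sub>R f (x, y))"
    and Fy: "F (x, y) = indicator A x * (indicator B y *\<^sub>R f (x, y))" for x y
    by (auto simp: F_def indicator_def)
  note fub = Fubini_lebesgue[OF F]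
  have intF: "(\<integral>z. F z \<partial>lebesgue) = (\<integral>z. f z \<partial>lebesgue_on (A \<times> B))"
    unfolding F_def by (simp only: integral_restrict_space[OF AB(3)])
  have inA: "(\<integral>x. F (x, y) \<partial>lebesgue) = indicator B y *\<^sub>R (\<integral>x. f (x, y) \<partial>lebesgue_on A)" for y
    unfolding Fx by (simp only: integral_restrict_space[OF AB(1)] integral_mult_right_zero real_scaleR_def)
  have inB: "(\<integral>y. F (x, y) \<partial>lebesgue) = indicator A x *\<^sub>R (\<integral>y. f (x, y) \<partial>lebesgue_on B)" for x
    unfolding Fy by (simp only: integral_restrict_space[OF AB(2)] integral_mult_right_zero real_scaleR_def)
  have "AE y in lebesgue. y \<in> B \<longrightarrow> integrable (lebesgue_on A) (\<lambda>x. f (x, y))"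
    using fub(1)
  proof eventually_elim
    case (elim y)
    show ?case
    proof
      assume "y \<in> B"
      with elim have "integrable lebesgue (\<lambda>x. indicator A x *\<^sub>R f (x, y))"
        by (simp only: Fx indicator_simps mult_1)
      then show "integrable (lebesgue_on A) (\<lambda>x. f (x, y))"
        by (simp only: integrable_restrict_space[OF AB(1)])
    qed
  qed
  then show "AE y in lebesgue_on B. integrable (lebesgue_on A) (\<lambda>x. f (x, y))"
    using AB(2) by (simp add: AE_restrict_space_iff)
  have "AE x in lebesgue. x \<in> A \<longrightarrow> integrable (lebesgue_on B) (\<lambda>y. f (x, y))"
    using fub(4)
  proof eventually_elim
    case (elim x)
    show ?case
    proof
      assume "x \<in> A"
      with elim have "integrable lebesgue (\<lambda>y. indicator B y *\<^sub>R f (x, y))"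
        by (simp only: Fy indicator_simps mult_1)
      then show "integrable (lebesgue_on B) (\<lambda>y. f (x, y))"
        by (simp only: integrable_restrict_space[OF AB(2)])
    qed
  qed
  then show "AE x in lebesgue_on A. integrable (lebesgue_on B) (\<lambda>y. f (x, y))"
    using AB(1) by (simp add: AE_restrict_space_iff)
  show "integrable (lebesgue_on B) (\<lambda>y. \<integral>x. f (x, y) \<partial>lebesgue_on A)"
    using fub(2) unfolding inA by (simp only: integrable_restrict_space[OF AB(2)])
  show "integrable (lebesgue_on A) (\<lambda>x. \<integral>y. f (x, y) \<partial>lebesgue_on B)"
    using fub(5) unfolding inB by (simp only: integrable_restrict_space[OF AB(1)])
  show "(\<integral>y. (\<integral>x. f (x, y) \<partial>lebesgue_on A) \<partial>lebesgue_on B) = (\<integral>z. f z \<partial>lebesgue_on (A \<times> B))"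
    using fub(3) unfolding inA intF by (simp only: integral_restrict_space[OF AB(2)])
  show "(\<integral>x. (\<integral>y. f (x, y) \<partial>lebesgue_on B) \<partial>lebesgue_on A) = (\<integral>z. f z \<partial>lebesgue_on (A \<times> B))"
    using fub(6) unfolding inB intF by (simp only: integral_restrict_space[OF AB(1)])
qed

lemma finite_measure_lebesgue_on_bounded: "open S \<Longrightarrow> bounded S \<Longrightarrow> finite_measure (lebesgue_on S)"
  by (intro finite_measure_lebesgue_on bounded_set_imp_lmeasurable) auto

text \<open>Slices of the square are integrable by Fubini's theorem; measurability of the slices of
  \<open>f\<close> itself is obtained separately. On a bounded set \<open>f\<close> is integrable,
  so its components have integrable slices.\<close>

lemma in_L2_slice:
  fixes f :: "'a::euclidean_space \<times> 'b::euclidean_space \<Rightarrow> 'c::euclidean_space"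
  assumes "open A" "open B" "bounded A" "bounded B" and f: "in_L2 (lebesgue_on (A \<times> B)) f"
  shows "AE y in lebesgue_on B. in_L2 (lebesgue_on A) (\<lambda>x. f (x, y))"
proof -
  have "integrable (lebesgue_on (A \<times> B)) f"
    by (intro in_L2_integrable finite_measure_lebesgue_on_bounded open_Times bounded_Times f assms)
  then have "AE y in lebesgue_on B. integrable (lebesgue_on A) (\<lambda>x. f (x, y) \<bullet> i)" for i
    by (intro Fubini_lebesgue_on(1) assms) auto
  then have "AE y in lebesgue_on B. \<forall>i\<in>Basis. integrable (lebesgue_on A) (\<lambda>x. f (x, y) \<bullet> i)"
    by (intro AE_finite_allI) auto
  moreover have "AE y in lebesgue_on B. integrable (lebesgue_on A) (\<lambda>x. (norm (f (x, y)))\<^sup>2)"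
    using f by (intro Fubini_lebesgue_on(1) assms) (auto simp: in_L2_def)
  ultimately show ?thesis
  proof eventually_elim
    case (elim y)
    have "(\<lambda>x. f (x, y)) \<in> borel_measurable (lebesgue_on A)"
      unfolding borel_measurable_euclidean_space[of "\<lambda>x. f (x, y)"]
      using elim(1) by (intro ballI borel_measurable_integrable) (rule bspec)
    with elim(2) show ?case by (simp add: in_L2_def)
  qed
qed

section \<open>Weak gradients\<close>

lemma locally_integrable_mult_test_function:
  fixes G :: "'a::euclidean_space \<Rightarrow> 'b::euclidean_space"
  assumes "open \<Omega>" "locally_integrable \<Omega> G" "\<phi> \<in> test_functions \<Omega>"
  shows "integrable (lebesgue_on \<Omega>) (\<lambda>x. \<phi> x *\<^sub>R G x)"
proof -
  obtain K where K: "compact K" "K \<subseteq> \<Omega>" "\<And>x. x \<notin> K \<Longrightarrow> \<phi> x = 0"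
    by (rule test_functions_support[OF assms(3)]) blast
  obtain B where B: "\<And>x. \<bar>\<phi> x\<bar> \<le> B" using test_functions_grad_bounded[OF assms(3)] by metis
  have sets: "K \<inter> space lebesgue \<in> sets lebesgue" "\<Omega> \<inter> space lebesgue \<in> sets lebesgue"
    using K(1) \<open>open \<Omega>\<close> by (auto simp: compact_imp_closed)
  have G: "integrable (lebesgue_on K) G" using assms(2) K by (auto simp: locally_integrable_def)
  have "integrable (lebesgue_on K) (\<lambda>x. \<phi> x *\<^sub>R G x)"
  proof (rule Bochner_Integration.integrable_bound)
    show "integrable (lebesgue_on K) (\<lambda>x. B *\<^sub>R G x)" using G by auto
    have "\<phi> \<in> borel_measurable (lebesgue_on K)"
      using sets(1) test_functions_smooth[OF assms(3)]
      by (intro continuous_imp_measurable_on_sets_lebesgue smooth_continuous_on) auto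
    then show "(\<lambda>x. \<phi> x *\<^sub>R G x) \<in> borel_measurable (lebesgue_on K)"
      using G by (intro borel_measurable_scaleR) auto
    show "AE x in lebesgue_on K. norm (\<phi> x *\<^sub>R G x) \<le> norm (B *\<^sub>R G x)"
      by (intro AE_I2) (simp add: mult_right_mono order_trans[OF B abs_ge_self])
  qed
  then have "integrable lebesgue (\<lambda>x. indicator K x *\<^sub>R (\<phi> x *\<^sub>R G x))"
    by (simp only: integrable_restrict_space[OF sets(1)])
  moreover have "indicator K x *\<^sub>R (\<phi> x *\<^sub>R G x) = indicator \<Omega> x *\<^sub>R (\<phi> x *\<^sub>R G x)" for x
    using K(2,3) by (cases "x \<in> K") (auto simp: indicator_def)
  ultimately show ?thesis
    by (simp only: integrable_restrict_space[OF sets(2)])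
qed

text \<open>Both gradients are only locally integrable, whereas the fundamental lemma asks for
  integrability on all of \<open>\<Omega>\<close>. Multiplication by the exhausting functions
  \<open>\<theta> n\<close> repairs this, and at each point of \<open>\<Omega>\<close> some
  \<open>\<theta> n\<close> is positive.\<close>

lemma weak_gradient_unique:
  fixes \<Omega> :: "'a::euclidean_space set"
  assumes "open \<Omega>" and G: "has_weak_gradient \<Omega> v G" and G': "has_weak_gradient \<Omega> v G'"
  shows "AE x in lebesgue_on \<Omega>. G x = G' x"
proof -
  let ?M = "lebesgue_on \<Omega>"
  have int: "integrable ?M (\<lambda>x. \<phi> x *\<^sub>R G x)" "integrable ?M (\<lambda>x. \<phi> x *\<^sub>R G' x)" if "\<phi> \<in> test_functions \<Omega>" for \<phi>
    using G G' \<open>open \<Omega>\<close> that by (auto simp: has_weak_gradient_def intro!: locally_integrable_mult_test_function)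
  have eq: "(\<integral>x. \<phi> x *\<^sub>R G x \<partial>?M) = (\<integral>x. \<phi> x *\<^sub>R G' x \<partial>?M)" if "\<phi> \<in> test_functions \<Omega>" for \<phi>
    using G G' that by (simp add: has_weak_gradient_def)
  obtain \<theta> where \<theta>: "\<And>n. \<theta> n \<in> test_functions \<Omega>" "\<And>x. (\<lambda>n. \<theta> n x) \<longlonglongrightarrow> indicator \<Omega> x"
    using open_exhausting_test_functions[OF \<open>open \<Omega>\<close>] by metis
  have "AE x in ?M. \<theta> n x *\<^sub>R (G x - G' x) = 0" for n
  proof (rule fundamental_lemma[OF \<open>open \<Omega>\<close>])
    show "integrable ?M (\<lambda>x. \<theta> n x *\<^sub>R (G x - G' x))"
      using int[OF \<theta>(1)[of n]] by (simp add: scaleR_diff_right)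
    fix \<phi> :: "'a \<Rightarrow> real" assume \<phi>: "\<phi> \<in> test_functions \<Omega>"
    have t: "(\<lambda>x. \<phi> x * \<theta> n x) \<in> test_functions \<Omega>"
      by (rule test_functions_mult_smooth[OF \<theta>(1) test_functions_smooth[OF \<phi>]])
    have "(\<integral>x. \<phi> x *\<^sub>R \<theta> n x *\<^sub>R (G x - G' x) \<partial>?M)
        = (\<integral>x. (\<phi> x * \<theta> n x) *\<^sub>R G x - (\<phi> x * \<theta> n x) *\<^sub>R G' x \<partial>?M)"
      by (simp add: scaleR_diff_right)
    also have "\<dots> = 0"
      using int[OF t] eq[OF t] by (subst Bochner_Integration.integral_diff) auto
    finally show "(\<integral>x. \<phi> x *\<^sub>R \<theta> n x *\<^sub>R (G x - G' x) \<partial>?M) = 0" .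
  qed
  then have "AE x in ?M. \<forall>n. \<theta> n x *\<^sub>R (G x - G' x) = 0"
    by - (rule AE_all_countable[THEN iffD2, OF allI])
  moreover have "AE x in ?M. x \<in> \<Omega>" by (rule AE_I2) simp
  ultimately show ?thesis
  proof eventually_elim
    case (elim x)
    have "(\<lambda>n. \<theta> n x) \<longlonglongrightarrow> 1" using \<theta>(2)[of x] elim(2) by simp
    then have "\<forall>\<^sub>F n in sequentially. 0 < \<theta> n x" by (rule order_tendstoD) simp
    then obtain n where "0 < \<theta> n x" using eventually_happens by fastforce
    then show ?case using elim(1)[rule_format, of n] by simp
  qed
qed

lemma has_weak_gradient_cmult:
  fixes \<Omega> :: "'a::euclidean_space set"
  assumes "has_weak_gradient \<Omega> v G" shows "has_weak_gradient \<Omega> (\<lambda>x. c * v x) (\<lambda>x. c *\<^sub>R G x)"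
proof -
  have "(\<integral>x. (c * v x) *\<^sub>R grad \<phi> x \<partial>lebesgue_on \<Omega>) = - (\<integral>x. \<phi> x *\<^sub>R c *\<^sub>R G x \<partial>lebesgue_on \<Omega>)"
    if "\<phi> \<in> test_functions \<Omega>" for \<phi>
  proof -
    have "(\<integral>x. (c * v x) *\<^sub>R grad \<phi> x \<partial>lebesgue_on \<Omega>) = (\<integral>x. c *\<^sub>R (v x *\<^sub>R grad \<phi> x) \<partial>lebesgue_on \<Omega>)"
      by simp
    also have "\<dots> = c *\<^sub>R (\<integral>x. v x *\<^sub>R grad \<phi> x \<partial>lebesgue_on \<Omega>)" by (rule integral_scaleR_right)
    also have "\<dots> = - (c *\<^sub>R (\<integral>x. \<phi> x *\<^sub>R G x \<partial>lebesgue_on \<Omega>))"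
      using assms that by (simp add: has_weak_gradient_def)
    also have "c *\<^sub>R (\<integral>x. \<phi> x *\<^sub>R G x \<partial>lebesgue_on \<Omega>) = (\<integral>x. c *\<^sub>R (\<phi> x *\<^sub>R G x) \<partial>lebesgue_on \<Omega>)"
      by (rule integral_scaleR_right[symmetric])
    finally show ?thesis by (simp add: mult.commute)
  qed
  with assms show ?thesis
    by (auto simp: has_weak_gradient_def locally_integrable_def)
qed

lemma has_weak_gradient_diff:
  fixes \<Omega> :: "'a::euclidean_space set"
  assumes "open \<Omega>" and v: "has_weak_gradient \<Omega> v G" and w: "has_weak_gradient \<Omega> w H"
  shows "has_weak_gradient \<Omega> (\<lambda>x. v x - w x) (\<lambda>x. G x - H x)"
proof -
  have loc: "locally_integrable \<Omega> v" "locally_integrable \<Omega> w" "locally_integrable \<Omega> G" "locally_integrable \<Omega> H"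
    using v w by (auto simp: has_weak_gradient_def)
  have "(\<integral>x. (v x - w x) *\<^sub>R grad \<phi> x \<partial>lebesgue_on \<Omega>) = - (\<integral>x. \<phi> x *\<^sub>R (G x - H x) \<partial>lebesgue_on \<Omega>)"
    if \<phi>: "\<phi> \<in> test_functions \<Omega>" for \<phi>
  proof -
    have int: "integrable (lebesgue_on \<Omega>) (\<lambda>x. u x *\<^sub>R grad \<phi> x)" if "locally_integrable \<Omega> u" for u
    proof -
      \<comment> \<open>The components of \<open>grad \<phi>\<close> are test functions themselves,
        so local integrability of \<open>u\<close> is enough in each component.\<close>
      have "integrable (lebesgue_on \<Omega>) (\<lambda>x. frechet_derivative \<phi> (at x) i *\<^sub>R u x)" for i
        by (rule locally_integrable_mult_test_function[OF \<open>open \<Omega>\<close> that test_functions_directional_derivative[OF \<phi>]])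
      then have "integrable (lebesgue_on \<Omega>) (\<lambda>x. \<Sum>i\<in>Basis. (frechet_derivative \<phi> (at x) i *\<^sub>R u x) *\<^sub>R i)"
        by (intro Bochner_Integration.integrable_sum integrable_scaleR_left)
      then show ?thesis by (simp add: grad_def scaleR_sum_right mult.commute)
    qed
    have int': "integrable (lebesgue_on \<Omega>) (\<lambda>x. \<phi> x *\<^sub>R G x)" "integrable (lebesgue_on \<Omega>) (\<lambda>x. \<phi> x *\<^sub>R H x)"
      using locally_integrable_mult_test_function[OF \<open>open \<Omega>\<close> _ \<phi>] loc by auto
    show ?thesis
      using v w \<phi> int[OF loc(1)] int[OF loc(2)] int'
      by (simp add: scaleR_diff_left scaleR_diff_right has_weak_gradient_def)
  qed
  with loc show ?thesis
    by (auto simp: has_weak_gradient_def locally_integrable_def)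
qed

text \<open>\<open>H10\<close> hides its gradient and its sequence behind existential quantifiers.
  Here both are exposed, so that \<open>D\<close> may be the gradient that occurs in the variational
  inequality, and convergence is stated for squared norms, the form in which it is used.\<close>

definition H10_approximation ::
  "'a::euclidean_space set \<Rightarrow> ('a \<Rightarrow> real) \<Rightarrow> ('a \<Rightarrow> 'a) \<Rightarrow> (nat \<Rightarrow> 'a \<Rightarrow> real) \<Rightarrow> bool" where
  "H10_approximation \<Omega> v D \<phi> \<longleftrightarrow> in_L2 (lebesgue_on \<Omega>) v \<and> in_L2 (lebesgue_on \<Omega>) D \<and>
    (\<forall>n. \<phi> n \<in> test_functions \<Omega>) \<and>
    (\<lambda>n. \<integral>x. (norm (\<phi> n x - v x))\<^sup>2 \<partial>lebesgue_on \<Omega>) \<longlonglongrightarrow> 0 \<and>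
    (\<lambda>n. \<integral>x. (norm (grad (\<phi> n) x - D x))\<^sup>2 \<partial>lebesgue_on \<Omega>) \<longlonglongrightarrow> 0"

lemma test_functions_in_L2:
  fixes \<phi> :: "'a::euclidean_space \<Rightarrow> real"
  assumes "open \<Omega>" "bounded \<Omega>" "\<phi> \<in> test_functions U"
  shows "in_L2 (lebesgue_on \<Omega>) \<phi>" "in_L2 (lebesgue_on \<Omega>) (grad \<phi>)"
proof -
  obtain B where B: "\<And>x. \<bar>\<phi> x\<bar> \<le> B" "\<And>x. norm (grad \<phi> x) \<le> B"
    using test_functions_grad_bounded[OF assms(3)] by metis
  show "in_L2 (lebesgue_on \<Omega>) \<phi>" "in_L2 (lebesgue_on \<Omega>) (grad \<phi>)"
    by (rule in_L2_bounded[where K=B]; use assms B in \<open>auto intro!: finite_measure_lebesgue_on_bounded test_functions_measurable\<close>)+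
qed

text \<open>By uniqueness, any weak gradient of \<open>v\<close> agrees almost everywhere with the
  one provided by \<open>H10\<close>, and the integrals do not notice the difference.\<close>

lemma H10_approximation_exists:
  fixes \<Omega> :: "'a::euclidean_space set"
  assumes "open \<Omega>" and v: "v \<in> H10 \<Omega>" and D: "has_weak_gradient \<Omega> v D"
  obtains \<phi> where "H10_approximation \<Omega> v D \<phi>"
proof -
  let ?M = "lebesgue_on \<Omega>"
  obtain G \<phi> where G: "in_L2 ?M v" "in_L2 ?M G" "has_weak_gradient \<Omega> v G" "range \<phi> \<subseteq> test_functions \<Omega>"
    "(\<lambda>n. L2_norm ?M (\<lambda>x. \<phi> n x - v x)) \<longlonglongrightarrow> 0" "(\<lambda>n. L2_norm ?M (\<lambda>x. grad (\<phi> n) x - G x)) \<longlonglongrightarrow> 0"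
    using v unfolding H10_def by blast
  have ae: "AE x in ?M. G x = D x" by (rule weak_gradient_unique[OF \<open>open \<Omega>\<close> G(3) D])
  have Gm[measurable]: "G \<in> borel_measurable ?M" using G(2) by (simp add: in_L2_def)
  have Dm[measurable]: "D \<in> borel_measurable ?M"
    by (rule borel_measurable_lebesgue_on_AE[OF Gm _ ae]) (use \<open>open \<Omega>\<close> in auto)
  have "integrable ?M (\<lambda>x. (norm (D x))\<^sup>2)"
  proof (rule integrable_cong_AE_imp)
    show "integrable ?M (\<lambda>x. (norm (G x))\<^sup>2)" using G(2) by (simp add: in_L2_def)
    show "AE x in ?M. (norm (G x))\<^sup>2 = (norm (D x))\<^sup>2" using ae by eventually_elim simp
  qed measurable
  then have "in_L2 ?M D" using Dm by (simp add: in_L2_def)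
  have test: "\<phi> n \<in> test_functions \<Omega>" for n using G(4) by auto
  have [measurable]: "grad (\<phi> n) \<in> borel_measurable ?M" for n
    by (rule test_functions_measurable(2)[OF \<open>open \<Omega>\<close> test])
  have "(\<integral>x. (norm (grad (\<phi> n) x - G x))\<^sup>2 \<partial>?M) = (\<integral>x. (norm (grad (\<phi> n) x - D x))\<^sup>2 \<partial>?M)" for n
  proof (rule integral_cong_AE)
    show "AE x in ?M. (norm (grad (\<phi> n) x - G x))\<^sup>2 = (norm (grad (\<phi> n) x - D x))\<^sup>2"
      using ae by eventually_elim simp
  qed measurable
  with G(1,5,6) \<open>in_L2 ?M D\<close> test have "H10_approximation \<Omega> v D \<phi>"
    by (simp add: H10_approximation_def L2_norm_tendsto_0_iff)
  then show thesis by (rule that)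
qed

text \<open>Needed because coercivity is applied to the difference of two solutions. The bound of
  the square of a sum by twice the sum of the squares takes the place of the triangle inequality in
  L2.\<close>

lemma H10_approximation_diff:
  fixes \<Omega> :: "'a::euclidean_space set"
  assumes "open \<Omega>" "bounded \<Omega>" and A: "H10_approximation \<Omega> v D \<phi>" and B: "H10_approximation \<Omega> w E \<psi>"
  shows "H10_approximation \<Omega> (\<lambda>x. v x - w x) (\<lambda>x. D x - E x) (\<lambda>n x. \<phi> n x + (-1) * \<psi> n x)"
proof -
  let ?M = "lebesgue_on \<Omega>"
  have \<phi>: "\<phi> n \<in> test_functions \<Omega>" and \<psi>: "\<psi> n \<in> test_functions \<Omega>" for n
    using A B by (auto simp: H10_approximation_def)
  have L2: "in_L2 ?M v" "in_L2 ?M D" "in_L2 ?M w" "in_L2 ?M E"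
    using A B by (auto simp: H10_approximation_def)
  have grad: "grad (\<lambda>x. \<phi> n x + (-1) * \<psi> n x) x = grad (\<phi> n) x - grad (\<psi> n) x" for n x
    using \<phi>[of n] \<psi>[of n] by (subst grad_add) (auto intro!: smooth_mult smooth_const smooth_uminus dest: test_functions_smooth simp: grad_cmult[of _ "-1", simplified] )
  have sq: "(\<lambda>n. \<integral>x. (norm (p n x - P x - (q n x - Q x)))\<^sup>2 \<partial>?M) \<longlonglongrightarrow> 0"
    if "\<And>n. in_L2 ?M (p n)" "\<And>n. in_L2 ?M (q n)" "in_L2 ?M P" "in_L2 ?M Q"
      and lim: "(\<lambda>n. \<integral>x. (norm (p n x - P x))\<^sup>2 \<partial>?M) \<longlonglongrightarrow> 0" "(\<lambda>n. \<integral>x. (norm (q n x - Q x))\<^sup>2 \<partial>?M) \<longlonglongrightarrow> 0"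
    for p q :: "nat \<Rightarrow> 'a \<Rightarrow> 'c::euclidean_space" and P Q
  proof (rule tendsto_sandwich[OF _ _ tendsto_const])
    show "\<forall>\<^sub>F n in sequentially. (\<integral>x. (norm (p n x - P x - (q n x - Q x)))\<^sup>2 \<partial>?M)
      \<le> 2 * (\<integral>x. (norm (p n x - P x))\<^sup>2 \<partial>?M) + 2 * (\<integral>x. (norm (q n x - Q x))\<^sup>2 \<partial>?M)"
    proof (intro always_eventually allI)
      fix n
      have minus: "norm ((-1) *\<^sub>R z) = norm z" for z :: 'c by simp
      have "p n x - P x - (q n x - Q x) = (p n x - P x) + (-1) *\<^sub>R (q n x - Q x)" for x by simp
      then show "(\<integral>x. (norm (p n x - P x - (q n x - Q x)))\<^sup>2 \<partial>?M)
        \<le> 2 * (\<integral>x. (norm (p n x - P x))\<^sup>2 \<partial>?M) + 2 * (\<integral>x. (norm (q n x - Q x))\<^sup>2 \<partial>?M)"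
        using in_L2_add(2)[OF in_L2_diff[OF that(1)[of n] that(3)]
            in_L2_cmult[OF in_L2_diff[OF that(2)[of n] that(4)], where c="-1"]]
        by (simp only: minus)
    qed
    have "(\<lambda>n. 2 * (\<integral>x. (norm (p n x - P x))\<^sup>2 \<partial>?M) + 2 * (\<integral>x. (norm (q n x - Q x))\<^sup>2 \<partial>?M)) \<longlonglongrightarrow> 2 * 0 + 2 * 0"
      by (intro tendsto_intros lim)
    then show "(\<lambda>n. 2 * (\<integral>x. (norm (p n x - P x))\<^sup>2 \<partial>?M) + 2 * (\<integral>x. (norm (q n x - Q x))\<^sup>2 \<partial>?M)) \<longlonglongrightarrow> 0"
      by simp
  qed auto
  note tL2 = test_functions_in_L2[OF assms(1,2)]
  have "(\<lambda>n. \<integral>x. (norm (\<phi> n x - v x - (\<psi> n x - w x)))\<^sup>2 \<partial>?M) \<longlonglongrightarrow> 0"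
    by (rule sq[OF tL2(1)[OF \<phi>] tL2(1)[OF \<psi>] L2(1,3)]) (use A B in \<open>simp_all add: H10_approximation_def\<close>)
  moreover have "(\<lambda>n. \<integral>x. (norm (grad (\<phi> n) x - D x - (grad (\<psi> n) x - E x)))\<^sup>2 \<partial>?M) \<longlonglongrightarrow> 0"
    by (rule sq[OF tL2(2)[OF \<phi>] tL2(2)[OF \<psi>] L2(2,4)]) (use A B in \<open>simp_all add: H10_approximation_def\<close>)
  moreover have "(\<lambda>x. \<phi> n x + (-1) * \<psi> n x) \<in> test_functions \<Omega>" for n
    using test_functions_add[OF \<phi> test_functions_cmult[OF \<psi>, where c="-1"]] .
  moreover have "\<phi> n x - v x - (\<psi> n x - w x) = \<phi> n x + (-1) * \<psi> n x - (v x - w x)"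
    and "grad (\<phi> n) x - D x - (grad (\<psi> n) x - E x) = grad (\<phi> n) x - grad (\<psi> n) x - (D x - E x)" for n x
    by (auto simp: algebra_simps)
  ultimately show ?thesis
    unfolding H10_approximation_def grad using in_L2_diff[OF L2(1,3)] in_L2_diff[OF L2(2,4)] by simp
qed

lemma H10_cmult:
  fixes \<Omega> :: "'a::euclidean_space set"
  assumes "v \<in> H10 \<Omega>" shows "(\<lambda>x. c * v x) \<in> H10 \<Omega>"
proof -
  let ?M = "lebesgue_on \<Omega>"
  obtain G \<phi> where G: "in_L2 ?M v" "in_L2 ?M G" "has_weak_gradient \<Omega> v G" "range \<phi> \<subseteq> test_functions \<Omega>"
    "(\<lambda>n. L2_norm ?M (\<lambda>x. \<phi> n x - v x)) \<longlonglongrightarrow> 0" "(\<lambda>n. L2_norm ?M (\<lambda>x. grad (\<phi> n) x - G x)) \<longlonglongrightarrow> 0"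
    using assms unfolding H10_def by blast
  have scale: "L2_norm ?M (\<lambda>x. c *\<^sub>R h x) = \<bar>c\<bar> * L2_norm ?M h" for h :: "'a \<Rightarrow> 'b::euclidean_space"
    by (simp add: L2_norm_def power_mult_distrib real_sqrt_mult)
  have grad: "grad (\<lambda>x. c * \<phi> n x) x = c *\<^sub>R grad (\<phi> n) x" for n x
    using G(4) by (intro grad_cmult test_functions_smooth) auto
  have 1: "(\<lambda>n. L2_norm ?M (\<lambda>x. c * \<phi> n x - c * v x)) \<longlonglongrightarrow> 0"
  proof -
    have "(\<lambda>n. \<bar>c\<bar> * L2_norm ?M (\<lambda>x. \<phi> n x - v x)) \<longlonglongrightarrow> \<bar>c\<bar> * 0" by (intro tendsto_intros G)
    then show ?thesis by (simp add: scale[symmetric] right_diff_distrib)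
  qed
  have 2: "(\<lambda>n. L2_norm ?M (\<lambda>x. grad (\<lambda>x. c * \<phi> n x) x - c *\<^sub>R G x)) \<longlonglongrightarrow> 0"
  proof -
    have "(\<lambda>n. \<bar>c\<bar> * L2_norm ?M (\<lambda>x. grad (\<phi> n) x - G x)) \<longlonglongrightarrow> \<bar>c\<bar> * 0" by (intro tendsto_intros G)
    then show ?thesis by (simp add: scale[symmetric] scaleR_diff_right grad)
  qed
  have "range (\<lambda>n x. c * \<phi> n x) \<subseteq> test_functions \<Omega>"
    using G(4) by (auto intro!: test_functions_cmult)
  then show ?thesis
    unfolding H10_def
    using 1 2 in_L2_cmult[OF G(1), of c] in_L2_cmult[OF G(2), of c] has_weak_gradient_cmult[OF G(3), of c]
    by (intro CollectI conjI exI[of _ "\<lambda>x. c *\<^sub>R G x"] exI[of _ "\<lambda>n x. c * \<phi> n x"]) simp_all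
qed

text \<open>Multiplication by a constant is how a solution for one threshold becomes a competitor
  for another; in the application \<open>c\<close> is \<open>\<alpha>\<close> and the thresholds are
  those of the two problems.\<close>

lemma gradient_constraint_cmult:
  fixes \<Omega> :: "'a::euclidean_space set"
  assumes v: "v \<in> gradient_constraint \<Omega> \<gamma>" and "0 \<le> c" and le: "AE x in lebesgue_on \<Omega>. c * \<gamma> x \<le> \<gamma>' x"
  shows "(\<lambda>x. c * v x) \<in> gradient_constraint \<Omega> \<gamma>'"
proof -
  obtain G where G: "v \<in> H10 \<Omega>" "has_weak_gradient \<Omega> v G" "AE x in lebesgue_on \<Omega>. norm (G x) \<le> \<gamma> x"
    using v by (auto simp: gradient_constraint_def)
  have "AE x in lebesgue_on \<Omega>. norm (c *\<^sub>R G x) \<le> \<gamma>' x"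
    using G(3) le
  proof eventually_elim
    case (elim x)
    have "norm (c *\<^sub>R G x) \<le> c * \<gamma> x" using elim(1) \<open>0 \<le> c\<close> by (simp add: mult_left_mono)
    with elim(2) show ?case by simp
  qed
  with has_weak_gradient_cmult[OF G(2), of c] H10_cmult[OF G(1), of c] show ?thesis
    unfolding gradient_constraint_def by blast
qed

text \<open>The constraint speaks of some weak gradient; uniqueness transfers the bound to a
  prescribed one.\<close>

lemma gradient_constraint_bound:
  fixes \<Omega> :: "'a::euclidean_space set"
  assumes "open \<Omega>" "v \<in> gradient_constraint \<Omega> \<gamma>" "has_weak_gradient \<Omega> v D"
  shows "AE x in lebesgue_on \<Omega>. norm (D x) \<le> \<gamma> x"
proof -
  obtain G where G: "has_weak_gradient \<Omega> v G" "AE x in lebesgue_on \<Omega>. norm (G x) \<le> \<gamma> x"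
    using assms(2) by (auto simp: gradient_constraint_def)
  from weak_gradient_unique[OF assms(1) G(1) assms(3)] G(2) show ?thesis
    by eventually_elim simp
qed

section \<open>Sup bounds from gradient bounds\<close>

lemma nn_integral_lborel_shift:
  fixes h :: "'a::euclidean_space \<Rightarrow> ennreal"
  assumes [measurable]: "h \<in> borel_measurable borel"
  shows "(\<integral>\<^sup>+x. h (x - c) \<partial>lborel) = (\<integral>\<^sup>+x. h x \<partial>lborel)"
proof -
  have "(\<integral>\<^sup>+x. h x \<partial>lborel) = (\<integral>\<^sup>+x. h x \<partial>(distr lborel borel ((+) (- c))))"
    by (simp add: lborel_distr_plus)
  also have "\<dots> = (\<integral>\<^sup>+x. h (x - c) \<partial>lborel)"
    by (subst nn_integral_distr) auto
  finally show ?thesis by simp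
qed

text \<open>Integrating along a line leaving \<open>\<Omega>\<close>; only the part of the gradient exceeding \<open>R\<close> is
  estimated in \<open>L\<^sup>1\<close>.\<close>

lemma test_function_excess_bound:
  fixes \<phi> :: "'a::euclidean_space \<Rightarrow> real"
  assumes \<phi>: "\<phi> \<in> test_functions \<Omega>" and \<Omega>: "\<Omega> \<subseteq> ball 0 \<rho>" and "0 < \<rho>" "0 \<le> R"
  shows "(\<integral>\<^sup>+x. ennreal (\<bar>\<phi> x\<bar> - 2 * \<rho> * R) * indicator \<Omega> x \<partial>lborel)
    \<le> ennreal (2 * \<rho>) * (\<integral>\<^sup>+x. ennreal (norm (grad \<phi> x) - R) \<partial>lborel)"
proof -
  obtain e :: 'a where e: "e \<in> Basis" using nonempty_Basis by blast
  define h where "h x = max (norm (grad \<phi> x) - R) 0" for x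
  have sm: "smooth \<phi>" using \<phi> by (rule test_functions_smooth)
  have hc: "continuous_on S h" for S
    unfolding h_def by (intro continuous_intros continuous_on_grad sm)
  have [measurable]: "h \<in> borel_measurable borel"
    by (rule borel_measurable_continuous_onI[OF hc])
  have line: "ennreal (\<bar>\<phi> x\<bar> - 2 * \<rho> * R) \<le> (\<integral>\<^sup>+s. ennreal (h (x - s *\<^sub>R e)) * indicator {0..2*\<rho>} s \<partial>lborel)"
    if "x \<in> \<Omega>" for x
  proof -
    have nx: "norm x < \<rho>" using that \<Omega> by auto
    \<comment> \<open>A step of length \<open>2 * \<rho>\<close>, the diameter of the ball, leaves
      the ball from every point in it, so \<open>\<phi>\<close> vanishes at the far end of the
      segment.\<close>
    have "norm (x - (2 * \<rho>) *\<^sub>R e) \<ge> 2 * \<rho> - norm x"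
      using norm_triangle_ineq2[of "(2 * \<rho>) *\<^sub>R e" x] e \<open>0 < \<rho>\<close> by (simp add: norm_minus_commute)
    with nx have "x - (2 * \<rho>) *\<^sub>R e \<notin> \<Omega>" using \<Omega> by auto
    moreover have "\<phi> y = 0" if "y \<notin> \<Omega>" for y
    proof -
      obtain K where "K \<subseteq> \<Omega>" "\<And>x. x \<notin> K \<Longrightarrow> \<phi> x = 0"
        by (rule test_functions_support[OF \<phi>]) blast
      with that show ?thesis by blast
    qed
    ultimately have far: "\<phi> (x - (2 * \<rho>) *\<^sub>R e) = 0" by blast
    have der: "((\<lambda>s. \<phi> (x - s *\<^sub>R e)) has_vector_derivative (- (grad \<phi> (x - s *\<^sub>R e) \<bullet> e))) (at s within S)" for s S
    proof -
      have "((\<lambda>s. x - s *\<^sub>R e) has_derivative (\<lambda>d. - (d *\<^sub>R e))) (at s within S)"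
        by (auto intro!: derivative_eq_intros)
      from has_derivative_compose[OF this has_derivative_grad[OF sm]]
      show ?thesis by (simp add: has_vector_derivative_def algebra_simps)
    qed
    have ftc: "((\<lambda>s. - (grad \<phi> (x - s *\<^sub>R e) \<bullet> e)) has_integral (\<phi> (x - (2*\<rho>) *\<^sub>R e) - \<phi> (x - 0 *\<^sub>R e))) {0..2*\<rho>}"
      using \<open>0 < \<rho>\<close> by (intro fundamental_theorem_of_calculus der) auto
    have hint: "((\<lambda>s. R + h (x - s *\<^sub>R e)) has_integral (R * (2 * \<rho>) + integral {0..2*\<rho>} (\<lambda>s. h (x - s *\<^sub>R e)))) {0..2*\<rho>}"
    proof (rule has_integral_add)
      show "((\<lambda>s. R) has_integral R * (2 * \<rho>)) {0..2 * \<rho>}"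
        using has_integral_const_real[of R 0 "2 * \<rho>"] \<open>0 < \<rho>\<close> by (simp add: mult.commute)
      show "((\<lambda>s. h (x - s *\<^sub>R e)) has_integral integral {0..2 * \<rho>} (\<lambda>s. h (x - s *\<^sub>R e))) {0..2 * \<rho>}"
        by (intro integrable_integral integrable_continuous_interval continuous_on_compose2[OF hc[of UNIV]] continuous_intros) auto
    qed
    have "norm (\<phi> (x - (2*\<rho>) *\<^sub>R e) - \<phi> (x - 0 *\<^sub>R e)) \<le> R * (2 * \<rho>) + integral {0..2*\<rho>} (\<lambda>s. h (x - s *\<^sub>R e))"
    proof (rule integral_norm_bound_integral[OF has_integral_integrable[OF ftc] has_integral_integrable[OF hint],
          unfolded integral_unique[OF ftc] integral_unique[OF hint]])
      fix s
      have "\<bar>grad \<phi> (x - s *\<^sub>R e) \<bullet> e\<bar> \<le> norm (grad \<phi> (x - s *\<^sub>R e))"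
        using Cauchy_Schwarz_ineq2[of "grad \<phi> (x - s *\<^sub>R e)" e] e by simp
      then show "norm (- (grad \<phi> (x - s *\<^sub>R e) \<bullet> e)) \<le> R + h (x - s *\<^sub>R e)"
        by (auto simp: h_def)
    qed
    then have "\<bar>\<phi> x\<bar> - 2 * \<rho> * R \<le> integral {0..2*\<rho>} (\<lambda>s. h (x - s *\<^sub>R e))"
      using far by (simp add: mult.commute mult.left_commute)
    moreover have "(\<integral>\<^sup>+s. ennreal (h (x - s *\<^sub>R e)) * indicator {0..2*\<rho>} s \<partial>lborel)
        = ennreal (integral {0..2*\<rho>} (\<lambda>s. h (x - s *\<^sub>R e)))"
    proof -
      have "(\<lambda>s. h (x - s *\<^sub>R e)) integrable_on {0..2 * \<rho>}"
        by (intro integrable_continuous_interval continuous_on_compose2[OF hc[of UNIV]] continuous_intros) auto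
      then have "(\<integral>\<^sup>+s. ennreal (indicator {0..2*\<rho>} s * h (x - s *\<^sub>R e)) \<partial>lborel)
        = ennreal (integral {0..2*\<rho>} (\<lambda>s. h (x - s *\<^sub>R e)))"
        by (intro nn_integral_has_integral_lebesgue integrable_integral) (simp add: h_def)
      moreover have "ennreal (h (x - s *\<^sub>R e)) * indicator {0..2*\<rho>} s = ennreal (indicator {0..2*\<rho>} s * h (x - s *\<^sub>R e))" for s
        by (simp add: indicator_def)
      ultimately show ?thesis by simp
    qed
    ultimately show ?thesis by (simp add: ennreal_leI)
  qed
  have "(\<integral>\<^sup>+x. ennreal (\<bar>\<phi> x\<bar> - 2 * \<rho> * R) * indicator \<Omega> x \<partial>lborel)
      \<le> (\<integral>\<^sup>+x. (\<integral>\<^sup>+s. ennreal (h (x - s *\<^sub>R e)) * indicator {0..2*\<rho>} s \<partial>lborel) \<partial>lborel)"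
  proof (rule nn_integral_mono)
    fix x show "ennreal (\<bar>\<phi> x\<bar> - 2 * \<rho> * R) * indicator \<Omega> x
        \<le> (\<integral>\<^sup>+s. ennreal (h (x - s *\<^sub>R e)) * indicator {0..2*\<rho>} s \<partial>lborel)"
      by (cases "x \<in> \<Omega>") (simp_all add: line)
  qed
  \<comment> \<open>After the exchange of integrals the inner one is independent of \<open>s\<close>
    by translation invariance, so the length of the segment comes out as a factor.\<close>
  also have "\<dots> = (\<integral>\<^sup>+s. (\<integral>\<^sup>+x. ennreal (h (x - s *\<^sub>R e)) * indicator {0..2*\<rho>} s \<partial>lborel) \<partial>lborel)"
    by (rule lborel_pair.Fubini') measurable
  also have "\<dots> = (\<integral>\<^sup>+s. (\<integral>\<^sup>+x. ennreal (h x) \<partial>lborel) * indicator {0..2*\<rho>} s \<partial>lborel)"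
    by (subst nn_integral_multc) (auto simp: nn_integral_lborel_shift[of "\<lambda>x. ennreal (h x)"])
  also have "\<dots> = (\<integral>\<^sup>+x. ennreal (h x) \<partial>lborel) * ennreal (2 * \<rho>)"
    using \<open>0 < \<rho>\<close> by (subst nn_integral_cmult) auto
  also have "(\<integral>\<^sup>+x. ennreal (h x) \<partial>lborel) = (\<integral>\<^sup>+x. ennreal (norm (grad \<phi> x) - R) \<partial>lborel)"
    by (intro nn_integral_cong) (simp add: h_def max_def ennreal_neg)
  finally show ?thesis by (simp add: mult.commute)
qed


text \<open>The approximating gradients converge only in the mean and may exceed \<open>R\<close>.
  Their excess over \<open>R\<close> is at most \<open>norm (grad (\<phi> n) x - D x)\<close>, which
  tends to \<open>0\<close> in L1; hence so does the excess of \<open>\<bar>\<phi> n x\<bar>\<close>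
  over \<open>B\<close>, and the excess of \<open>\<bar>v x\<bar>\<close> integrates to
  \<open>0\<close>.\<close>

lemma H10_sup_bound:
  fixes \<Omega> :: "'a::euclidean_space set"
  assumes "open \<Omega>" and \<Omega>: "\<Omega> \<subseteq> ball 0 \<rho>" and "0 < \<rho>" "0 \<le> R"
    and H: "H10_approximation \<Omega> v D \<phi>" and D: "AE x in lebesgue_on \<Omega>. norm (D x) \<le> R"
  shows "AE x in lebesgue_on \<Omega>. \<bar>v x\<bar> \<le> 2 * \<rho> * R"
proof -
  let ?M = "lebesgue_on \<Omega>"
  define B where "B = 2 * \<rho> * R"
  have bdd: "bounded \<Omega>" using \<Omega> bounded_ball bounded_subset by blast
  have fin: "finite_measure ?M" by (rule finite_measure_lebesgue_on_bounded[OF \<open>open \<Omega>\<close> bdd])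
  have \<Omega>L: "\<Omega> \<inter> space lebesgue \<in> sets lebesgue" "\<Omega> \<in> sets borel" using \<open>open \<Omega>\<close> by auto
  have v: "in_L2 ?M v" and DL2: "in_L2 ?M D" and test: "\<phi> n \<in> test_functions \<Omega>" for n
    using H by (auto simp: H10_approximation_def)
  have one: "in_L2 ?M (\<lambda>x. 1::real)"
    by (rule in_L2_bounded[OF fin, where K=1]) auto
  note tL2 = test_functions_in_L2[OF \<open>open \<Omega>\<close> bdd test]
  have lim1: "(\<lambda>n. \<integral>x. norm (\<phi> n x - v x) \<partial>?M) \<longlonglongrightarrow> 0"
    using L2_null_sequence[OF one in_L2_diff[OF tL2(1) v]] H by (simp add: H10_approximation_def)
  have lim2: "(\<lambda>n. \<integral>x. norm (grad (\<phi> n) x - D x) \<partial>?M) \<longlonglongrightarrow> 0"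
    using L2_null_sequence[OF one in_L2_diff[OF tL2(2) DL2]] H by (simp add: H10_approximation_def)
  note int1 = in_L2_integrable[OF fin in_L2_diff[OF tL2(1) v]]
  note int2 = in_L2_integrable[OF fin in_L2_diff[OF tL2(2) DL2]]
  note intv = in_L2_integrable[OF fin v] and int\<phi> = in_L2_integrable[OF fin tL2(1)]
  have const: "integrable ?M (\<lambda>x. B)" by (rule finite_measure.integrable_const[OF fin])
  have pos: "integrable ?M (\<lambda>x. max (\<bar>f x\<bar> - B) 0)" if "integrable ?M f" for f :: "'a \<Rightarrow> real"
    using that const by (intro integrable_max Bochner_Integration.integrable_diff integrable_abs) auto
  have main: "(\<integral>x. max (\<bar>\<phi> n x\<bar> - B) 0 \<partial>?M) \<le> 2 * \<rho> * (\<integral>x. norm (grad (\<phi> n) x - D x) \<partial>?M)" for n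
  proof -
    have sm: "smooth (\<phi> n)" using test by (rule test_functions_smooth)
    have [measurable]: "\<phi> n \<in> borel_measurable borel" "grad (\<phi> n) \<in> borel_measurable borel"
      by (intro borel_measurable_continuous_onI smooth_continuous_on continuous_on_grad sm)+
    have "ennreal (\<integral>x. max (\<bar>\<phi> n x\<bar> - B) 0 \<partial>?M) = (\<integral>\<^sup>+x. ennreal (max (\<bar>\<phi> n x\<bar> - B) 0) \<partial>?M)"
      using pos[OF int\<phi>] by (intro nn_integral_eq_integral[symmetric]) auto
    also have "\<dots> = (\<integral>\<^sup>+x. ennreal (\<bar>\<phi> n x\<bar> - B) * indicator \<Omega> x \<partial>lebesgue)"
      using \<Omega>L by (subst nn_integral_restrict_space) (auto intro!: nn_integral_cong simp: max_def ennreal_neg)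
    also have "\<dots> = (\<integral>\<^sup>+x. ennreal (\<bar>\<phi> n x\<bar> - B) * indicator \<Omega> x \<partial>lborel)"
      by (rule nn_integral_completion)
    also have "\<dots> \<le> ennreal (2 * \<rho>) * (\<integral>\<^sup>+x. ennreal (norm (grad (\<phi> n) x) - R) \<partial>lborel)"
      unfolding B_def by (rule test_function_excess_bound[OF test \<Omega> \<open>0 < \<rho>\<close> \<open>0 \<le> R\<close>])
    also have "(\<integral>\<^sup>+x. ennreal (norm (grad (\<phi> n) x) - R) \<partial>lborel)
        = (\<integral>\<^sup>+x. ennreal (norm (grad (\<phi> n) x) - R) * indicator \<Omega> x \<partial>lebesgue)"
    proof -
      have "grad (\<phi> n) x = 0" if "x \<notin> \<Omega>" for x
      proof -
        obtain K where "compact K" "K \<subseteq> \<Omega>" "\<And>x. x \<notin> K \<Longrightarrow> \<phi> n x = 0"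
          by (rule test_functions_support[OF test]) blast
        with that show ?thesis by (intro grad_eq_0_off_support[where K=K]) auto
      qed
      then have "ennreal (norm (grad (\<phi> n) x) - R) = ennreal (norm (grad (\<phi> n) x) - R) * indicator \<Omega> x" for x
        using \<open>0 \<le> R\<close> by (cases "x \<in> \<Omega>") (auto simp: ennreal_neg)
      then show ?thesis by (simp add: nn_integral_completion)
    qed
    also have "\<dots> = (\<integral>\<^sup>+x. ennreal (norm (grad (\<phi> n) x) - R) \<partial>?M)"
      using \<Omega>L by (subst nn_integral_restrict_space) auto
    also have "\<dots> \<le> (\<integral>\<^sup>+x. ennreal (norm (grad (\<phi> n) x - D x)) \<partial>?M)"
    proof (rule nn_integral_mono_AE)
      show "AE x in ?M. ennreal (norm (grad (\<phi> n) x) - R) \<le> ennreal (norm (grad (\<phi> n) x - D x))"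
        using D
      proof eventually_elim
        case (elim x)
        have "norm (grad (\<phi> n) x) - R \<le> norm (grad (\<phi> n) x - D x)"
          using norm_triangle_sub[of "grad (\<phi> n) x" "D x"] elim by linarith
        then show ?case by (rule ennreal_leI)
      qed
    qed
    also have "\<dots> = ennreal (\<integral>x. norm (grad (\<phi> n) x - D x) \<partial>?M)"
      using int2 by (intro nn_integral_eq_integral) auto
    finally have "ennreal (\<integral>x. max (\<bar>\<phi> n x\<bar> - B) 0 \<partial>?M)
        \<le> ennreal (2 * \<rho> * (\<integral>x. norm (grad (\<phi> n) x - D x) \<partial>?M))"
      using \<open>0 < \<rho>\<close> by (simp add: ennreal_mult mult_left_mono)
    moreover have "0 \<le> 2 * \<rho> * (\<integral>x. norm (grad (\<phi> n) x - D x) \<partial>?M)" using \<open>0 < \<rho>\<close> by simp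
    ultimately show ?thesis by (simp only: ennreal_le_iff)
  qed
  have "(\<integral>x. max (\<bar>v x\<bar> - B) 0 \<partial>?M)
      \<le> (\<integral>x. norm (\<phi> n x - v x) \<partial>?M) + 2 * \<rho> * (\<integral>x. norm (grad (\<phi> n) x - D x) \<partial>?M)" for n
  proof -
    have "(\<integral>x. max (\<bar>v x\<bar> - B) 0 \<partial>?M) \<le> (\<integral>x. norm (\<phi> n x - v x) + max (\<bar>\<phi> n x\<bar> - B) 0 \<partial>?M)"
      using pos[OF intv] pos[OF int\<phi>[of n]] int1[of n] by (intro integral_mono) auto
    also have "\<dots> = (\<integral>x. norm (\<phi> n x - v x) \<partial>?M) + (\<integral>x. max (\<bar>\<phi> n x\<bar> - B) 0 \<partial>?M)"
      using pos[OF int\<phi>[of n]] int1[of n] by (intro Bochner_Integration.integral_add) auto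
    finally show ?thesis using main[of n] by linarith
  qed
  moreover have "(\<lambda>n. (\<integral>x. norm (\<phi> n x - v x) \<partial>?M) + 2 * \<rho> * (\<integral>x. norm (grad (\<phi> n) x - D x) \<partial>?M)) \<longlonglongrightarrow> 0 + 2 * \<rho> * 0"
    by (intro tendsto_intros lim1 lim2)
  ultimately have "(\<integral>x. max (\<bar>v x\<bar> - B) 0 \<partial>?M) \<le> 0 + 2 * \<rho> * 0"
    by (intro LIMSEQ_le_const[of _ _ "\<integral>x. max (\<bar>v x\<bar> - B) 0 \<partial>?M"]) auto
  moreover have "0 \<le> (\<integral>x. max (\<bar>v x\<bar> - B) 0 \<partial>?M)" by simp
  ultimately have "(\<integral>x. max (\<bar>v x\<bar> - B) 0 \<partial>?M) = 0" by linarith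
  then have "AE x in ?M. max (\<bar>v x\<bar> - B) 0 = 0"
    using integral_nonneg_eq_0_iff_AE[OF pos[OF intv]] by simp
  then show ?thesis by eventually_elim (auto simp: B_def max_def split: if_splits)
qed

text \<open>An L1 function is replaced by a test function at a cost that the bound \<open>K\<close>
  controls uniformly in \<open>n\<close>. This upgrades convergence in the sense of distributions,
  which is what continuity of \<open>w\<close> in time gives for its gradient, to convergence
  against products such as \<open>w\<close> times a component of \<open>b\<close>.\<close>

lemma weak_convergence_L1:
  fixes \<Omega> :: "'a::euclidean_space set" and h :: "nat \<Rightarrow> 'a \<Rightarrow> real"
  assumes "open \<Omega>" "bounded \<Omega>" and f: "integrable (lebesgue_on \<Omega>) f"
    and h: "\<And>n. h n \<in> borel_measurable (lebesgue_on \<Omega>)" "h' \<in> borel_measurable (lebesgue_on \<Omega>)"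
    and bd: "\<And>n. AE x in lebesgue_on \<Omega>. \<bar>h n x\<bar> \<le> K" "AE x in lebesgue_on \<Omega>. \<bar>h' x\<bar> \<le> K"
    and lim: "\<And>\<phi>. \<phi> \<in> test_functions \<Omega> \<Longrightarrow>
      (\<lambda>n. \<integral>x. \<phi> x * h n x \<partial>lebesgue_on \<Omega>) \<longlonglongrightarrow> (\<integral>x. \<phi> x * h' x \<partial>lebesgue_on \<Omega>)"
  shows "(\<lambda>n. \<integral>x. f x * h n x \<partial>lebesgue_on \<Omega>) \<longlonglongrightarrow> (\<integral>x. f x * h' x \<partial>lebesgue_on \<Omega>)"
proof (rule LIMSEQ_I)
  let ?M = "lebesgue_on \<Omega>"
  fix e :: real assume "e > 0"
  \<comment> \<open>Two replacements cost \<open>d * \<bar>K\<bar>\<close> each and the convergence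
    for the test function costs \<open>d\<close>; the choice keeps
    \<open>2 * d * \<bar>K\<bar> + d\<close> below \<open>e\<close>.\<close>
  define d where "d = e / (4 * (\<bar>K\<bar> + 1))"
  have "d > 0" unfolding d_def using \<open>e > 0\<close> by simp
  have div: "e / L * L = e" if "L > 0" for L :: real using that by simp
  have dK: "d * (4 * (\<bar>K\<bar> + 1)) = e" unfolding d_def by (rule div) simp
  obtain \<phi> where \<phi>: "\<phi> \<in> test_functions \<Omega>" "(\<integral>x. \<bar>f x - \<phi> x\<bar> \<partial>?M) < d"
    using test_functions_dense_L1[OF assms(1-3) \<open>d > 0\<close>] by blast
  have int\<phi>: "integrable ?M \<phi>"
    using test_functions_in_L2(1)[OF assms(1,2) \<phi>(1)] finite_measure_lebesgue_on_bounded[OF assms(1,2)]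
    by (intro in_L2_integrable)
  have close: "\<bar>(\<integral>x. f x * k x \<partial>?M) - (\<integral>x. \<phi> x * k x \<partial>?M)\<bar> \<le> d * \<bar>K\<bar>"
    if k: "k \<in> borel_measurable ?M" "AE x in ?M. \<bar>k x\<bar> \<le> K" for k
  proof -
    note fk = integrable_mult_bounded[OF f k] and pk = integrable_mult_bounded[OF int\<phi> k]
    have "\<bar>(\<integral>x. f x * k x \<partial>?M) - (\<integral>x. \<phi> x * k x \<partial>?M)\<bar> = \<bar>\<integral>x. f x * k x - \<phi> x * k x \<partial>?M\<bar>"
      using fk pk by simp
    also have "\<dots> \<le> (\<integral>x. \<bar>f x * k x - \<phi> x * k x\<bar> \<partial>?M)"
      by (rule integral_abs_bound)
    also have "\<dots> \<le> (\<integral>x. \<bar>f x - \<phi> x\<bar> * \<bar>K\<bar> \<partial>?M)"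
    proof (rule integral_mono_AE)
      show "AE x in ?M. \<bar>f x * k x - \<phi> x * k x\<bar> \<le> \<bar>f x - \<phi> x\<bar> * \<bar>K\<bar>"
        using k(2)
      proof eventually_elim
        case (elim x)
        have "\<bar>f x * k x - \<phi> x * k x\<bar> = \<bar>f x - \<phi> x\<bar> * \<bar>k x\<bar>"
          by (simp add: abs_mult[symmetric] left_diff_distrib)
        also have "\<dots> \<le> \<bar>f x - \<phi> x\<bar> * \<bar>K\<bar>" using elim by (intro mult_left_mono) auto
        finally show ?case .
      qed
    qed (use fk pk f int\<phi> in auto)
    also have "\<dots> = (\<integral>x. \<bar>f x - \<phi> x\<bar> \<partial>?M) * \<bar>K\<bar>" by simp
    also have "\<dots> \<le> d * \<bar>K\<bar>" using \<phi>(2) by (intro mult_right_mono) auto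
    finally show ?thesis .
  qed
  obtain N where N: "\<And>n. n \<ge> N \<Longrightarrow> norm ((\<integral>x. \<phi> x * h n x \<partial>?M) - (\<integral>x. \<phi> x * h' x \<partial>?M)) < d"
    using LIMSEQ_D[OF lim[OF \<phi>(1)] \<open>d > 0\<close>] by blast
  have "norm ((\<integral>x. f x * h n x \<partial>?M) - (\<integral>x. f x * h' x \<partial>?M)) < e" if "n \<ge> N" for n
  proof -
    have "\<bar>(\<integral>x. f x * h n x \<partial>?M) - (\<integral>x. f x * h' x \<partial>?M)\<bar> \<le> d * \<bar>K\<bar> + d + d * \<bar>K\<bar>"
      using close[OF h(1) bd(1), of n] close[OF h(2) bd(2)] N[OF that] unfolding real_norm_def by linarith
    also have "\<dots> < d * (4 * (\<bar>K\<bar> + 1))"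
    proof -
      have "0 \<le> d * \<bar>K\<bar>" using \<open>d > 0\<close> by simp
      moreover have "d * (4 * (\<bar>K\<bar> + 1)) = 4 * (d * \<bar>K\<bar>) + 4 * d" by (simp add: algebra_simps)
      ultimately show ?thesis using \<open>d > 0\<close> by linarith
    qed
    finally show ?thesis using dK by simp
  qed
  then show "\<exists>no. \<forall>n\<ge>no. norm ((\<integral>x. f x * h n x \<partial>?M) - (\<integral>x. f x * h' x \<partial>?M)) < e" by blast
qed

section \<open>The weak time derivative\<close>

lemma smooth_has_real_derivative:
  fixes f :: "real \<Rightarrow> real"
  assumes "smooth f"
  shows "(f has_real_derivative deriv f t) (at t)" and "deriv f t = frechet_derivative f (at t) 1"
proof -
  have "(f has_derivative (\<lambda>h. frechet_derivative f (at t) 1 * h)) (at t)"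
  proof -
    have "frechet_derivative f (at t) h = frechet_derivative f (at t) 1 * h" for h
      using linear_cmul[OF linear_frechet_derivative[OF smooth_differentiable[OF assms]], of t h 1]
      by (simp add: mult.commute)
    then have "frechet_derivative f (at t) = (\<lambda>h. frechet_derivative f (at t) 1 * h)" by (rule ext)
    then show ?thesis using smooth_has_derivative[OF assms, of t] by argo
  qed
  then have "(f has_real_derivative frechet_derivative f (at t) 1) (at t)"
    by (simp add: has_field_derivative_def)
  then show "(f has_real_derivative deriv f t) (at t)" "deriv f t = frechet_derivative f (at t) 1"
    using DERIV_imp_deriv by metis+
qed

lemma smooth_deriv:
  fixes f :: "real \<Rightarrow> real"
  assumes "smooth f" shows "smooth (deriv f)"
proof -
  have "deriv f = (\<lambda>t. frechet_derivative f (at t) 1)"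
    by (rule ext) (rule smooth_has_real_derivative(2)[OF assms])
  then show ?thesis using smooth_frechet_derivative[OF assms, of 1] by simp
qed

lemma smooth_affine_chain:
  fixes s :: "real \<Rightarrow> real"
  assumes "smooth s"
  shows "((\<lambda>t. s (k * (t - a))) has_real_derivative k * deriv s (k * (t - a))) (at t within S)"
proof -
  have "((\<lambda>t. k * (t - a)) has_real_derivative k) (at t within S)"
    by (auto intro!: derivative_eq_intros)
  from DERIV_chain2[OF smooth_has_real_derivative(1)[OF assms] this] show ?thesis
    by (simp add: mult.commute)
qed

lemma test_functions_deriv:
  fixes \<theta> :: "real \<Rightarrow> real"
  assumes "\<theta> \<in> test_functions U" shows "deriv \<theta> \<in> test_functions U"
proof -
  obtain K where K: "compact K" "K \<subseteq> U" "\<And>x. x \<notin> K \<Longrightarrow> \<theta> x = 0"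
    by (rule test_functions_support[OF assms]) blast
  show ?thesis
  proof (rule test_functionsI[OF smooth_deriv K(1,2)])
    show "smooth \<theta>" using assms by (rule test_functions_smooth)
    then show "deriv \<theta> x = 0" if "x \<notin> K" for x
      using grad_eq_0_off_support[OF K(1,3) that] by (simp add: grad_def smooth_has_real_derivative(2))
  qed
qed

text \<open>Tensor products are the test functions that separate time from space, both in the weak
  time derivative and in the coercivity condition.\<close>

lemma test_functions_product:
  fixes \<phi> :: "'a::euclidean_space \<Rightarrow> real" and \<theta> :: "'b::euclidean_space \<Rightarrow> real"
  assumes \<phi>: "\<phi> \<in> test_functions U" and \<theta>: "\<theta> \<in> test_functions V"
  shows "(\<lambda>z. \<phi> (fst z) * \<theta> (snd z)) \<in> test_functions (U \<times> V)"
proof -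
  obtain K where K: "compact K" "K \<subseteq> U" "\<And>x. x \<notin> K \<Longrightarrow> \<phi> x = 0"
    by (rule test_functions_support[OF \<phi>]) blast
  obtain L where L: "compact L" "L \<subseteq> V" "\<And>x. x \<notin> L \<Longrightarrow> \<theta> x = 0"
    by (rule test_functions_support[OF \<theta>]) blast
  show ?thesis
  proof (rule test_functionsI[where K="K \<times> L"])
    show "smooth (\<lambda>z. \<phi> (fst z) * \<theta> (snd z))"
      by (intro smooth_mult smooth_compose_linear[OF test_functions_smooth[OF \<phi>] bounded_linear_fst]
          smooth_compose_linear[OF test_functions_smooth[OF \<theta>] bounded_linear_snd])
    show "\<phi> (fst z) * \<theta> (snd z) = 0" if "z \<notin> K \<times> L" for z
      using that K(3)[of "fst z"] L(3)[of "snd z"] by (cases z) auto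
  qed (use K L in \<open>auto intro: compact_Times\<close>)
qed

lemma integrable_lebesgue_on_subset:
  fixes f :: "'a::euclidean_space \<Rightarrow> 'b::euclidean_space"
  assumes f: "integrable (lebesgue_on S) f" and "T \<subseteq> S" and S: "S \<in> sets lebesgue" and T: "T \<in> sets lebesgue"
  shows "integrable (lebesgue_on T) f"
proof -
  have S': "S \<inter> space lebesgue \<in> sets lebesgue" and T': "T \<inter> space lebesgue \<in> sets lebesgue"
    using S T by auto
  have "integrable lebesgue (\<lambda>x. indicator S x *\<^sub>R f x)"
    using f by (simp only: integrable_restrict_space[OF S'])
  then have "integrable lebesgue (\<lambda>x. indicator T x *\<^sub>R (indicator S x *\<^sub>R f x))"
    by (rule integrable_mult_indicator[OF T])
  moreover have "indicator T x *\<^sub>R (indicator S x *\<^sub>R f x) = indicator T x *\<^sub>R f x" for x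
    using \<open>T \<subseteq> S\<close> by (auto simp: indicator_def)
  ultimately show ?thesis by (simp only: integrable_restrict_space[OF T'])
qed

lemma integral_lebesgue_on_indicator:
  fixes f :: "'a::euclidean_space \<Rightarrow> 'b::euclidean_space"
  assumes "T \<subseteq> S" "S \<in> sets lebesgue" "T \<in> sets lebesgue"
  shows "(\<integral>x. indicator T x *\<^sub>R f x \<partial>lebesgue_on S) = (\<integral>x. f x \<partial>lebesgue_on T)"
proof -
  have "indicator T x *\<^sub>R f x = (if x \<in> T then f x else 0)" for x by simp
  then show ?thesis using integral_restrict[OF assms(1,3,2), of f] by simp
qed

lemma lebesgue_on_Ioo_eq_integral:
  fixes f :: "real \<Rightarrow> real"
  assumes "integrable (lebesgue_on {a<..<b}) f"
  shows "f integrable_on {a..b}" "(\<integral>t. f t \<partial>lebesgue_on {a<..<b}) = integral {a..b} f"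
  using integrable_on_lebesgue_on[OF assms] lebesgue_integral_eq_integral[OF assms]
  by (auto simp: integrable_on_open_interval_real integral_open_interval_real)

lemma continuous_imp_integrable_Ioo:
  fixes f :: "real \<Rightarrow> real"
  assumes "continuous_on {a..b} f"
  shows "integrable (lebesgue_on {a<..<b}) f"
  by (rule integrable_lebesgue_on_subset[OF continuous_imp_integrable_real[OF assms]]) auto

lemma mono_deriv_nonneg:
  fixes s :: "real \<Rightarrow> real"
  assumes "mono s" "(s has_real_derivative D) (at x)" shows "0 \<le> D"
proof -
  have "((\<lambda>y. (s y - s x) / (y - x)) \<longlongrightarrow> D) (at x)"
    using assms(2) by (simp add: has_field_derivative_iff)
  moreover have "0 \<le> (s y - s x) / (y - x)" for y
    using monoD[OF assms(1), of x y] monoD[OF assms(1), of y x]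
    by (cases "x \<le> y") (auto intro: divide_nonneg_nonneg divide_nonpos_nonpos)
  ultimately show ?thesis
    by (intro tendsto_lowerbound[where F="at x"]) auto
qed

text \<open>The derivative of \<open>s (k * (t - a))\<close> is nonnegative, vanishes outside the
  interval from \<open>a\<close> to \<open>a + 1 / k\<close> and has integral \<open>1\<close>. It
  is an approximate identity, and its integral against \<open>U\<close> is a mean of values close to
  \<open>U a\<close>.\<close>

lemma step_concentration:
  fixes s U :: "real \<Rightarrow> real"
  assumes s: "smooth s" "\<And>r. r \<le> 0 \<Longrightarrow> s r = 0" "\<And>r. r \<ge> 1 \<Longrightarrow> s r = 1" "mono s"
    and U: "continuous_on {0..T} U" and a: "0 \<le> a" "a + 1 / k \<le> T" "0 < k"
    and close: "\<And>t. a \<le> t \<Longrightarrow> t \<le> a + 1 / k \<Longrightarrow> \<bar>U t - U a\<bar> \<le> e"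
  shows "\<bar>(\<integral>t. k * deriv s (k * (t - a)) * U t \<partial>lebesgue_on {0<..<T}) - U a\<bar> \<le> e"
proof -
  let ?I = "lebesgue_on {0<..<T}"
  define q where "q t = k * deriv s (k * (t - a))" for t
  have ds: "(s has_real_derivative deriv s r) (at r)" for r by (rule smooth_has_real_derivative(1)[OF s(1)])
  have dq: "((\<lambda>t. s (k * (t - a))) has_real_derivative q t) (at t within S)" for t S
    unfolding q_def by (rule smooth_affine_chain[OF s(1)])
  have cq: "continuous_on S q" for S
    unfolding q_def by (intro continuous_intros continuous_on_compose2[OF smooth_continuous_on[OF smooth_deriv[OF s(1)], of UNIV]]) auto
  have q0: "0 \<le> q t" for t
    using mono_deriv_nonneg[OF s(4) ds] \<open>0 < k\<close> by (simp add: q_def)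
  have qout: "q t = 0" if "t < a \<or> t > a + 1 / k" for t
  proof -
    define r where "r = k * (t - a)"
    have "r < 0 \<or> r > 1"
      using that \<open>0 < k\<close> unfolding r_def by (auto simp: mult_less_0_iff field_simps)
    then have "deriv s r = 0"
    proof
      assume "r < 0"
      have "(s has_real_derivative 0) (at r)"
        by (rule has_field_derivative_transform_within_open[OF DERIV_const[of 0], of "{..<0}"])
           (use s(2) \<open>r < 0\<close> in auto)
      then show ?thesis by (rule DERIV_imp_deriv)
    next
      assume "r > 1"
      have "(s has_real_derivative 0) (at r)"
        by (rule has_field_derivative_transform_within_open[OF DERIV_const[of 1], of "{1<..}"])
           (use s(3) \<open>r > 1\<close> in auto)
      then show ?thesis by (rule DERIV_imp_deriv)
    qed
    then show ?thesis by (simp add: q_def r_def)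
  qed
  have "0 < 1 / k" using \<open>0 < k\<close> by simp
  then have "0 \<le> T" using a by linarith
  have qint: "integrable ?I q" by (rule continuous_imp_integrable_Ioo[OF cq])
  have qU: "integrable ?I (\<lambda>t. q t * U t)"
    by (intro continuous_imp_integrable_Ioo continuous_intros cq U)
  have qabs: "integrable ?I (\<lambda>t. q t * \<bar>U t - U a\<bar>)"
    by (intro continuous_imp_integrable_Ioo continuous_intros cq U)
  have one: "(\<integral>t. q t \<partial>?I) = 1"
  proof -
    have "(q has_integral (s (k * (T - a)) - s (k * (0 - a)))) {0..T}"
      using \<open>0 \<le> T\<close> by (intro fundamental_theorem_of_calculus)
        (use dq in \<open>auto simp: has_real_derivative_iff_has_vector_derivative\<close>)
    moreover have "1 \<le> k * (T - a)"
      using a by (simp add: field_simps)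
    moreover have "k * (0 - a) \<le> 0" using a by (simp add: mult_nonneg_nonneg)
    ultimately have "(q has_integral 1) {0..T}" using s(2,3) by simp
    then show ?thesis using lebesgue_on_Ioo_eq_integral(2)[OF qint] by (simp add: integral_unique)
  qed
  have "(\<integral>t. q t * U t \<partial>?I) - U a = (\<integral>t. q t * U t \<partial>?I) - (\<integral>t. q t * U a \<partial>?I)"
    using one by simp
  also have "\<dots> = (\<integral>t. q t * U t - q t * U a \<partial>?I)"
    using qint qU by (intro Bochner_Integration.integral_diff[symmetric]) auto
  finally have "\<bar>(\<integral>t. q t * U t \<partial>?I) - U a\<bar> \<le> (\<integral>t. \<bar>q t * U t - q t * U a\<bar> \<partial>?I)"
    using integral_abs_bound by metis
  also have "\<dots> = (\<integral>t. q t * \<bar>U t - U a\<bar> \<partial>?I)"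
    using q0 by (intro Bochner_Integration.integral_cong) (auto simp: abs_mult right_diff_distrib[symmetric])
  also have "\<dots> \<le> (\<integral>t. q t * e \<partial>?I)"
  proof (rule integral_mono[OF qabs])
    show "q t * \<bar>U t - U a\<bar> \<le> q t * e" for t
      using close[of t] q0[of t] qout[of t] by (cases "a \<le> t \<and> t \<le> a + 1 / k") (auto intro: mult_left_mono)
  qed (use qint in auto)
  also have "\<dots> = e" using one by simp
  finally show ?thesis by (simp add: q_def)
qed

text \<open>The test function is a smoothed indicator of the interval from \<open>\<sigma>\<close>
  to \<open>\<tau>\<close>, a difference of two steps. Its derivative consists of two approximate
  identities, which pick out \<open>U \<sigma> - U \<tau>\<close>, while the side with
  \<open>V\<close> converges to minus the integral over the interval.\<close>

lemma du_bois_reymond: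
  fixes U V :: "real \<Rightarrow> real"
  assumes U: "continuous_on {0..T} U" and V: "integrable (lebesgue_on {0<..<T}) V"
    and test: "\<And>\<theta>. \<theta> \<in> test_functions {0<..<T} \<Longrightarrow>
      (\<integral>t. deriv \<theta> t * U t \<partial>lebesgue_on {0<..<T}) = - (\<integral>t. \<theta> t * V t \<partial>lebesgue_on {0<..<T})"
    and st: "0 < \<sigma>" "\<sigma> < \<tau>" "\<tau> < T"
  shows "U \<tau> - U \<sigma> = (\<integral>t. V t \<partial>lebesgue_on {\<sigma><..<\<tau>})"
proof -
  let ?I = "lebesgue_on {0<..<T}"
  obtain s :: "real \<Rightarrow> real" where s: "smooth s" "\<And>r. r \<le> 0 \<Longrightarrow> s r = 0" "\<And>r. r \<ge> 1 \<Longrightarrow> s r = 1"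
    "\<And>r. 0 \<le> s r" "\<And>r. s r \<le> 1" "mono s" using smooth_step_exists by metis
  define \<theta> where "\<theta> n t = s (real n * (t - \<sigma>)) - s (real n * (t - \<tau>))" for n :: nat and t
  have ds: "(s has_real_derivative deriv s r) (at r)" for r by (rule smooth_has_real_derivative(1)[OF s(1)])
  have sm: "smooth (\<lambda>t. s (real n * (t - a)))" for n a
  proof -
    have "smooth (\<lambda>t::real. t)" by (rule smooth_bounded_linear) (rule bounded_linear_ident)
    then show ?thesis by (intro smooth_compose[OF _ s(1)] smooth_mult smooth_diff smooth_const)
  qed
  have d\<theta>: "deriv (\<theta> n) t = real n * deriv s (real n * (t - \<sigma>)) - real n * deriv s (real n * (t - \<tau>))" for n t
    unfolding \<theta>_def by (intro DERIV_imp_deriv DERIV_diff smooth_affine_chain[OF s(1)])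
  have lim: "(\<lambda>n. \<integral>t. \<theta> n t *\<^sub>R V t \<partial>?I) \<longlonglongrightarrow> (\<integral>t. indicator {\<sigma><..\<tau>} t *\<^sub>R V t \<partial>?I)"
  proof (rule integral_bounded_convergence[OF V, where K=1])
    show "\<theta> n \<in> borel_measurable ?I" for n
      unfolding \<theta>_def[abs_def] by (intro lebesgue_on_continuous_measurable smooth_continuous_on smooth_diff sm) auto
    show "indicat_real {\<sigma><..\<tau>} \<in> borel_measurable ?I"
      by (rule lebesgue_on_indicator_measurable) auto
    show "AE t in ?I. \<bar>\<theta> n t\<bar> \<le> 1" for n
    proof (rule AE_I2)
      fix t show "\<bar>\<theta> n t\<bar> \<le> 1"
        using s(4,5)[of "real n * (t - \<sigma>)"] s(4,5)[of "real n * (t - \<tau>)"] unfolding \<theta>_def by linarith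
    qed
    have step: "(\<lambda>n. s (real n * (t - a))) \<longlonglongrightarrow> (if t \<le> a then 0 else 1)" for t a
    proof (cases "t \<le> a")
      case True
      then show ?thesis using s(2) by (simp add: mult_nonneg_nonpos)
    next
      case False
      then obtain N :: nat where N: "1 / (t - a) \<le> real N" using real_arch_simple by blast
      have "s (real n * (t - a)) = 1" if "n \<ge> N" for n
      proof (rule s(3))
        have "1 / (t - a) \<le> real n" using N that by linarith
        then show "1 \<le> real n * (t - a)" using False by (simp add: pos_divide_le_eq)
      qed
      with False show ?thesis
        by (auto intro!: tendsto_eventually eventually_sequentiallyI[of N])
    qed
    show "AE t in ?I. (\<lambda>n. \<theta> n t) \<longlonglongrightarrow> indicator {\<sigma><..\<tau>} t"
    proof (rule AE_I2)
      fix t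
      have "(\<lambda>n. \<theta> n t) \<longlonglongrightarrow> (if t \<le> \<sigma> then 0 else 1) - (if t \<le> \<tau> then 0 else 1)"
        unfolding \<theta>_def by (intro tendsto_diff step)
      then show "(\<lambda>n. \<theta> n t) \<longlonglongrightarrow> indicator {\<sigma><..\<tau>} t"
        using st by (auto simp: indicator_def split: if_splits)
    qed
  qed
  have "(\<integral>t. indicator {\<sigma><..\<tau>} t *\<^sub>R V t \<partial>?I) = (\<integral>t. V t \<partial>lebesgue_on {\<sigma><..\<tau>})"
    using st by (intro integral_lebesgue_on_indicator) auto
  \<comment> \<open>Both steps rise to the right of their base point, which leaves a half-open
    interval; one endpoint does not affect the integral.\<close>
  also have "\<dots> = (\<integral>t. V t \<partial>lebesgue_on {\<sigma><..<\<tau>})"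
  proof -
    have i1: "integrable (lebesgue_on {\<sigma><..\<tau>}) V" and i2: "integrable (lebesgue_on {\<sigma><..<\<tau>}) V"
      using st by (auto intro!: integrable_lebesgue_on_subset[OF V])
    have "negligible {\<tau>}" by simp
    then have "integral {\<sigma><..\<tau>} V = integral {\<sigma><..<\<tau>} V"
      by (intro integral_spike_set) (auto intro: negligible_subset[of "{\<tau>}"])
    then show ?thesis using lebesgue_integral_eq_integral[OF i1] lebesgue_integral_eq_integral[OF i2] by simp
  qed
  finally have limV: "(\<lambda>n. - (\<integral>t. \<theta> n t * V t \<partial>?I)) \<longlonglongrightarrow> - (\<integral>t. V t \<partial>lebesgue_on {\<sigma><..<\<tau>})"
    using lim by (simp add: tendsto_minus)
  have double: "\<bar>- (\<integral>t. V t \<partial>lebesgue_on {\<sigma><..<\<tau>}) - (U \<sigma> - U \<tau>)\<bar> \<le> 2 * e" if "e > 0" for e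
  proof -
    have "\<exists>d>0. \<forall>t\<in>{0..T}. \<bar>t - a\<bar> < d \<longrightarrow> \<bar>U t - U a\<bar> < e" if "a \<in> {0..T}" for a
      using U that \<open>e > 0\<close> unfolding continuous_on_iff dist_real_def by blast
    from this[of \<sigma>] this[of \<tau>] obtain d d' where d: "d > 0" "\<And>t. t \<in> {0..T} \<Longrightarrow> \<bar>t - \<sigma>\<bar> < d \<Longrightarrow> \<bar>U t - U \<sigma>\<bar> < e"
      and d': "d' > 0" "\<And>t. t \<in> {0..T} \<Longrightarrow> \<bar>t - \<tau>\<bar> < d' \<Longrightarrow> \<bar>U t - U \<tau>\<bar> < e"
      using st by auto
    \<comment> \<open>Besides the moduli of continuity at both points, \<open>T - \<tau>\<close>
      limits the width \<open>1 / real n\<close> of the steps, so that the support ends before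
      \<open>T\<close>.\<close>
    define \<delta> where "\<delta> = min (min d d') (T - \<tau>)"
    have "\<delta> > 0" using d(1) d'(1) st by (simp add: \<delta>_def)
    then obtain N :: nat where N: "1 / \<delta> < real N" using reals_Archimedean2 by blast
    have "\<bar>- (\<integral>t. \<theta> n t * V t \<partial>?I) - (U \<sigma> - U \<tau>)\<bar> \<le> 2 * e" if "n \<ge> N" for n
    proof -
      have n: "1 / \<delta> < real n" using N that by linarith
      then have "0 < real n" using \<open>\<delta> > 0\<close> by (meson less_trans zero_less_divide_1_iff)
      with n \<open>\<delta> > 0\<close> have n\<delta>: "1 / real n < \<delta>" by (simp add: field_simps)
      have small: "1 / real n < d" "1 / real n < d'" "\<tau> + 1 / real n < T" using n\<delta> by (auto simp: \<delta>_def)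
      have "0 < 1 / real n" using \<open>0 < real n\<close> by simp
      let ?J = "\<lambda>a. \<integral>t. real n * deriv s (real n * (t - a)) * U t \<partial>?I"
      have 1: "\<bar>?J \<sigma> - U \<sigma>\<bar> \<le> e"
      proof (rule step_concentration[OF s(1-3,6) U _ _ \<open>0 < real n\<close>])
        show "\<bar>U t - U \<sigma>\<bar> \<le> e" if "\<sigma> \<le> t" "t \<le> \<sigma> + 1 / real n" for t
          using d(2)[of t] that small st by (intro less_imp_le) auto
      qed (use st small in auto)
      have 2: "\<bar>?J \<tau> - U \<tau>\<bar> \<le> e"
      proof (rule step_concentration[OF s(1-3,6) U _ _ \<open>0 < real n\<close>])
        show "\<bar>U t - U \<tau>\<bar> \<le> e" if "\<tau> \<le> t" "t \<le> \<tau> + 1 / real n" for t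
          using d'(2)[of t] that small st by (intro less_imp_le) auto
      qed (use st small in auto)
      have "\<theta> n \<in> test_functions {0<..<T}"
      proof (rule test_functionsI[where K="{\<sigma>..\<tau> + 1 / real n}"])
        show "smooth (\<theta> n)" unfolding \<theta>_def[abs_def] by (intro smooth_diff sm)
        show "\<theta> n t = 0" if "t \<notin> {\<sigma>..\<tau> + 1 / real n}" for t
        proof (cases "t < \<sigma>")
          case True
          then have "real n * (t - \<sigma>) \<le> 0" "real n * (t - \<tau>) \<le> 0"
            using st by (auto intro!: mult_nonneg_nonpos)
          then show ?thesis using s(2) by (simp add: \<theta>_def)
        next
          case False
          then have "t - \<tau> > 1 / real n" using that by auto
          then have 3: "real n * (t - \<tau>) \<ge> 1" using \<open>0 < real n\<close> by (simp add: field_simps)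
          have "real n * (t - \<tau>) \<le> real n * (t - \<sigma>)" using st by (intro mult_left_mono) auto
          with 3 show ?thesis using s(3) by (simp add: \<theta>_def)
        qed
      qed (use st small in auto)
      then have "- (\<integral>t. \<theta> n t * V t \<partial>?I) = (\<integral>t. deriv (\<theta> n) t * U t \<partial>?I)"
        by (simp add: test)
      also have "\<dots> = (\<integral>t. real n * deriv s (real n * (t - \<sigma>)) * U t - real n * deriv s (real n * (t - \<tau>)) * U t \<partial>?I)"
        by (simp add: d\<theta> left_diff_distrib)
      also have "\<dots> = ?J \<sigma> - ?J \<tau>"
      proof (rule Bochner_Integration.integral_diff)
        have "integrable ?I (\<lambda>t. real n * deriv s (real n * (t - a)) * U t)" for a
          by (intro continuous_imp_integrable_Ioo continuous_intros U
              continuous_on_compose2[OF smooth_continuous_on[OF smooth_deriv[OF s(1)], of UNIV]]) auto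
        then show "integrable ?I (\<lambda>t. real n * deriv s (real n * (t - \<sigma>)) * U t)"
          "integrable ?I (\<lambda>t. real n * deriv s (real n * (t - \<tau>)) * U t)" by auto
      qed
      finally show ?thesis using 1 2 by linarith
    qed
    then have ev: "\<forall>\<^sub>F n in sequentially. \<bar>- (\<integral>t. \<theta> n t * V t \<partial>?I) - (U \<sigma> - U \<tau>)\<bar> \<le> 2 * e"
      by (auto simp: eventually_sequentially)
    have "(\<lambda>n. \<bar>- (\<integral>t. \<theta> n t * V t \<partial>?I) - (U \<sigma> - U \<tau>)\<bar>)
        \<longlonglongrightarrow> \<bar>- (\<integral>t. V t \<partial>lebesgue_on {\<sigma><..<\<tau>}) - (U \<sigma> - U \<tau>)\<bar>"
      by (intro tendsto_intros limV)
    then show ?thesis by (rule tendsto_upperbound) (use ev in auto)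
  qed
  have "\<bar>- (\<integral>t. V t \<partial>lebesgue_on {\<sigma><..<\<tau>}) - (U \<sigma> - U \<tau>)\<bar> \<le> e" if "e > 0" for e
    using double[of "e / 2"] that by simp
  then have "\<bar>- (\<integral>t. V t \<partial>lebesgue_on {\<sigma><..<\<tau>}) - (U \<sigma> - U \<tau>)\<bar> \<le> 0"
    by - (rule field_le_epsilon, simp)
  then show ?thesis by simp
qed

text \<open>On a partition into short pieces the bounds telescope, since the increments of
  \<open>A\<close> add up; so the total change is at most \<open>e * (A b - A a)\<close> for every
  \<open>e > 0\<close>. In the application \<open>A\<close> is the indefinite integral of the
  absolute values of two time derivatives.\<close>

lemma increments_dominated_imp_constant:
  fixes P A :: "real \<Rightarrow> real"
  assumes "a \<le> b"
    and small: "\<And>e. e > 0 \<Longrightarrow> \<exists>d>0. \<forall>s t. a \<le> s \<longrightarrow> s \<le> t \<longrightarrow> t \<le> b \<longrightarrow> t - s < d \<longrightarrow> \<bar>P t - P s\<bar> \<le> e * (A t - A s)"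
  shows "P b = P a"
proof -
  have bound: "\<bar>P b - P a\<bar> \<le> e * (A b - A a)" if "e > 0" for e
  proof -
    obtain d where d: "d > 0" "\<And>s t. a \<le> s \<Longrightarrow> s \<le> t \<Longrightarrow> t \<le> b \<Longrightarrow> t - s < d \<Longrightarrow> \<bar>P t - P s\<bar> \<le> e * (A t - A s)"
      using small[OF \<open>e > 0\<close>] by blast
    obtain n :: nat where n: "(b - a) / d < real n" using reals_Archimedean2 by blast
    have "0 \<le> (b - a) / d" using \<open>a \<le> b\<close> d(1) by simp
    with n have n0: "0 < real n" by linarith
    define h where "h = (b - a) / real n"
    have "0 \<le> h" using \<open>a \<le> b\<close> n0 by (simp add: h_def)
    have "h < d" using n n0 d(1) by (simp add: h_def field_simps)
    have "\<bar>P (a + real i * h) - P a\<bar> \<le> e * (A (a + real i * h) - A a)" if "i \<le> n" for i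
      using that
    proof (induction i)
      case 0
      then show ?case by simp
    next
      case (Suc i)
      have "real (Suc i) * h \<le> real n * h" using Suc.prems \<open>0 \<le> h\<close> by (intro mult_right_mono) auto
      also have "\<dots> = b - a" using n0 by (simp add: h_def)
      finally have le: "a + real (Suc i) * h \<le> b" by simp
      have "0 \<le> real i * h" using \<open>0 \<le> h\<close> by simp
      then have "\<bar>P (a + real (Suc i) * h) - P (a + real i * h)\<bar> \<le> e * (A (a + real (Suc i) * h) - A (a + real i * h))"
        using le \<open>0 \<le> h\<close> \<open>h < d\<close> by (intro d(2)) (auto simp: algebra_simps)
      moreover have "\<bar>P (a + real i * h) - P a\<bar> \<le> e * (A (a + real i * h) - A a)"
        using Suc by simp
      ultimately show ?case by (simp add: right_diff_distrib)
    qed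
    from this[of n] show ?thesis using n0 by (simp add: h_def)
  qed
  have "\<bar>P b - P a\<bar> \<le> e" if "e > 0" for e
  proof -
    define K where "K = \<bar>A b - A a\<bar> + 1"
    have "K > 0" by (simp add: K_def)
    have "\<bar>P b - P a\<bar> \<le> e / K * (A b - A a)" using bound[of "e / K"] that \<open>K > 0\<close> by simp
    also have "\<dots> \<le> e / K * K" using that \<open>K > 0\<close> by (intro mult_left_mono) (auto simp: K_def)
    also have "\<dots> = e" using \<open>K > 0\<close> by simp
    finally show ?thesis .
  qed
  then have "\<bar>P b - P a\<bar> \<le> 0" by - (rule field_le_epsilon, simp)
  then show ?thesis by simp
qed


lemma uniform_bound_integral:
  fixes f :: "'a \<Rightarrow> real"
  assumes "integrable M f" "integrable M g" "AE x in M. \<bar>f x\<bar> \<le> e * g x"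
  shows "\<bar>\<integral>x. f x \<partial>M\<bar> \<le> e * (\<integral>x. g x \<partial>M)"
proof -
  have "\<bar>\<integral>x. f x \<partial>M\<bar> \<le> (\<integral>x. \<bar>f x\<bar> \<partial>M)" by (rule integral_abs_bound)
  also have "\<dots> \<le> (\<integral>x. e * g x \<partial>M)"
    using assms by (intro integral_mono_AE) auto
  finally show ?thesis by simp
qed

section \<open>Continuous functions on the space-time cylinder and their time increments\<close>

locale cylinder_domain =
  fixes \<Omega> :: "'a::euclidean_space set" and T :: real
  assumes open_domain: "open \<Omega>" and bounded_domain: "bounded \<Omega>" and T_pos: "0 < T"
begin

abbreviation "Q \<equiv> cylinder \<Omega> T"
abbreviation "I \<equiv> lebesgue_on {0<..<T}"
abbreviation "M \<equiv> lebesgue_on \<Omega>"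

lemma finite_M: "finite_measure M"
  by (rule finite_measure_lebesgue_on_bounded[OF open_domain bounded_domain])

lemma open_cylinder: "open Q" and bounded_cylinder: "bounded Q"
  using open_domain bounded_domain by (auto simp: cylinder_def intro: open_Times bounded_Times)

lemma finite_Q: "finite_measure (lebesgue_on Q)"
  by (rule finite_measure_lebesgue_on_bounded[OF open_cylinder bounded_cylinder])

lemma closure_cylinder: "closure Q = closure \<Omega> \<times> {0..T}"
  using T_pos by (simp add: cylinder_def closure_Times)

lemmas Fubini_Q = Fubini_lebesgue_on[OF open_domain open_greaterThanLessThan, of 0 T, folded cylinder_def]

lemma AE_Q:
  assumes "AE z in lebesgue_on Q. P z"
  shows "AE x in M. AE t in I. P (x, t)" "AE t in I. AE x in M. P (x, t)"
  using AE_lebesgue_on_prod[OF open_domain open_greaterThanLessThan assms[unfolded cylinder_def]] by auto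

lemma continuous_Q_bounded:
  assumes "continuous_on (closure Q) u"
  obtains B where "\<And>x t. x \<in> closure \<Omega> \<Longrightarrow> t \<in> {0..T} \<Longrightarrow> \<bar>u (x, t)\<bar> \<le> (B :: real)"
proof -
  have "compact (closure Q)" using bounded_cylinder by (simp add: compact_closure)
  then have "bounded (u ` closure Q)" using assms by (intro compact_imp_bounded compact_continuous_image)
  then obtain B where "\<And>z. z \<in> closure Q \<Longrightarrow> \<bar>u z\<bar> \<le> B" unfolding bounded_iff by auto
  then have "\<bar>u (x, t)\<bar> \<le> B" if "x \<in> closure \<Omega>" "t \<in> {0..T}" for x t
    using that by (simp add: closure_cylinder)
  then show thesis by (rule that)
qed

lemma continuous_Q_slice:
  assumes "continuous_on (closure Q) u" "t \<in> {0..T}"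
  shows "continuous_on \<Omega> (\<lambda>x. u (x, t))"
  by (rule continuous_on_compose2[OF assms(1)])
     (use assms(2) closure_subset[of \<Omega>] in \<open>auto simp: closure_cylinder intro!: continuous_intros\<close>)

lemma continuous_Q_slice_measurable:
  fixes u :: "'a \<times> real \<Rightarrow> real"
  assumes "continuous_on (closure Q) u" "t \<in> {0..T}"
  shows "(\<lambda>x. u (x, t)) \<in> borel_measurable M" "integrable M (\<lambda>x. u (x, t))"
proof -
  show m: "(\<lambda>x. u (x, t)) \<in> borel_measurable M"
    by (rule lebesgue_on_continuous_measurable[OF open_domain continuous_Q_slice[OF assms]])
  obtain B where "\<And>x t. x \<in> closure \<Omega> \<Longrightarrow> t \<in> {0..T} \<Longrightarrow> \<bar>u (x, t)\<bar> \<le> B"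
    using continuous_Q_bounded[OF assms(1)] by blast
  then have "AE x in M. norm (u (x, t)) \<le> B"
    using assms(2) closure_subset[of \<Omega>] by (intro AE_I2) auto
  then show "integrable M (\<lambda>x. u (x, t))"
    using finite_measure.integrable_const_bound[OF finite_M _ m] by blast
qed

lemma continuous_Q_measurable:
  fixes u :: "'a \<times> real \<Rightarrow> real"
  assumes "continuous_on (closure Q) u"
  shows "u \<in> borel_measurable (lebesgue_on Q)" "integrable (lebesgue_on Q) u" "in_L2 (lebesgue_on Q) u"
proof -
  show m: "u \<in> borel_measurable (lebesgue_on Q)"
    by (rule lebesgue_on_continuous_measurable[OF open_cylinder continuous_on_subset[OF assms closure_subset]])
  obtain B where B: "\<And>x t. x \<in> closure \<Omega> \<Longrightarrow> t \<in> {0..T} \<Longrightarrow> \<bar>u (x, t)\<bar> \<le> B"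
    using continuous_Q_bounded[OF assms(1)] by blast
  have bd: "AE z in lebesgue_on Q. norm (u z) \<le> B"
  proof (rule AE_I2)
    fix z assume "z \<in> space (lebesgue_on Q)"
    then have "z \<in> closure Q" using closure_subset[of Q] by auto
    then show "norm (u z) \<le> B" using B by (cases z) (auto simp: closure_cylinder)
  qed
  then show "in_L2 (lebesgue_on Q) u"
    by (rule in_L2_bounded[OF finite_Q m])
  then show "integrable (lebesgue_on Q) u" by (rule in_L2_integrable[OF finite_Q])
qed

lemma continuous_integral_slices:
  fixes u :: "'a \<times> real \<Rightarrow> real"
  assumes u: "continuous_on (closure Q) u"
  shows "continuous_on {0..T} (\<lambda>t. \<integral>x. u (x, t) \<partial>M)"
proof (rule continuous_on_sequentiallyI)
  fix s :: "nat \<Rightarrow> real" and t assume s: "\<forall>n. s n \<in> {0..T}" "t \<in> {0..T}" "s \<longlonglongrightarrow> t"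
  obtain B where B: "\<And>x t. x \<in> closure \<Omega> \<Longrightarrow> t \<in> {0..T} \<Longrightarrow> \<bar>u (x, t)\<bar> \<le> B"
    using continuous_Q_bounded[OF u] by blast
  have sub: "x \<in> closure \<Omega>" if "x \<in> \<Omega>" for x using that closure_subset[of \<Omega>] by auto
  show "(\<lambda>n. \<integral>x. u (x, s n) \<partial>M) \<longlonglongrightarrow> (\<integral>x. u (x, t) \<partial>M)"
  proof (rule integral_dominated_convergence[where w="\<lambda>x. B"])
    show "integrable M (\<lambda>x. B)" by (rule finite_measure.integrable_const[OF finite_M])
    show "(\<lambda>x. u (x, t)) \<in> borel_measurable M" "(\<lambda>x. u (x, s n)) \<in> borel_measurable M" for n
      using continuous_Q_slice_measurable[OF u] s by auto
    show "AE x in M. norm (u (x, s n)) \<le> B" for n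
      using B s sub by (intro AE_I2) auto
    show "AE x in M. (\<lambda>n. u (x, s n)) \<longlonglongrightarrow> u (x, t)"
    proof (rule AE_I2)
      fix x assume "x \<in> space M"
      then have "continuous_on {0..T} (\<lambda>t. u (x, t))"
        by (intro continuous_on_compose2[OF u]) (auto simp: closure_cylinder sub intro!: continuous_intros)
      then show "(\<lambda>n. u (x, s n)) \<longlonglongrightarrow> u (x, t)"
        using s unfolding continuous_on_sequentially by (auto simp: o_def)
    qed
  qed
qed

text \<open>The regularity of a solution on which the product rule in time rests: continuity gives a
  meaning to the slice at every time, and square integrability makes the weak derivative integrable
  on the cylinder.\<close>

definition time_regular :: "('a \<times> real \<Rightarrow> real) \<Rightarrow> ('a \<times> real \<Rightarrow> real) \<Rightarrow> bool" where
  "time_regular u ut \<longleftrightarrow> continuous_on (closure Q) u \<and> in_L2 (lebesgue_on Q) ut \<and> has_weak_time_deriv \<Omega> T u ut"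

lemma time_regular_integrable: "time_regular u ut \<Longrightarrow> integrable (lebesgue_on Q) ut"
  unfolding time_regular_def by (blast intro: in_L2_integrable[OF finite_Q])

text \<open>Testing with \<open>\<phi> x * \<theta> t\<close> turns the weak derivative on the
  cylinder into a weak derivative of a real function of \<open>t\<close>, the integral of
  \<open>u\<close> over space with weight \<open>\<phi>\<close>.\<close>

lemma weak_time_deriv_separated:
  assumes u: "time_regular u ut" and \<phi>: "\<phi> \<in> test_functions \<Omega>" and \<theta>: "\<theta> \<in> test_functions {0<..<T}"
  shows "(\<integral>t. deriv \<theta> t * (\<integral>x. \<phi> x * u (x, t) \<partial>M) \<partial>I) = - (\<integral>t. \<theta> t * (\<integral>x. \<phi> x * ut (x, t) \<partial>M) \<partial>I)"
proof -
  have cu: "continuous_on (closure Q) u" using u by (simp add: time_regular_def)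
  note iu = continuous_Q_measurable(2)[OF cu] and iut = time_regular_integrable[OF u]
  define F where "F z = (\<phi> (fst z) * deriv \<theta> (snd z)) *\<^sub>R u z" for z
  define G where "G z = (\<phi> (fst z) * \<theta> (snd z)) *\<^sub>R ut z" for z
  have t: "(\<lambda>z. \<phi> (fst z) * \<theta> (snd z)) \<in> test_functions Q" "(\<lambda>z. \<phi> (fst z) * deriv \<theta> (snd z)) \<in> test_functions Q"
    unfolding cylinder_def by (intro test_functions_product \<phi> \<theta> test_functions_deriv)+
  have F: "integrable (lebesgue_on Q) F" unfolding F_def
    by (rule test_functions_integrable_mult[OF open_cylinder t(2) iu])
  have G: "integrable (lebesgue_on Q) G" unfolding G_def
    by (rule test_functions_integrable_mult[OF open_cylinder t(1) iut])
  have d: "deriv (\<lambda>s. \<phi> x * \<theta> s) t = \<phi> x * deriv \<theta> t" for x t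
    by (intro DERIV_imp_deriv DERIV_cmult smooth_has_real_derivative(1) test_functions_smooth[OF \<theta>])
  have "(\<integral>(x, t). u (x, t) * deriv (\<lambda>s. \<phi> (fst (x, s)) * \<theta> (snd (x, s))) t \<partial>lebesgue_on Q)
      = - (\<integral>z. ut z * (\<phi> (fst z) * \<theta> (snd z)) \<partial>lebesgue_on Q)"
  proof -
    have "has_weak_time_deriv \<Omega> T u ut" using u by (simp add: time_regular_def)
    from bspec[OF this[unfolded has_weak_time_deriv_def, THEN conjunct2, THEN conjunct2] t(1)] show ?thesis .
  qed
  then have "(\<integral>z. F z \<partial>lebesgue_on Q) = - (\<integral>z. G z \<partial>lebesgue_on Q)"
    by (simp add: d F_def G_def case_prod_unfold mult.commute)
  then show ?thesis
    using Fubini_Q(3)[OF F] Fubini_Q(3)[OF G] by (simp add: F_def G_def mult.assoc mult.left_commute[of "\<phi> _"])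
qed

text \<open>For each \<open>\<phi>\<close> the integral of \<open>\<phi> x * u (x, t)\<close> over
  space satisfies \<open>du_bois_reymond\<close> as a function of \<open>t\<close>; after an
  exchange of integrals the fundamental lemma removes \<open>\<phi>\<close>. The null set may depend
  on \<open>\<sigma>\<close> and \<open>\<tau>\<close>.\<close>

lemma time_increment_AE:
  assumes u: "time_regular u ut" and st: "0 < \<sigma>" "\<sigma> < \<tau>" "\<tau> < T"
  shows "AE x in M. u (x, \<tau>) - u (x, \<sigma>) = (\<integral>t. ut (x, t) \<partial>lebesgue_on {\<sigma><..<\<tau>})"
    and "integrable M (\<lambda>x. \<integral>t. ut (x, t) \<partial>lebesgue_on {\<sigma><..<\<tau>})"
proof -
  let ?J = "lebesgue_on {\<sigma><..<\<tau>}"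
  have cu: "continuous_on (closure Q) u" using u by (simp add: time_regular_def)
  note iut = time_regular_integrable[OF u]
  have iut': "integrable (lebesgue_on (\<Omega> \<times> {\<sigma><..<\<tau>})) ut"
  proof (rule integrable_lebesgue_on_subset[OF iut])
    have "open (\<Omega> \<times> {\<sigma><..<\<tau>})" using open_domain by (intro open_Times) auto
    then show "\<Omega> \<times> {\<sigma><..<\<tau>} \<in> sets lebesgue" by auto
  qed (use st open_cylinder in \<open>auto simp: cylinder_def\<close>)
  note Fub = Fubini_lebesgue_on[OF open_domain open_greaterThanLessThan, of \<sigma> \<tau>]
  show int: "integrable M (\<lambda>x. \<integral>t. ut (x, t) \<partial>?J)" by (rule Fub(5)[OF iut'])
  have iu\<tau>: "integrable M (\<lambda>x. u (x, \<tau>))" and iu\<sigma>: "integrable M (\<lambda>x. u (x, \<sigma>))"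
    using continuous_Q_slice_measurable(2)[OF cu] st by auto
  have "AE x in M. u (x, \<tau>) - u (x, \<sigma>) - (\<integral>t. ut (x, t) \<partial>?J) = 0"
  proof (rule fundamental_lemma_real[OF open_domain])
    show "integrable M (\<lambda>x. u (x, \<tau>) - u (x, \<sigma>) - (\<integral>t. ut (x, t) \<partial>?J))"
      using int iu\<tau> iu\<sigma> by auto
    fix \<phi> :: "'a \<Rightarrow> real" assume \<phi>: "\<phi> \<in> test_functions \<Omega>"
    note m = test_functions_integrable_mult[OF open_domain \<phi>]
    obtain B where B: "\<And>x. \<bar>\<phi> x\<bar> \<le> B" using test_functions_grad_bounded[OF \<phi>] by metis
    have \<phi>m: "(\<lambda>z. \<phi> (fst z)) \<in> borel_measurable (lebesgue_on S)" if "open S" for S :: "('a \<times> real) set"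
      using smooth_compose_linear[OF test_functions_smooth[OF \<phi>] bounded_linear_fst]
      by (intro lebesgue_on_continuous_measurable that smooth_continuous_on)
    have iG: "integrable (lebesgue_on S) (\<lambda>z. ut z * \<phi> (fst z))" if "open S" "integrable (lebesgue_on S) ut" for S
      by (rule integrable_mult_bounded[OF that(2) \<phi>m[OF that(1)], where K=B]) (use B in auto)
    have c\<phi>u: "continuous_on (closure Q) (\<lambda>z. \<phi> (fst z) * u z)"
      using smooth_compose_linear[OF test_functions_smooth[OF \<phi>] bounded_linear_fst]
      by (intro continuous_intros cu smooth_continuous_on)
    have "(\<integral>x. \<phi> x * u (x, \<tau>) \<partial>M) - (\<integral>x. \<phi> x * u (x, \<sigma>) \<partial>M) = (\<integral>t. (\<integral>x. \<phi> x * ut (x, t) \<partial>M) \<partial>?J)"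
    proof (rule du_bois_reymond[of T "\<lambda>t. \<integral>x. \<phi> x * u (x, t) \<partial>M"])
      show "continuous_on {0..T} (\<lambda>t. \<integral>x. \<phi> x * u (x, t) \<partial>M)"
        using continuous_integral_slices[OF c\<phi>u] by simp
      show "integrable I (\<lambda>t. \<integral>x. \<phi> x * ut (x, t) \<partial>M)"
        using Fubini_Q(2)[OF iG[OF open_cylinder iut]] by (simp add: mult.commute)
    qed (use st weak_time_deriv_separated[OF u \<phi>] in auto)
    also have "\<dots> = (\<integral>x. (\<integral>t. ut (x, t) * \<phi> x \<partial>?J) \<partial>M)"
      using Fub(3)[OF iG[OF _ iut']] Fub(6)[OF iG[OF _ iut']] open_domain by (simp add: mult.commute open_Times)
    also have "\<dots> = (\<integral>x. \<phi> x * (\<integral>t. ut (x, t) \<partial>?J) \<partial>M)" by (simp add: mult.commute)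
    finally show "(\<integral>x. \<phi> x * (u (x, \<tau>) - u (x, \<sigma>) - (\<integral>t. ut (x, t) \<partial>?J)) \<partial>M) = 0"
      using m[OF int] m[OF iu\<tau>] m[OF iu\<sigma>] by (simp add: right_diff_distrib)
  qed
  then show "AE x in M. u (x, \<tau>) - u (x, \<sigma>) = (\<integral>t. ut (x, t) \<partial>?J)" by eventually_elim simp
qed

text \<open>The weight does not depend on time, so the increment formula can be multiplied by it and
  integrated. It will be a slice of another function, frozen at an endpoint of the interval.\<close>

lemma time_increment_weighted:
  assumes u: "time_regular u ut" and st: "0 < \<sigma>" "\<sigma> < \<tau>" "\<tau> < T"
    and f: "continuous_on \<Omega> f" "\<And>x. x \<in> \<Omega> \<Longrightarrow> \<bar>f x\<bar> \<le> B"
  shows "(\<integral>x. (u (x, \<tau>) - u (x, \<sigma>)) * f x \<partial>M) = (\<integral>z. ut z * f (fst z) \<partial>lebesgue_on (\<Omega> \<times> {\<sigma><..<\<tau>}))"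
    and "integrable (lebesgue_on (\<Omega> \<times> {\<sigma><..<\<tau>})) (\<lambda>z. ut z * f (fst z))"
proof -
  let ?J = "lebesgue_on {\<sigma><..<\<tau>}"
  have op: "open (\<Omega> \<times> {\<sigma><..<\<tau>})" using open_domain by (intro open_Times) auto
  have iut: "integrable (lebesgue_on (\<Omega> \<times> {\<sigma><..<\<tau>})) ut"
    by (rule integrable_lebesgue_on_subset[OF time_regular_integrable[OF u]])
       (use st op open_cylinder in \<open>auto simp: cylinder_def\<close>)
  show int: "integrable (lebesgue_on (\<Omega> \<times> {\<sigma><..<\<tau>})) (\<lambda>z. ut z * f (fst z))"
  proof (rule integrable_mult_bounded[OF iut, where K=B])
    show "(\<lambda>z. f (fst z)) \<in> borel_measurable (lebesgue_on (\<Omega> \<times> {\<sigma><..<\<tau>}))"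
      by (intro lebesgue_on_continuous_measurable op continuous_on_compose2[OF f(1)] continuous_intros) auto
  qed (use f in \<open>auto intro!: AE_I2\<close>)
  have "(\<integral>x. (u (x, \<tau>) - u (x, \<sigma>)) * f x \<partial>M) = (\<integral>x. (\<integral>t. ut (x, t) \<partial>?J) * f x \<partial>M)"
  proof (rule integral_cong_AE)
    have cu: "continuous_on (closure Q) u" using u by (simp add: time_regular_def)
    have [measurable]: "f \<in> borel_measurable M"
      by (rule lebesgue_on_continuous_measurable[OF open_domain f(1)])
    have [measurable]: "(\<lambda>x. u (x, \<tau>)) \<in> borel_measurable M" "(\<lambda>x. u (x, \<sigma>)) \<in> borel_measurable M"
      using continuous_Q_slice_measurable(1)[OF cu] st by auto
    have [measurable]: "(\<lambda>x. \<integral>t. ut (x, t) \<partial>?J) \<in> borel_measurable M"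
      using time_increment_AE(2)[OF u st] by auto
    show "(\<lambda>x. (u (x, \<tau>) - u (x, \<sigma>)) * f x) \<in> borel_measurable M"
      "(\<lambda>x. (\<integral>t. ut (x, t) \<partial>?J) * f x) \<in> borel_measurable M" by measurable
    show "AE x in M. (u (x, \<tau>) - u (x, \<sigma>)) * f x = (\<integral>t. ut (x, t) \<partial>?J) * f x"
      using time_increment_AE(1)[OF u st] by eventually_elim simp
  qed
  also have "\<dots> = (\<integral>z. ut z * f (fst z) \<partial>lebesgue_on (\<Omega> \<times> {\<sigma><..<\<tau>}))"
    using Fubini_lebesgue_on(6)[OF open_domain open_greaterThanLessThan int] by simp
  finally show "(\<integral>x. (u (x, \<tau>) - u (x, \<sigma>)) * f x \<partial>M) = (\<integral>z. ut z * f (fst z) \<partial>lebesgue_on (\<Omega> \<times> {\<sigma><..<\<tau>}))" .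
qed

section \<open>The product rule in time\<close>

lemma continuous_Q_time_modulus:
  fixes u :: "'a \<times> real \<Rightarrow> real"
  assumes "continuous_on (closure Q) u" "e > 0"
  obtains d where "d > 0" "\<And>x s t. x \<in> \<Omega> \<Longrightarrow> s \<in> {0..T} \<Longrightarrow> t \<in> {0..T} \<Longrightarrow> \<bar>s - t\<bar> < d \<Longrightarrow> \<bar>u (x, s) - u (x, t)\<bar> \<le> e"
proof -
  have "compact (closure Q)" using bounded_cylinder by (simp add: compact_closure)
  then have "uniformly_continuous_on (closure Q) u" using assms(1) by (rule compact_uniformly_continuous[rotated])
  then obtain d where d: "d > 0" "\<And>z z'. z \<in> closure Q \<Longrightarrow> z' \<in> closure Q \<Longrightarrow> dist z' z < d \<Longrightarrow> dist (u z') (u z) < e"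
    using \<open>e > 0\<close> unfolding uniformly_continuous_on_def by metis
  show thesis
  proof (rule that[OF d(1)])
    fix x s t assume "x \<in> \<Omega>" "s \<in> {0..T}" "t \<in> {0..T}" "\<bar>s - t\<bar> < d"
    then have "dist (u (x, s)) (u (x, t)) < e"
      using closure_subset[of \<Omega>] by (intro d(2)) (auto simp: closure_cylinder dist_Pair_Pair dist_real_def)
    then show "\<bar>u (x, s) - u (x, t)\<bar> \<le> e" by (simp add: dist_real_def)
  qed
qed

text \<open>On a short interval the product rule fails only by the oscillation of the continuous
  factors, so the error is dominated by a small multiple of an additive interval function.\<close>

lemma weak_product_rule:
  assumes u: "time_regular u ut" and v: "time_regular v vt" and \<tau>: "0 \<le> \<tau>" "\<tau> \<le> T"
  shows "integrable I (\<lambda>t. \<integral>x. ut (x, t) * v (x, t) + vt (x, t) * u (x, t) \<partial>M)"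
    and "(\<integral>x. u (x, \<tau>) * v (x, \<tau>) \<partial>M) - (\<integral>x. u (x, 0) * v (x, 0) \<partial>M)
      = integral {0..\<tau>} (\<lambda>t. \<integral>x. ut (x, t) * v (x, t) + vt (x, t) * u (x, t) \<partial>M)"
proof -
  define Y where "Y t = (\<integral>x. u (x, t) * v (x, t) \<partial>M)" for t
  define F where "F z = ut z * v z + vt z * u z" for z
  define D where "D t = (\<integral>x. F (x, t) \<partial>M)" for t
  define a where "a t = (\<integral>x. \<bar>ut (x, t)\<bar> + \<bar>vt (x, t)\<bar> \<partial>M)" for t
  have cu: "continuous_on (closure Q) u" and cv: "continuous_on (closure Q) v"
    using u v by (auto simp: time_regular_def)
  note iut = time_regular_integrable[OF u] and ivt = time_regular_integrable[OF v]
  obtain Bu where Bu: "\<And>x t. x \<in> closure \<Omega> \<Longrightarrow> t \<in> {0..T} \<Longrightarrow> \<bar>u (x, t)\<bar> \<le> Bu"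
    using continuous_Q_bounded[OF cu] by blast
  obtain Bv where Bv: "\<And>x t. x \<in> closure \<Omega> \<Longrightarrow> t \<in> {0..T} \<Longrightarrow> \<bar>v (x, t)\<bar> \<le> Bv"
    using continuous_Q_bounded[OF cv] by blast
  have sub: "x \<in> closure \<Omega>" if "x \<in> \<Omega>" for x using that closure_subset[of \<Omega>] by auto
  have F: "integrable (lebesgue_on Q) F"
    unfolding F_def
  proof (intro Bochner_Integration.integrable_add)
    show "integrable (lebesgue_on Q) (\<lambda>z. ut z * v z)"
      by (rule integrable_mult_bounded[OF iut continuous_Q_measurable(1)[OF cv], where K=Bv])
         (use Bv sub in \<open>auto intro!: AE_I2 simp: cylinder_def\<close>)
    show "integrable (lebesgue_on Q) (\<lambda>z. vt z * u z)"
      by (rule integrable_mult_bounded[OF ivt continuous_Q_measurable(1)[OF cu], where K=Bu])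
         (use Bu sub in \<open>auto intro!: AE_I2 simp: cylinder_def\<close>)
  qed
  have A: "integrable (lebesgue_on Q) (\<lambda>z. \<bar>ut z\<bar> + \<bar>vt z\<bar>)" using iut ivt by auto
  have iD: "integrable I D" unfolding D_def by (rule Fubini_Q(2)[OF F])
  have ia: "integrable I a" unfolding a_def by (rule Fubini_Q(2)[OF A])
  have D_on: "D integrable_on {0..T}" and a_on: "a integrable_on {0..T}"
    using lebesgue_on_Ioo_eq_integral(1)[OF iD] lebesgue_on_Ioo_eq_integral(1)[OF ia] by auto
  \<comment> \<open>\<open>P\<close> records the failure of the product rule up to time
    \<open>t\<close>; the aim is to show that it is constant.\<close>
  define P where "P t = Y t - integral {0..t} D" for t
  define A' where "A' t = integral {0..t} a" for t
  have split: "integral {0..t} h - integral {0..s} h = integral {s..t} h"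
    if "h integrable_on {0..T}" "0 \<le> s" "s \<le> t" "t \<le> T" for h :: "real \<Rightarrow> real" and s t
  proof -
    have "h integrable_on {0..t}" by (rule integrable_subinterval_real[OF that(1)]) (use that in auto)
    from Henstock_Kurzweil_Integration.integral_combine[OF that(2,3) this] show ?thesis by simp
  qed
  have const: "P t = P s" if "0 < s" "s \<le> t" "t < T" for s t
  proof (rule increments_dominated_imp_constant[where A=A', OF \<open>s \<le> t\<close>])
    fix e :: real assume "e > 0"
    obtain d1 where d1: "d1 > 0" "\<And>x s t. x \<in> \<Omega> \<Longrightarrow> s \<in> {0..T} \<Longrightarrow> t \<in> {0..T} \<Longrightarrow> \<bar>s - t\<bar> < d1 \<Longrightarrow> \<bar>u (x, s) - u (x, t)\<bar> \<le> e"
      using continuous_Q_time_modulus[OF cu \<open>e > 0\<close>] by blast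
    obtain d2 where d2: "d2 > 0" "\<And>x s t. x \<in> \<Omega> \<Longrightarrow> s \<in> {0..T} \<Longrightarrow> t \<in> {0..T} \<Longrightarrow> \<bar>s - t\<bar> < d2 \<Longrightarrow> \<bar>v (x, s) - v (x, t)\<bar> \<le> e"
      using continuous_Q_time_modulus[OF cv \<open>e > 0\<close>] by blast
    have main: "\<bar>P r - P q\<bar> \<le> e * (A' r - A' q)" if "s \<le> q" "q < r" "r \<le> t" "r - q < min d1 d2" for q r
    proof -
      have qr: "0 < q" "q < r" "r < T" using that \<open>0 < s\<close> \<open>t < T\<close> by auto
      let ?S = "\<Omega> \<times> {q<..<r}"
      let ?N = "lebesgue_on ?S"
      have "open ?S" using open_domain by (intro open_Times) auto
      then have S: "?S \<subseteq> Q" "Q \<in> sets lebesgue" "?S \<in> sets lebesgue"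
        using qr open_cylinder by (auto simp: cylinder_def)
      note Fub = Fubini_lebesgue_on[OF open_domain open_greaterThanLessThan, of q r]
      have IF: "integrable ?N F" by (rule integrable_lebesgue_on_subset[OF F S])
      have IA: "integrable ?N (\<lambda>z. \<bar>ut z\<bar> + \<bar>vt z\<bar>)" by (rule integrable_lebesgue_on_subset[OF A S])
      have intF: "(\<integral>z. F z \<partial>?N) = integral {q..r} D"
        using Fub(3)[OF IF] lebesgue_on_Ioo_eq_integral(2)[OF Fub(2)[OF IF]] by (simp add: D_def[abs_def])
      have intA: "(\<integral>z. \<bar>ut z\<bar> + \<bar>vt z\<bar> \<partial>?N) = integral {q..r} a"
        using Fub(3)[OF IA] lebesgue_on_Ioo_eq_integral(2)[OF Fub(2)[OF IA]] by (simp add: a_def[abs_def])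
      have r: "r \<in> {0..T}" and q: "q \<in> {0..T}" using qr by auto
      note wv = time_increment_weighted[OF v qr continuous_Q_slice[OF cu r], of Bu]
        and wu = time_increment_weighted[OF u qr continuous_Q_slice[OF cv q], of Bv]
      have wv': "(\<integral>x. (v (x, r) - v (x, q)) * u (x, r) \<partial>M) = (\<integral>z. vt z * u (fst z, r) \<partial>?N)"
        "integrable ?N (\<lambda>z. vt z * u (fst z, r))" using wv Bu sub r by auto
      have wu': "(\<integral>x. (u (x, r) - u (x, q)) * v (x, q) \<partial>M) = (\<integral>z. ut z * v (fst z, q) \<partial>?N)"
        "integrable ?N (\<lambda>z. ut z * v (fst z, q))" using wu Bv sub q by auto
      have ip: "integrable M (\<lambda>x. u (x, p) * v (x, p'))" if "p \<in> {0..T}" "p' \<in> {0..T}" for p p'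
        by (rule integrable_mult_bounded[OF continuous_Q_slice_measurable(2)[OF cu that(1)]
              continuous_Q_slice_measurable(1)[OF cv that(2)], where K=Bv])
           (use Bv sub that in \<open>auto intro!: AE_I2\<close>)
      \<comment> \<open>Discrete Leibniz rule: one factor is frozen at the right endpoint and the
        other at the left one, so that no product of two increments remains.\<close>
      have "Y r - Y q = (\<integral>x. (v (x, r) - v (x, q)) * u (x, r) \<partial>M) + (\<integral>x. (u (x, r) - u (x, q)) * v (x, q) \<partial>M)"
      proof -
        have "(\<integral>x. (v (x, r) - v (x, q)) * u (x, r) \<partial>M) = (\<integral>x. u (x, r) * v (x, r) - u (x, r) * v (x, q) \<partial>M)"
          by (rule Bochner_Integration.integral_cong) (auto simp: algebra_simps)
        moreover have "(\<integral>x. (u (x, r) - u (x, q)) * v (x, q) \<partial>M) = (\<integral>x. u (x, r) * v (x, q) - u (x, q) * v (x, q) \<partial>M)"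
          by (rule Bochner_Integration.integral_cong) (auto simp: algebra_simps)
        ultimately show ?thesis
          using ip[OF r r] ip[OF r q] ip[OF q q] by (simp add: Y_def)
      qed
      then have "P r - P q = (\<integral>z. vt z * u (fst z, r) \<partial>?N) + (\<integral>z. ut z * v (fst z, q) \<partial>?N) - (\<integral>z. F z \<partial>?N)"
        using split[OF D_on, of q r] qr by (simp add: P_def wv' wu' intF)
      also have "\<dots> = (\<integral>z. vt z * u (fst z, r) + ut z * v (fst z, q) - F z \<partial>?N)"
        using wv'(2) wu'(2) IF by simp
      finally have eq: "P r - P q = (\<integral>z. vt z * u (fst z, r) + ut z * v (fst z, q) - F z \<partial>?N)" .
      \<comment> \<open>Freezing a factor changes it by at most \<open>e\<close> on an interval
        shorter than \<open>min d1 d2\<close>, uniformly in \<open>x\<close>.\<close>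
      have "\<bar>\<integral>z. vt z * u (fst z, r) + ut z * v (fst z, q) - F z \<partial>?N\<bar> \<le> e * (\<integral>z. \<bar>ut z\<bar> + \<bar>vt z\<bar> \<partial>?N)"
      proof (rule uniform_bound_integral[OF _ IA])
        show "AE z in ?N. \<bar>vt z * u (fst z, r) + ut z * v (fst z, q) - F z\<bar> \<le> e * (\<bar>ut z\<bar> + \<bar>vt z\<bar>)"
        proof (rule AE_I2)
          fix z assume "z \<in> space ?N"
          then obtain x p where z: "z = (x, p)" "x \<in> \<Omega>" "q < p" "p < r" by auto
          have p: "p \<in> {0..T}" using z qr by auto
          have "\<bar>u (x, r) - u (x, p)\<bar> \<le> e" using d1(2)[OF z(2) r p] z that by auto
          moreover have "\<bar>v (x, q) - v (x, p)\<bar> \<le> e" using d2(2)[OF z(2) q p] z that by auto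
          ultimately have "\<bar>vt z * (u (x, r) - u z)\<bar> \<le> \<bar>vt z\<bar> * e" "\<bar>ut z * (v (x, q) - v z)\<bar> \<le> \<bar>ut z\<bar> * e"
            unfolding abs_mult z(1) by (auto intro: mult_left_mono)
          moreover have "vt z * u (fst z, r) + ut z * v (fst z, q) - F z = vt z * (u (x, r) - u z) + ut z * (v (x, q) - v z)"
            by (simp add: F_def z(1) algebra_simps)
          ultimately show "\<bar>vt z * u (fst z, r) + ut z * v (fst z, q) - F z\<bar> \<le> e * (\<bar>ut z\<bar> + \<bar>vt z\<bar>)"
            by (simp add: algebra_simps)
        qed
      qed (use wv'(2) wu'(2) IF in auto)
      then show ?thesis
        using eq split[OF a_on, of q r] qr by (simp add: A'_def intA)
    qed
    show "\<exists>d>0. \<forall>q r. s \<le> q \<longrightarrow> q \<le> r \<longrightarrow> r \<le> t \<longrightarrow> r - q < d \<longrightarrow> \<bar>P r - P q\<bar> \<le> e * (A' r - A' q)"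
    proof (intro exI[of _ "min d1 d2"] conjI allI impI)
      fix q r assume "s \<le> q" "q \<le> r" "r \<le> t" "r - q < min d1 d2"
      then show "\<bar>P r - P q\<bar> \<le> e * (A' r - A' q)" by (cases "q = r") (auto intro!: main)
    qed (use d1 d2 in auto)
  qed
  have "continuous_on {0..T} Y"
  proof -
    have "continuous_on (closure Q) (\<lambda>z. u z * v z)" by (intro continuous_intros cu cv)
    from continuous_integral_slices[OF this] show ?thesis by (simp add: Y_def[abs_def])
  qed
  then have cP: "continuous_on {0..T} P"
    unfolding P_def by (intro continuous_intros indefinite_integral_continuous_1 D_on)
  \<comment> \<open>The increment formula is available only strictly inside the time interval;
    continuity of \<open>P\<close> then reaches the endpoints.\<close>
  have mid: "P t = P (T / 2)" if "t \<in> {0<..<T}" for t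
  proof (cases "t \<le> T / 2")
    case True
    show ?thesis by (rule const[symmetric]) (use that True T_pos in auto)
  next
    case False
    show ?thesis by (rule const) (use that False T_pos in auto)
  qed
  have cl: "closure {0<..<T} = {0..T}" using T_pos by simp
  have all: "P t = P (T / 2)" if "t \<in> {0..T}" for t
    by (rule continuous_constant_on_closure[of "{0<..<T}"]) (use that in \<open>simp_all only: cl cP mid\<close>)
  have "P \<tau> = P (T / 2)" "P 0 = P (T / 2)" by (rule all; use \<tau> T_pos in auto)+
  then have "P \<tau> = P 0" by argo
  then show "(\<integral>x. u (x, \<tau>) * v (x, \<tau>) \<partial>M) - (\<integral>x. u (x, 0) * v (x, 0) \<partial>M)
      = integral {0..\<tau>} (\<lambda>t. \<integral>x. ut (x, t) * v (x, t) + vt (x, t) * u (x, t) \<partial>M)"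
    by (simp add: P_def Y_def D_def[abs_def] F_def)
  show "integrable I (\<lambda>t. \<integral>x. ut (x, t) * v (x, t) + vt (x, t) * u (x, t) \<partial>M)"
    using iD by (simp add: D_def[abs_def] F_def)
qed

end

section \<open>Coercivity\<close>

text \<open>Smooth bounded approximations \<open>(1 - exp (-\<epsilon> r\<^sup>2)) / \<epsilon>\<close> of \<open>r\<^sup>2\<close>, vanishing at \<open>0\<close>: composed
  with a test function they give nonnegative test functions.\<close>

definition soft_square :: "real \<Rightarrow> real \<Rightarrow> real" where
  "soft_square \<epsilon> r = (1 - exp (- (\<epsilon> * r\<^sup>2))) / \<epsilon>"

lemma soft_square_smooth: "smooth (soft_square \<epsilon>)"
proof -
  have id: "smooth (\<lambda>r::real. r)" by (rule smooth_bounded_linear) (rule bounded_linear_ident)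
  have "smooth (\<lambda>r. - (\<epsilon> * r\<^sup>2))"
    unfolding power2_eq_square by (intro smooth_uminus smooth_mult smooth_const id)
  from smooth_compose[OF this smooth_exp]
  have "smooth (\<lambda>r. (1 / \<epsilon>) * (1 - exp (- (\<epsilon> * r\<^sup>2))))" by (intro smooth_mult smooth_diff smooth_const)
  then show ?thesis by (simp add: soft_square_def[abs_def])
qed

lemma soft_square_deriv:
  "\<epsilon> > 0 \<Longrightarrow> (soft_square \<epsilon> has_real_derivative 2 * r * exp (- (\<epsilon> * r\<^sup>2))) (at r)"
  unfolding soft_square_def[abs_def] by (auto intro!: derivative_eq_intros)

text \<open>Two kinds of bounds for two limits. Those free of \<open>r\<close> serve while
  \<open>\<epsilon>\<close> is fixed and the approximating functions have no common bound; those
  free of \<open>\<epsilon>\<close> serve when \<open>\<epsilon>\<close> tends to \<open>0\<close>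
  at a bounded function.\<close>

lemma soft_square_bounds:
  assumes "\<epsilon> > 0"
  shows "0 \<le> soft_square \<epsilon> r" "soft_square \<epsilon> r \<le> 1 / \<epsilon>" "soft_square \<epsilon> r \<le> r\<^sup>2"
    and "\<bar>2 * r * exp (- (\<epsilon> * r\<^sup>2))\<bar> \<le> 1 / \<epsilon> + 1" "\<bar>2 * r * exp (- (\<epsilon> * r\<^sup>2))\<bar> \<le> 2 * \<bar>r\<bar>"
proof -
  have x: "0 \<le> \<epsilon> * r\<^sup>2" using assms by simp
  show "0 \<le> soft_square \<epsilon> r" "soft_square \<epsilon> r \<le> 1 / \<epsilon>"
    using assms x by (auto simp: soft_square_def divide_right_mono)
  have "1 - exp (- (\<epsilon> * r\<^sup>2)) \<le> \<epsilon> * r\<^sup>2"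
    using exp_ge_add_one_self[of "- (\<epsilon> * r\<^sup>2)"] by linarith
  then show "soft_square \<epsilon> r \<le> r\<^sup>2"
    using assms by (simp add: soft_square_def pos_divide_le_eq mult.commute)
  have E: "0 < exp (- (\<epsilon> * r\<^sup>2))" "exp (- (\<epsilon> * r\<^sup>2)) \<le> 1" using x by auto
  show "\<bar>2 * r * exp (- (\<epsilon> * r\<^sup>2))\<bar> \<le> 2 * \<bar>r\<bar>"
    using mult_left_mono[OF E(2), of "2 * \<bar>r\<bar>"] E(1) by (simp add: abs_mult)
  have "\<epsilon> * r\<^sup>2 \<le> exp (\<epsilon> * r\<^sup>2)" using exp_ge_add_one_self[of "\<epsilon> * r\<^sup>2"] by linarith
  then have 1: "\<epsilon> * r\<^sup>2 * exp (- (\<epsilon> * r\<^sup>2)) \<le> 1"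
    by (simp add: exp_minus field_simps)
  \<comment> \<open>This square yields \<open>2 * \<bar>r\<bar> \<le> 1 / \<epsilon> + \<epsilon> *
    r\<^sup>2\<close>; the exponential brings the second summand down to at most
    \<open>1\<close>.\<close>
  have "0 \<le> (1 - \<epsilon> * \<bar>r\<bar>)\<^sup>2" by simp
  then have "2 * \<epsilon> * \<bar>r\<bar> \<le> 1 + \<epsilon>\<^sup>2 * r\<^sup>2"
    by (simp add: power2_eq_square algebra_simps abs_mult_self_eq)
  then have "2 * \<bar>r\<bar> \<le> 1 / \<epsilon> + \<epsilon> * r\<^sup>2"
    using assms by (simp add: field_simps power2_eq_square)
  then have "2 * \<bar>r\<bar> * exp (- (\<epsilon> * r\<^sup>2)) \<le> (1 / \<epsilon> + \<epsilon> * r\<^sup>2) * exp (- (\<epsilon> * r\<^sup>2))"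
    using E by (intro mult_right_mono) auto
  also have "\<dots> = 1 / \<epsilon> * exp (- (\<epsilon> * r\<^sup>2)) + \<epsilon> * r\<^sup>2 * exp (- (\<epsilon> * r\<^sup>2))" by (simp add: distrib_right)
  also have "\<dots> \<le> 1 / \<epsilon> + 1"
    using 1 mult_left_mono[OF E(2), of "1 / \<epsilon>"] assms by simp
  finally show "\<bar>2 * r * exp (- (\<epsilon> * r\<^sup>2))\<bar> \<le> 1 / \<epsilon> + 1"
    using E(1) by (simp add: abs_mult)
qed

lemma soft_square_limit:
  assumes "\<And>k. \<epsilon> k > 0" "\<epsilon> \<longlonglongrightarrow> 0"
  shows "(\<lambda>k. soft_square (\<epsilon> k) r) \<longlonglongrightarrow> r\<^sup>2" "(\<lambda>k. 2 * r * exp (- (\<epsilon> k * r\<^sup>2))) \<longlonglongrightarrow> 2 * r"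
proof -
  \<comment> \<open>As a function of \<open>\<epsilon>\<close>, the value
    \<open>soft_square \<epsilon> r\<close> is a difference quotient of
    \<open>1 - exp (- (x * r\<^sup>2))\<close> at \<open>x = 0\<close>.\<close>
  have D: "((\<lambda>x. 1 - exp (- (x * r\<^sup>2))) has_real_derivative r\<^sup>2) (at 0)"
    by (auto intro!: derivative_eq_intros)
  then have "((\<lambda>x. (1 - exp (- (x * r\<^sup>2))) / x) \<longlongrightarrow> r\<^sup>2) (at 0)"
    by (simp add: has_field_derivative_iff)
  moreover have "filterlim \<epsilon> (at 0) sequentially"
    using assms by (auto simp: filterlim_at intro!: always_eventually) (metis less_irrefl)
  ultimately show "(\<lambda>k. soft_square (\<epsilon> k) r) \<longlonglongrightarrow> r\<^sup>2"
    unfolding soft_square_def by (rule filterlim_compose)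
  have "(\<lambda>k. 2 * r * exp (- (\<epsilon> k * r\<^sup>2))) \<longlonglongrightarrow> 2 * r * exp (- (0 * r\<^sup>2))"
    by (intro tendsto_intros assms)
  then show "(\<lambda>k. 2 * r * exp (- (\<epsilon> k * r\<^sup>2))) \<longlonglongrightarrow> 2 * r" by simp
qed

lemma grad_soft_square:
  fixes \<phi> :: "'a::euclidean_space \<Rightarrow> real"
  assumes "smooth \<phi>" "\<epsilon> > 0"
  shows "grad (\<lambda>x. soft_square \<epsilon> (\<phi> x)) x = (2 * \<phi> x * exp (- (\<epsilon> * (\<phi> x)\<^sup>2))) *\<^sub>R grad \<phi> x"
proof (rule grad_eqI)
  show "((\<lambda>x. soft_square \<epsilon> (\<phi> x)) has_derivative
      (\<lambda>d. ((2 * \<phi> x * exp (- (\<epsilon> * (\<phi> x)\<^sup>2))) *\<^sub>R grad \<phi> x) \<bullet> d)) (at x)"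
    using has_derivative_compose[OF has_derivative_grad[OF assms(1)]
        soft_square_deriv[OF assms(2), of "\<phi> x", unfolded has_field_derivative_def]]
    by simp
qed

section \<open>From test functions to the square of a time-dependent function\<close>

context cylinder_domain
begin

text \<open>With \<open>\<phi> x * \<theta> t\<close> as test function, Fubini's theorem leaves a
  function of \<open>t\<close> whose integral against every nonnegative \<open>\<theta>\<close> is
  nonnegative. The resulting null set of times depends on \<open>\<phi>\<close>.\<close>

lemma coercivity_test_function:
  fixes b :: "'a \<times> real \<Rightarrow> 'a" and c :: "'a \<times> real \<Rightarrow> real"
  assumes coer: "coercivity_condition \<Omega> T l b c"
    and b: "in_L2 (lebesgue_on Q) b" and c: "in_L2 (lebesgue_on Q) c"
    and \<phi>: "\<phi> \<in> test_functions \<Omega>" "\<And>x. 0 \<le> \<phi> x"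
  shows "AE t in I. 0 \<le> (\<integral>x. c (x, t) * \<phi> x + 1/2 * (b (x, t) \<bullet> grad \<phi> x) - l * \<phi> x \<partial>M)"
proof -
  have sm: "smooth \<phi>" using \<phi>(1) by (rule test_functions_smooth)
  obtain B where B: "\<And>x. \<bar>\<phi> x\<bar> \<le> B" "\<And>x. norm (grad \<phi> x) \<le> B"
    using test_functions_grad_bounded[OF \<phi>(1)] by metis
  have L2: "in_L2 (lebesgue_on Q) (\<lambda>z. \<phi> (fst z))" "in_L2 (lebesgue_on Q) (\<lambda>z. grad \<phi> (fst z))"
  proof -
    have "continuous_on Q (\<lambda>z. \<phi> (fst z))" "continuous_on Q (\<lambda>z. grad \<phi> (fst z))"
      by (intro continuous_on_compose2[OF smooth_continuous_on[OF sm, of UNIV]]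
          continuous_on_compose2[OF continuous_on_grad[OF sm, of UNIV]] continuous_intros; simp)+
    then show "in_L2 (lebesgue_on Q) (\<lambda>z. \<phi> (fst z))" "in_L2 (lebesgue_on Q) (\<lambda>z. grad \<phi> (fst z))"
      by (auto intro!: in_L2_bounded[OF finite_Q, where K=B] lebesgue_on_continuous_measurable open_cylinder B)
  qed
  define H where "H z = c z * \<phi> (fst z) + 1/2 * (b z \<bullet> grad \<phi> (fst z)) - l * \<phi> (fst z)" for z
  have H: "integrable (lebesgue_on Q) H"
    unfolding H_def
    using in_L2_mult_integrable(1)[OF c L2(1)] in_L2_mult_integrable(1)[OF b L2(2)] in_L2_integrable[OF finite_Q L2(1)]
    by simp
  have "AE t in lebesgue_on {0<..<T}. 0 \<le> (\<integral>x. H (x, t) \<partial>M)"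
  proof (rule fundamental_lemma_nonneg)
    show "integrable I (\<lambda>t. \<integral>x. H (x, t) \<partial>M)" by (rule Fubini_Q(2)[OF H])
    fix \<theta> :: "real \<Rightarrow> real" assume \<theta>: "\<theta> \<in> test_functions {0<..<T}" "\<And>t. 0 \<le> \<theta> t"
    obtain K where K: "\<And>x. \<bar>\<theta> x\<bar> \<le> K" using test_functions_grad_bounded[OF \<theta>(1)] by metis
    have \<theta>L2: "in_L2 (lebesgue_on Q) (\<lambda>z. \<phi> (fst z) * \<theta> (snd z))" and \<theta>m: "(\<lambda>z. \<theta> (snd z)) \<in> borel_measurable (lebesgue_on Q)"
    proof -
      have t: "(\<lambda>z. \<phi> (fst z) * \<theta> (snd z)) \<in> test_functions Q"
        unfolding cylinder_def by (rule test_functions_product[OF \<phi>(1) \<theta>(1)])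
      show "in_L2 (lebesgue_on Q) (\<lambda>z. \<phi> (fst z) * \<theta> (snd z))"
        by (rule test_functions_in_L2(1)[OF open_cylinder bounded_cylinder t])
      have "continuous_on Q (\<lambda>z. \<theta> (snd z))"
        by (intro continuous_on_compose2[OF smooth_continuous_on[OF test_functions_smooth[OF \<theta>(1)], of UNIV]] continuous_intros) simp
      then show "(\<lambda>z. \<theta> (snd z)) \<in> borel_measurable (lebesgue_on Q)"
        by (rule lebesgue_on_continuous_measurable[OF open_cylinder])
    qed
    have t: "(\<lambda>z. \<phi> (fst z) * \<theta> (snd z)) \<in> test_functions Q"
      unfolding cylinder_def by (rule test_functions_product[OF \<phi>(1) \<theta>(1)])
    have H\<theta>: "integrable (lebesgue_on Q) (\<lambda>z. H z * \<theta> (snd z))"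
      by (rule integrable_mult_bounded[OF H \<theta>m, where K=K]) (use K in auto)
    have g: "grad (\<lambda>y. \<phi> y * \<theta> s) x = \<theta> s *\<^sub>R grad \<phi> x" for x s
      using grad_cmult[OF sm, of "\<theta> s" x] by (simp add: mult.commute)
    have "l * (\<integral>z. \<phi> (fst z) * \<theta> (snd z) \<partial>lebesgue_on Q)
        \<le> (\<integral>(x, t). c (x, t) * (\<phi> (fst (x, t)) * \<theta> (snd (x, t))) + 1/2 * (b (x, t) \<bullet> grad (\<lambda>y. \<phi> (fst (y, t)) * \<theta> (snd (y, t))) x) \<partial>lebesgue_on Q)"
    proof -
      have "\<forall>z. 0 \<le> \<phi> (fst z) * \<theta> (snd z)" using \<phi>(2) \<theta>(2) by simp
      from mp[OF bspec[OF coer[unfolded coercivity_condition_def] t] this] show ?thesis .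
    qed
    also have "\<dots> = (\<integral>z. H z * \<theta> (snd z) + l * (\<phi> (fst z) * \<theta> (snd z)) \<partial>lebesgue_on Q)"
      by (rule Bochner_Integration.integral_cong) (auto simp: g H_def algebra_simps case_prod_unfold)
    also have "\<dots> = (\<integral>z. H z * \<theta> (snd z) \<partial>lebesgue_on Q) + l * (\<integral>z. \<phi> (fst z) * \<theta> (snd z) \<partial>lebesgue_on Q)"
      using H\<theta> in_L2_integrable[OF finite_Q \<theta>L2] by simp
    finally have "0 \<le> (\<integral>z. H z * \<theta> (snd z) \<partial>lebesgue_on Q)" by simp
    also have "\<dots> = (\<integral>t. \<theta> t * (\<integral>x. H (x, t) \<partial>M) \<partial>I)"
      using Fubini_Q(3)[OF H\<theta>] by (simp add: mult.commute)
    finally show "0 \<le> (\<integral>t. \<theta> t * (\<integral>x. H (x, t) \<partial>M) \<partial>I)" .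
  qed simp
  then show ?thesis by (simp add: H_def)
qed

text \<open>The inequality is given along \<open>soft_square (1 / Suc k) (\<phi> n x)\<close>.
  Letting \<open>n\<close> tend to infinity replaces \<open>\<phi> n\<close> by \<open>w\<close>:
  the values converge almost everywhere along a subsequence, the gradients in L2. Letting
  \<open>k\<close> tend to infinity then removes the regularisation, with majorants from the bound
  on \<open>w\<close>. The factor \<open>1/2\<close> cancels against the \<open>2\<close> in the
  derivative of the square.\<close>

lemma coercivity_closure:
  fixes b0 :: "'a \<Rightarrow> 'a" and c0 w :: "'a \<Rightarrow> real"
  assumes b: "in_L2 M b0" and c: "in_L2 M c0"
    and H: "H10_approximation \<Omega> w D \<phi>" and w: "AE x in M. \<bar>w x\<bar> \<le> B"
    and coer: "\<And>k n. 0 \<le> (\<integral>x. c0 x * soft_square (1 / Suc k) (\<phi> n x)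
        + 1/2 * (b0 x \<bullet> grad (\<lambda>x. soft_square (1 / Suc k) (\<phi> n x)) x) - l * soft_square (1 / Suc k) (\<phi> n x) \<partial>M)"
  shows "l * (\<integral>x. (w x)\<^sup>2 \<partial>M) \<le> (\<integral>x. c0 x * (w x)\<^sup>2 \<partial>M) + (\<integral>x. w x * (b0 x \<bullet> D x) \<partial>M)"
proof -
  have wL2: "in_L2 M w" and DL2: "in_L2 M D" and test: "\<phi> n \<in> test_functions \<Omega>" for n
    using H by (auto simp: H10_approximation_def)
  note tL2 = test_functions_in_L2[OF open_domain bounded_domain test]
  have one: "in_L2 M (\<lambda>x. 1::real)" by (rule in_L2_bounded[OF finite_M, where K=1]) auto
  have i1: "integrable M (\<lambda>x. 1::real)" by (rule finite_measure.integrable_const[OF finite_M])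
  have ic: "integrable M c0" by (rule in_L2_integrable[OF finite_M c])
  have ibD: "integrable M (\<lambda>x. b0 x \<bullet> D x)" by (rule in_L2_mult_integrable(1)[OF b DL2])
  have [measurable]: "w \<in> borel_measurable M" "D \<in> borel_measurable M" "b0 \<in> borel_measurable M" "c0 \<in> borel_measurable M"
    using wL2 DL2 b c by (auto simp: in_L2_def)
  have [measurable]: "\<phi> n \<in> borel_measurable M" "grad (\<phi> n) \<in> borel_measurable M" for n
    using test_functions_measurable[OF open_domain test] by auto
  have nbL2: "in_L2 M (\<lambda>x. norm (b0 x))" using b by (simp add: in_L2_def)
  have lim1: "(\<lambda>n. \<integral>x. norm (\<phi> n x - w x) \<partial>M) \<longlonglongrightarrow> 0"
    using L2_null_sequence[OF one in_L2_diff[OF tL2(1) wL2]] H by (simp add: H10_approximation_def)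
  have lim2: "(\<lambda>n. \<integral>x. norm (b0 x) * norm (grad (\<phi> n) x - D x) \<partial>M) \<longlonglongrightarrow> 0"
    using L2_null_sequence[OF nbL2 in_L2_diff[OF tL2(2) DL2]] H by (simp add: H10_approximation_def)
  \<comment> \<open>Convergence in L1 yields pointwise convergence almost everywhere only along a
    subsequence.\<close>
  obtain r where r: "strict_mono r" "AE x in M. (\<lambda>n. \<phi> (r n) x - w x) \<longlonglongrightarrow> 0"
    using tendsto_L1_AE_subseq[OF in_L2_integrable[OF finite_M in_L2_diff[OF tL2(1) wL2]] lim1] by blast
  have aew: "AE x in M. (\<lambda>n. \<phi> (r n) x) \<longlonglongrightarrow> w x"
    using r(2) by eventually_elim (rule Lim_null[THEN iffD2])
  have eps: "l * (\<integral>x. soft_square \<epsilon> (w x) \<partial>M) \<le> (\<integral>x. soft_square \<epsilon> (w x) * c0 x \<partial>M)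
      + 1/2 * (\<integral>x. (2 * w x * exp (- (\<epsilon> * (w x)\<^sup>2))) * (b0 x \<bullet> D x) \<partial>M)"
    if \<epsilon>: "\<epsilon> > 0" and pos: "\<And>n. 0 \<le> (\<integral>x. c0 x * soft_square \<epsilon> (\<phi> n x)
        + 1/2 * (b0 x \<bullet> grad (\<lambda>x. soft_square \<epsilon> (\<phi> n x)) x) - l * soft_square \<epsilon> (\<phi> n x) \<partial>M)" for \<epsilon>
  proof -
    define g where "g = soft_square \<epsilon>"
    define g' where "g' r = 2 * r * exp (- (\<epsilon> * r\<^sup>2))" for r
    have cg: "continuous_on UNIV g" unfolding g_def by (intro smooth_continuous_on soft_square_smooth)
    have cg': "continuous_on UNIV g'" unfolding g'_def by (intro continuous_intros)
    have [measurable]: "g \<in> borel_measurable borel" "g' \<in> borel_measurable borel"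
      using cg cg' by (auto intro: borel_measurable_continuous_onI)
    have gb: "\<bar>g x\<bar> \<le> 1 / \<epsilon>" "\<bar>g' x\<bar> \<le> 1 / \<epsilon> + 1" for x
      using soft_square_bounds[OF \<epsilon>] by (auto simp: g_def g'_def)
    have aeg: "AE x in M. (\<lambda>n. g (\<phi> (r n) x)) \<longlonglongrightarrow> g (w x)"
      using aew by eventually_elim (rule continuous_on_tendsto_compose[OF cg], auto)
    have aeg': "AE x in M. (\<lambda>n. g' (\<phi> (r n) x)) \<longlonglongrightarrow> g' (w x)"
      using aew by eventually_elim (rule continuous_on_tendsto_compose[OF cg'], auto)
    have L1: "(\<lambda>n. \<integral>x. g (\<phi> (r n) x) *\<^sub>R c0 x \<partial>M) \<longlonglongrightarrow> (\<integral>x. g (w x) *\<^sub>R c0 x \<partial>M)"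
      by (rule integral_bounded_convergence[OF ic _ _ _ aeg, where K="1 / \<epsilon>"]) (use gb in auto)
    have L2: "(\<lambda>n. \<integral>x. g (\<phi> (r n) x) *\<^sub>R (1::real) \<partial>M) \<longlonglongrightarrow> (\<integral>x. g (w x) *\<^sub>R (1::real) \<partial>M)"
      by (rule integral_bounded_convergence[OF i1 _ _ _ aeg, where K="1 / \<epsilon>"]) (use gb in auto)
    have L3: "(\<lambda>n. \<integral>x. g' (\<phi> (r n) x) *\<^sub>R (b0 x \<bullet> D x) \<partial>M) \<longlonglongrightarrow> (\<integral>x. g' (w x) *\<^sub>R (b0 x \<bullet> D x) \<partial>M)"
      by (rule integral_bounded_convergence[OF ibD _ _ _ aeg', where K="1 / \<epsilon> + 1"]) (use gb in auto)
    \<comment> \<open>The gradient is split as \<open>D x\<close> plus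
      \<open>grad (\<phi> n) x - D x\<close>. The first part pairs a fixed integrable function with
      a bounded factor; the second is small in the mean because \<open>b0\<close> is square
      integrable.\<close>
    have iL4: "integrable M (\<lambda>x. norm (b0 x) * norm (grad (\<phi> n) x - D x))" for n
      by (rule in_L2_mult_integrable(2)[OF b in_L2_diff[OF tL2(2) DL2]])
    have bd4: "\<bar>g' (\<phi> n x) * (b0 x \<bullet> (grad (\<phi> n) x - D x))\<bar> \<le> (1 / \<epsilon> + 1) * (norm (b0 x) * norm (grad (\<phi> n) x - D x))" for n x
      unfolding abs_mult using gb(2)[of "\<phi> n x"] Cauchy_Schwarz_ineq2[of "b0 x" "grad (\<phi> n) x - D x"]
      by (intro mult_mono) auto
    have i4: "integrable M (\<lambda>x. g' (\<phi> n x) * (b0 x \<bullet> (grad (\<phi> n) x - D x)))" for n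
    proof (rule Bochner_Integration.integrable_bound)
      show "integrable M (\<lambda>x. (1 / \<epsilon> + 1) * (norm (b0 x) * norm (grad (\<phi> n) x - D x)))" using iL4 by simp
      show "AE x in M. norm (g' (\<phi> n x) * (b0 x \<bullet> (grad (\<phi> n) x - D x)))
          \<le> norm ((1 / \<epsilon> + 1) * (norm (b0 x) * norm (grad (\<phi> n) x - D x)))"
        by (intro AE_I2) (metis bd4 abs_ge_self order_trans real_norm_def)
    qed measurable
    have L4: "(\<lambda>n. \<integral>x. g' (\<phi> (r n) x) * (b0 x \<bullet> (grad (\<phi> (r n)) x - D x)) \<partial>M) \<longlonglongrightarrow> 0"
    proof (rule Lim_null_comparison)
      show "\<forall>\<^sub>F n in sequentially. norm (\<integral>x. g' (\<phi> (r n) x) * (b0 x \<bullet> (grad (\<phi> (r n)) x - D x)) \<partial>M)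
          \<le> (1 / \<epsilon> + 1) * (\<integral>x. norm (b0 x) * norm (grad (\<phi> (r n)) x - D x) \<partial>M)"
        using uniform_bound_integral[OF i4 iL4] bd4 by (intro always_eventually allI) simp
      have "(\<lambda>n. (1 / \<epsilon> + 1) * (\<integral>x. norm (b0 x) * norm (grad (\<phi> (r n)) x - D x) \<partial>M)) \<longlonglongrightarrow> (1 / \<epsilon> + 1) * 0"
        using LIMSEQ_subseq_LIMSEQ[OF lim2 r(1)] by (intro tendsto_intros) (simp add: o_def)
      then show "(\<lambda>n. (1 / \<epsilon> + 1) * (\<integral>x. norm (b0 x) * norm (grad (\<phi> (r n)) x - D x) \<partial>M)) \<longlonglongrightarrow> 0" by simp
    qed
    have ineq: "l * (\<integral>x. g (\<phi> n x) *\<^sub>R (1::real) \<partial>M) \<le> (\<integral>x. g (\<phi> n x) *\<^sub>R c0 x \<partial>M)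
        + 1/2 * ((\<integral>x. g' (\<phi> n x) *\<^sub>R (b0 x \<bullet> D x) \<partial>M) + (\<integral>x. g' (\<phi> n x) * (b0 x \<bullet> (grad (\<phi> n) x - D x)) \<partial>M))" for n
    proof -
      have j1: "integrable M (\<lambda>x. c0 x * g (\<phi> n x))" and j2: "integrable M (\<lambda>x. 1 * g (\<phi> n x))"
        and j3: "integrable M (\<lambda>x. (b0 x \<bullet> D x) * g' (\<phi> n x))"
        by (rule integrable_mult_bounded[OF ic, where K="1 / \<epsilon>"] integrable_mult_bounded[OF i1, where K="1 / \<epsilon>"]
            integrable_mult_bounded[OF ibD, where K="1 / \<epsilon> + 1"]; use gb in auto)+
      have "0 \<le> (\<integral>x. c0 x * g (\<phi> n x) + 1/2 * (b0 x \<bullet> grad (\<lambda>x. g (\<phi> n x)) x) - l * g (\<phi> n x) \<partial>M)"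
        using pos[of n] by (simp add: g_def)
      also have "\<dots> = (\<integral>x. c0 x * g (\<phi> n x) + 1/2 * ((b0 x \<bullet> D x) * g' (\<phi> n x) + g' (\<phi> n x) * (b0 x \<bullet> (grad (\<phi> n) x - D x)))
          - l * (1 * g (\<phi> n x)) \<partial>M)"
        unfolding g_def grad_soft_square[OF test_functions_smooth[OF test] \<epsilon>] g'_def
        by (rule Bochner_Integration.integral_cong) (auto simp: inner_diff_right algebra_simps)
      also have "\<dots> = (\<integral>x. c0 x * g (\<phi> n x) \<partial>M) + 1/2 * ((\<integral>x. (b0 x \<bullet> D x) * g' (\<phi> n x) \<partial>M)
          + (\<integral>x. g' (\<phi> n x) * (b0 x \<bullet> (grad (\<phi> n) x - D x)) \<partial>M)) - l * (\<integral>x. 1 * g (\<phi> n x) \<partial>M)"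
        using j1 j2 j3 i4[of n] by simp
      finally show ?thesis by (simp add: mult.commute)
    qed
    have "l * (\<integral>x. g (w x) *\<^sub>R (1::real) \<partial>M) \<le> (\<integral>x. g (w x) *\<^sub>R c0 x \<partial>M)
        + 1/2 * ((\<integral>x. g' (w x) *\<^sub>R (b0 x \<bullet> D x) \<partial>M) + 0)"
    proof (rule LIMSEQ_le)
      show "(\<lambda>n. l * (\<integral>x. g (\<phi> (r n) x) *\<^sub>R (1::real) \<partial>M)) \<longlonglongrightarrow> l * (\<integral>x. g (w x) *\<^sub>R (1::real) \<partial>M)"
        by (intro tendsto_intros L2)
      show "(\<lambda>n. (\<integral>x. g (\<phi> (r n) x) *\<^sub>R c0 x \<partial>M) + 1/2 * ((\<integral>x. g' (\<phi> (r n) x) *\<^sub>R (b0 x \<bullet> D x) \<partial>M)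
            + (\<integral>x. g' (\<phi> (r n) x) * (b0 x \<bullet> (grad (\<phi> (r n)) x - D x)) \<partial>M)))
          \<longlonglongrightarrow> (\<integral>x. g (w x) *\<^sub>R c0 x \<partial>M) + 1/2 * ((\<integral>x. g' (w x) *\<^sub>R (b0 x \<bullet> D x) \<partial>M) + 0)"
        by (intro tendsto_intros L1 L3 L4)
    qed (use ineq in blast)
    then show ?thesis by (simp add: g_def g'_def)
  qed
  \<comment> \<open>Only the parameters \<open>1 / Suc k\<close> are available: a countable family
    is what allows a common null set of times.\<close>
  define \<epsilon> :: "nat \<Rightarrow> real" where "\<epsilon> k = 1 / Suc k" for k
  have \<epsilon>: "\<epsilon> k > 0" "\<epsilon> \<longlonglongrightarrow> 0" for k
    using LIMSEQ_inverse_real_of_nat by (auto simp: \<epsilon>_def[abs_def] inverse_eq_divide)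
  have bdw: "AE x in M. \<bar>soft_square (\<epsilon> k) (w x)\<bar> \<le> B\<^sup>2" for k
    using w
  proof eventually_elim
    case (elim x)
    have "(w x)\<^sup>2 \<le> B\<^sup>2" using elim by (simp add: abs_le_square_iff[symmetric])
    then show ?case using soft_square_bounds(1,3)[OF \<epsilon>(1)[of k], of "w x"] by simp
  qed
  have bdw': "AE x in M. \<bar>2 * w x * exp (- (\<epsilon> k * (w x)\<^sup>2))\<bar> \<le> 2 * B" for k
    using w by eventually_elim (use soft_square_bounds(5)[OF \<epsilon>(1)[of k]] in \<open>smt (verit)\<close>)
  have ms: "(\<lambda>x. soft_square (\<epsilon> k) (w x)) \<in> borel_measurable M" for k
    unfolding soft_square_def by measurable
  have A1: "(\<lambda>k. \<integral>x. soft_square (\<epsilon> k) (w x) *\<^sub>R c0 x \<partial>M) \<longlonglongrightarrow> (\<integral>x. (w x)\<^sup>2 *\<^sub>R c0 x \<partial>M)"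
    by (rule integral_bounded_convergence[OF ic ms _ bdw]) (auto intro!: AE_I2 soft_square_limit(1) \<epsilon>)
  have A2: "(\<lambda>k. \<integral>x. soft_square (\<epsilon> k) (w x) *\<^sub>R (1::real) \<partial>M) \<longlonglongrightarrow> (\<integral>x. (w x)\<^sup>2 *\<^sub>R (1::real) \<partial>M)"
    by (rule integral_bounded_convergence[OF i1 ms _ bdw]) (auto intro!: AE_I2 soft_square_limit(1) \<epsilon>)
  have A3: "(\<lambda>k. \<integral>x. (2 * w x * exp (- (\<epsilon> k * (w x)\<^sup>2))) *\<^sub>R (b0 x \<bullet> D x) \<partial>M) \<longlonglongrightarrow> (\<integral>x. (2 * w x) *\<^sub>R (b0 x \<bullet> D x) \<partial>M)"
    by (rule integral_bounded_convergence[OF ibD _ _ bdw']) (auto intro!: AE_I2 soft_square_limit(2) \<epsilon>)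
  have "l * (\<integral>x. (w x)\<^sup>2 *\<^sub>R (1::real) \<partial>M) \<le> (\<integral>x. (w x)\<^sup>2 *\<^sub>R c0 x \<partial>M) + 1/2 * (\<integral>x. (2 * w x) *\<^sub>R (b0 x \<bullet> D x) \<partial>M)"
  proof (rule LIMSEQ_le)
    show "(\<lambda>k. l * (\<integral>x. soft_square (\<epsilon> k) (w x) *\<^sub>R (1::real) \<partial>M)) \<longlonglongrightarrow> l * (\<integral>x. (w x)\<^sup>2 *\<^sub>R (1::real) \<partial>M)"
      by (intro tendsto_intros A2)
    show "(\<lambda>k. (\<integral>x. soft_square (\<epsilon> k) (w x) *\<^sub>R c0 x \<partial>M)
        + 1/2 * (\<integral>x. (2 * w x * exp (- (\<epsilon> k * (w x)\<^sup>2))) *\<^sub>R (b0 x \<bullet> D x) \<partial>M))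
      \<longlonglongrightarrow> (\<integral>x. (w x)\<^sup>2 *\<^sub>R c0 x \<partial>M) + 1/2 * (\<integral>x. (2 * w x) *\<^sub>R (b0 x \<bullet> D x) \<partial>M)"
      by (intro tendsto_intros A1 A3)
    show "\<exists>N. \<forall>k\<ge>N. l * (\<integral>x. soft_square (\<epsilon> k) (w x) *\<^sub>R (1::real) \<partial>M) \<le> (\<integral>x. soft_square (\<epsilon> k) (w x) *\<^sub>R c0 x \<partial>M)
        + 1/2 * (\<integral>x. (2 * w x * exp (- (\<epsilon> k * (w x)\<^sup>2))) *\<^sub>R (b0 x \<bullet> D x) \<partial>M)"
      using eps[OF \<epsilon>(1)] coer by (auto simp: \<epsilon>_def)
  qed
  moreover have "(\<integral>x. (2 * w x) *\<^sub>R (b0 x \<bullet> D x) \<partial>M) = 2 * (\<integral>x. w x * (b0 x \<bullet> D x) \<partial>M)"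
    by (simp add: mult.assoc)
  ultimately show ?thesis by (simp add: mult.commute)
qed

text \<open>For fixed \<open>w\<close> the test functions involved are indexed by two natural
  numbers, so their exceptional sets of times unite to one null set.\<close>

lemma coercivity_H10:
  fixes b :: "'a \<times> real \<Rightarrow> 'a" and c :: "'a \<times> real \<Rightarrow> real"
  assumes coer: "coercivity_condition \<Omega> T l b c"
    and b: "in_L2 (lebesgue_on Q) b" and c: "in_L2 (lebesgue_on Q) c"
    and H: "H10_approximation \<Omega> w D \<phi>" and w: "AE x in M. \<bar>w x\<bar> \<le> B"
  shows "AE t in I. l * (\<integral>x. (w x)\<^sup>2 \<partial>M) \<le> (\<integral>x. c (x, t) * (w x)\<^sup>2 \<partial>M) + (\<integral>x. w x * (b (x, t) \<bullet> D x) \<partial>M)"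
proof -
  have test: "\<phi> n \<in> test_functions \<Omega>" for n using H by (auto simp: H10_approximation_def)
  have "AE t in I. 0 \<le> (\<integral>x. c (x, t) * soft_square (1 / Suc k) (\<phi> n x)
        + 1/2 * (b (x, t) \<bullet> grad (\<lambda>x. soft_square (1 / Suc k) (\<phi> n x)) x) - l * soft_square (1 / Suc k) (\<phi> n x) \<partial>M)" for k n
  proof (rule coercivity_test_function[OF coer b c])
    show "(\<lambda>x. soft_square (1 / Suc k) (\<phi> n x)) \<in> test_functions \<Omega>"
      by (rule test_functions_compose[OF test soft_square_smooth]) (simp add: soft_square_def)
    show "0 \<le> soft_square (1 / Suc k) (\<phi> n x)" for x by (rule soft_square_bounds(1)) simp
  qed
  then have "AE t in I. \<forall>k n. 0 \<le> (\<integral>x. c (x, t) * soft_square (1 / Suc k) (\<phi> n x)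
        + 1/2 * (b (x, t) \<bullet> grad (\<lambda>x. soft_square (1 / Suc k) (\<phi> n x)) x) - l * soft_square (1 / Suc k) (\<phi> n x) \<partial>M)"
    unfolding AE_all_countable by blast
  moreover have "AE t in I. in_L2 M (\<lambda>x. b (x, t))" "AE t in I. in_L2 M (\<lambda>x. c (x, t))"
    using in_L2_slice[OF open_domain _ bounded_domain, of "{0<..<T}"] b c by (auto simp: cylinder_def)
  ultimately show ?thesis
  proof eventually_elim
    case (elim t)
    show ?case by (rule coercivity_closure[OF elim(2,3) H w]) (use elim(1) in blast)
  qed
qed

text \<open>The exceptional set of times in the previous lemma depends on \<open>w\<close>. A countable family of
  times \<open>s\<close> and the weak continuity of the gradient in time allow \<open>w\<close> to depend on \<open>t\<close>.\<close>

lemma coercivity_time_dependent: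
  fixes b :: "'a \<times> real \<Rightarrow> 'a" and c :: "'a \<times> real \<Rightarrow> real" and D :: "'a \<times> real \<Rightarrow> 'a"
  assumes coer: "coercivity_condition \<Omega> T l b c"
    and b: "in_L2 (lebesgue_on Q) b" and c: "in_L2 (lebesgue_on Q) c"
    and w: "continuous_on (closure Q) w"
    and good: "AE t in I. (\<exists>\<phi>. H10_approximation \<Omega> (\<lambda>x. w (x, t)) (\<lambda>x. D (x, t)) \<phi>) \<and>
       has_weak_gradient \<Omega> (\<lambda>x. w (x, t)) (\<lambda>x. D (x, t)) \<and> (AE x in M. norm (D (x, t)) \<le> R)"
  shows "AE t in I. l * (\<integral>x. (w (x, t))\<^sup>2 \<partial>M)
    \<le> (\<integral>x. c (x, t) * (w (x, t))\<^sup>2 \<partial>M) + (\<integral>x. w (x, t) * (b (x, t) \<bullet> D (x, t)) \<partial>M)"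
proof -
  obtain B where B: "\<And>x t. x \<in> closure \<Omega> \<Longrightarrow> t \<in> {0..T} \<Longrightarrow> \<bar>w (x, t)\<bar> \<le> B"
    using continuous_Q_bounded[OF w] by blast
  have sub: "x \<in> closure \<Omega>" if "x \<in> \<Omega>" for x using that closure_subset[of \<Omega>] by auto
  \<comment> \<open>The set of full measure of those times at which the slice of \<open>w\<close>
    has its gradient, its approximation and its bound.\<close>
  define G where "G = {t \<in> {0<..<T}. (\<exists>\<phi>. H10_approximation \<Omega> (\<lambda>x. w (x, t)) (\<lambda>x. D (x, t)) \<phi>) \<and>
       has_weak_gradient \<Omega> (\<lambda>x. w (x, t)) (\<lambda>x. D (x, t)) \<and> (AE x in M. norm (D (x, t)) \<le> R)}"
  have aeG: "AE t in I. t \<in> G"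
  proof -
    have "AE t in I. t \<in> {0<..<T}" by (rule AE_I2) simp
    with good show ?thesis by eventually_elim (simp add: G_def)
  qed
  \<comment> \<open>The dense times are taken from \<open>G\<close> itself, since the limit is
    formed with the gradients \<open>D (x, s n)\<close> and their bound \<open>R\<close>.\<close>
  obtain S where S: "countable S" "S \<subseteq> G" "G \<subseteq> closure S" using separable[of G] by blast
  have "AE t in I. \<forall>s\<in>S. l * (\<integral>x. (w (x, s))\<^sup>2 \<partial>M)
      \<le> (\<integral>x. c (x, t) * (w (x, s))\<^sup>2 \<partial>M) + (\<integral>x. w (x, s) * (b (x, t) \<bullet> D (x, s)) \<partial>M)"
  proof (rule AE_ball_countable'[OF _ S(1)])
    fix s assume "s \<in> S"
    then have "s \<in> G" using S by auto
    then obtain \<phi> where \<phi>: "H10_approximation \<Omega> (\<lambda>x. w (x, s)) (\<lambda>x. D (x, s)) \<phi>" and s: "s \<in> {0..T}"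
      unfolding G_def by auto
    have "AE x in M. \<bar>w (x, s)\<bar> \<le> B" using B s sub by (intro AE_I2) auto
    from coercivity_H10[OF coer b c \<phi> this]
    show "AE t in I. l * (\<integral>x. (w (x, s))\<^sup>2 \<partial>M)
      \<le> (\<integral>x. c (x, t) * (w (x, s))\<^sup>2 \<partial>M) + (\<integral>x. w (x, s) * (b (x, t) \<bullet> D (x, s)) \<partial>M)" .
  qed
  moreover have "AE t in I. in_L2 M (\<lambda>x. b (x, t))" "AE t in I. in_L2 M (\<lambda>x. c (x, t))"
    using in_L2_slice[OF open_domain _ bounded_domain, of "{0<..<T}"] b c by (auto simp: cylinder_def)
  ultimately show ?thesis using aeG
  proof eventually_elim
    case (elim t)
    then have "t \<in> closure S" using S by auto
    then obtain s where s: "\<And>n. s n \<in> S" "s \<longlonglongrightarrow> t" unfolding closure_sequential by blast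
    have sG: "s n \<in> G" for n using s S by auto
    have sT: "s n \<in> {0..T}" "t \<in> {0..T}" for n using sG[of n] elim(4) by (auto simp: G_def)
    have ib: "integrable M (\<lambda>x. b (x, t))" and ic: "integrable M (\<lambda>x. c (x, t))"
      using in_L2_integrable[OF finite_M] elim by auto
    have inb: "integrable M (\<lambda>x. norm (b (x, t)))" using ib by auto
    have i1: "integrable M (\<lambda>x. 1::real)" by (rule finite_measure.integrable_const[OF finite_M])
    have DL2: "in_L2 M (\<lambda>x. D (x, r))" if "r \<in> G" for r
      using that by (auto simp: G_def H10_approximation_def)
    have Dm: "(\<lambda>x. D (x, r)) \<in> borel_measurable M" and DR: "AE x in M. norm (D (x, r)) \<le> R" if "r \<in> G" for r
      using DL2[OF that] that by (auto simp: in_L2_def G_def)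
    have wm: "(\<lambda>x. w (x, r)) \<in> borel_measurable M" if "r \<in> {0..T}" for r
      by (rule continuous_Q_slice_measurable(1)[OF w that])
    have wlim: "(\<lambda>n. w (x, s n)) \<longlonglongrightarrow> w (x, t)" if "x \<in> \<Omega>" for x
    proof -
      have "continuous_on {0..T} (\<lambda>t. w (x, t))"
        using that by (intro continuous_on_compose2[OF w]) (auto simp: closure_cylinder sub intro!: continuous_intros)
      then show ?thesis using s(2) sT unfolding continuous_on_sequentially by (auto simp: o_def)
    qed
    have wB: "\<bar>w (x, r)\<bar> \<le> B" if "x \<in> \<Omega>" "r \<in> {0..T}" for x r using B sub that by auto
    have w2B: "\<bar>(w (x, r))\<^sup>2\<bar> \<le> B\<^sup>2" if "x \<in> \<Omega>" "r \<in> {0..T}" for x r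
      using wB[OF that] by (simp add: abs_le_square_iff[symmetric])
    have T1: "(\<lambda>n. \<integral>x. (w (x, s n))\<^sup>2 *\<^sub>R c (x, t) \<partial>M) \<longlonglongrightarrow> (\<integral>x. (w (x, t))\<^sup>2 *\<^sub>R c (x, t) \<partial>M)"
      by (rule integral_bounded_convergence[OF ic, where K="B\<^sup>2"])
         (use w2B sT wm wlim in \<open>auto intro!: AE_I2 tendsto_intros borel_measurable_power\<close>)
    have T2: "(\<lambda>n. \<integral>x. (w (x, s n))\<^sup>2 *\<^sub>R (1::real) \<partial>M) \<longlonglongrightarrow> (\<integral>x. (w (x, t))\<^sup>2 *\<^sub>R (1::real) \<partial>M)"
      by (rule integral_bounded_convergence[OF i1, where K="B\<^sup>2"])
         (use w2B sT wm wlim in \<open>auto intro!: AE_I2 tendsto_intros borel_measurable_power\<close>)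
    have T3: "(\<lambda>n. \<integral>x. \<bar>w (x, s n) - w (x, t)\<bar> *\<^sub>R norm (b (x, t)) \<partial>M) \<longlonglongrightarrow> (\<integral>x. 0 *\<^sub>R norm (b (x, t)) \<partial>M)"
    proof (rule integral_bounded_convergence[OF inb, where K="2 * B"])
      show "(\<lambda>x. \<bar>w (x, s n) - w (x, t)\<bar>) \<in> borel_measurable M" for n
        using wm sT by (intro borel_measurable_abs borel_measurable_diff) auto
      show "AE x in M. \<bar>\<bar>w (x, s n) - w (x, t)\<bar>\<bar> \<le> 2 * B" for n
      proof (rule AE_I2)
        fix x assume "x \<in> space M"
        then show "\<bar>\<bar>w (x, s n) - w (x, t)\<bar>\<bar> \<le> 2 * B"
          using wB[of x "s n"] wB[of x t] sT(1)[of n] sT(2) by simp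
      qed
      show "AE x in M. (\<lambda>n. \<bar>w (x, s n) - w (x, t)\<bar>) \<longlonglongrightarrow> 0"
      proof (rule AE_I2)
        fix x assume "x \<in> space M"
        then have "(\<lambda>n. \<bar>w (x, s n) - w (x, t)\<bar>) \<longlonglongrightarrow> \<bar>w (x, t) - w (x, t)\<bar>"
          by (intro tendsto_intros wlim) simp
        then show "(\<lambda>n. \<bar>w (x, s n) - w (x, t)\<bar>) \<longlonglongrightarrow> 0" by simp
      qed
    qed simp
    have bDi: "integrable M (\<lambda>x. norm (b (x, t)) * norm (D (x, r)))" if "r \<in> G" for r
      by (rule in_L2_mult_integrable(2)[OF elim(2) DL2[OF that]])
    have bD: "integrable M (\<lambda>x. b (x, t) \<bullet> D (x, r))" if "r \<in> G" for r
      by (rule in_L2_mult_integrable(1)[OF elim(2) DL2[OF that]])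
    have wbD: "integrable M (\<lambda>x. (b (x, t) \<bullet> D (x, r)) * w (x, p))" if "r \<in> G" "p \<in> {0..T}" for r p
      by (rule integrable_mult_bounded[OF bD[OF that(1)] wm[OF that(2)], where K=B]) (use wB that in \<open>auto intro!: AE_I2\<close>)
    \<comment> \<open>Splitting off \<open>w (x, s n) - w (x, t)\<close> separates two limits: this
      difference tends to \<open>0\<close> while the gradients stay bounded by \<open>R\<close>; the
      rest has the fixed factor \<open>w (x, t)\<close> and needs only weak convergence of the
      gradients.\<close>
    have T4: "(\<lambda>n. \<integral>x. (w (x, s n) - w (x, t)) * (b (x, t) \<bullet> D (x, s n)) \<partial>M) \<longlonglongrightarrow> 0"
    proof (rule Lim_null_comparison)
      have "(\<lambda>n. R * (\<integral>x. \<bar>w (x, s n) - w (x, t)\<bar> *\<^sub>R norm (b (x, t)) \<partial>M)) \<longlonglongrightarrow> R * (\<integral>x. 0 *\<^sub>R norm (b (x, t)) \<partial>M)"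
        by (intro tendsto_intros T3)
      then show "(\<lambda>n. R * (\<integral>x. \<bar>w (x, s n) - w (x, t)\<bar> *\<^sub>R norm (b (x, t)) \<partial>M)) \<longlonglongrightarrow> 0" by simp
      show "\<forall>\<^sub>F n in sequentially. norm (\<integral>x. (w (x, s n) - w (x, t)) * (b (x, t) \<bullet> D (x, s n)) \<partial>M)
          \<le> R * (\<integral>x. \<bar>w (x, s n) - w (x, t)\<bar> *\<^sub>R norm (b (x, t)) \<partial>M)"
      proof (intro always_eventually allI, unfold real_norm_def, rule uniform_bound_integral)
        fix n
        show "integrable M (\<lambda>x. (w (x, s n) - w (x, t)) * (b (x, t) \<bullet> D (x, s n)))"
          using wbD[OF sG[of n] sT(1)[of n]] wbD[OF sG[of n] sT(2)] by (simp add: left_diff_distrib mult.commute)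
        have "integrable M (\<lambda>x. norm (b (x, t)) * \<bar>w (x, s n) - w (x, t)\<bar>)"
        proof (rule integrable_mult_bounded[OF inb, where K="2 * B"])
          show "(\<lambda>x. \<bar>w (x, s n) - w (x, t)\<bar>) \<in> borel_measurable M"
            using wm sT by (intro borel_measurable_abs borel_measurable_diff) auto
          show "AE x in M. \<bar>\<bar>w (x, s n) - w (x, t)\<bar>\<bar> \<le> 2 * B"
          proof (rule AE_I2)
            fix x assume "x \<in> space M"
            then show "\<bar>\<bar>w (x, s n) - w (x, t)\<bar>\<bar> \<le> 2 * B"
              using wB[of x "s n"] wB[of x t] sT(1)[of n] sT(2) by simp
          qed
        qed
        then show "integrable M (\<lambda>x. \<bar>w (x, s n) - w (x, t)\<bar> *\<^sub>R norm (b (x, t)))" by (simp add: mult.commute)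
        show "AE x in M. \<bar>(w (x, s n) - w (x, t)) * (b (x, t) \<bullet> D (x, s n))\<bar> \<le> R * (\<bar>w (x, s n) - w (x, t)\<bar> *\<^sub>R norm (b (x, t)))"
          using DR[OF sG[of n]]
        proof eventually_elim
          case (elim x)
          have "\<bar>b (x, t) \<bullet> D (x, s n)\<bar> \<le> norm (b (x, t)) * R"
            using Cauchy_Schwarz_ineq2[of "b (x, t)" "D (x, s n)"] mult_left_mono[OF elim norm_ge_zero[of "b (x, t)"]] by linarith
          then have "\<bar>w (x, s n) - w (x, t)\<bar> * \<bar>b (x, t) \<bullet> D (x, s n)\<bar> \<le> \<bar>w (x, s n) - w (x, t)\<bar> * (norm (b (x, t)) * R)"
            by (intro mult_left_mono) auto
          then show ?case by (simp add: abs_mult mult.commute mult.left_commute)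
        qed
      qed
    qed
    have T5: "(\<lambda>n. \<integral>x. (w (x, t) * (b (x, t) \<bullet> i)) * (D (x, s n) \<bullet> i) \<partial>M)
        \<longlonglongrightarrow> (\<integral>x. (w (x, t) * (b (x, t) \<bullet> i)) * (D (x, t) \<bullet> i) \<partial>M)" and
      T5i: "r \<in> G \<Longrightarrow> integrable M (\<lambda>x. (w (x, t) * (b (x, t) \<bullet> i)) * (D (x, r) \<bullet> i))" if i: "i \<in> Basis" for i r
    proof -
      have "integrable M (\<lambda>x. (b (x, t) \<bullet> i) * w (x, t))"
        using ib wm[OF sT(2)] wB sT(2) by (intro integrable_mult_bounded[where K=B]) (auto intro!: AE_I2)
      then have wb: "integrable M (\<lambda>x. w (x, t) * (b (x, t) \<bullet> i))" by (simp add: mult.commute)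
      have Dim: "(\<lambda>x. D (x, r) \<bullet> i) \<in> borel_measurable M" if "r \<in> G" for r using Dm[OF that] by simp
      have DiR: "AE x in M. \<bar>D (x, r) \<bullet> i\<bar> \<le> R" if "r \<in> G" for r
        using DR[OF that] by eventually_elim (use Basis_le_norm[OF i] order_trans in blast)
      show "r \<in> G \<Longrightarrow> integrable M (\<lambda>x. (w (x, t) * (b (x, t) \<bullet> i)) * (D (x, r) \<bullet> i))"
        by (rule integrable_mult_bounded[OF wb Dim DiR])
      show "(\<lambda>n. \<integral>x. (w (x, t) * (b (x, t) \<bullet> i)) * (D (x, s n) \<bullet> i) \<partial>M)
        \<longlonglongrightarrow> (\<integral>x. (w (x, t) * (b (x, t) \<bullet> i)) * (D (x, t) \<bullet> i) \<partial>M)"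
      proof (rule weak_convergence_L1[OF open_domain bounded_domain wb Dim[OF sG] Dim[OF elim(4)] DiR[OF sG] DiR[OF elim(4)]])
        fix \<phi> :: "'a \<Rightarrow> real" assume \<phi>: "\<phi> \<in> test_functions \<Omega>"
        have gradi: "integrable M (grad \<phi>)"
          by (rule in_L2_integrable[OF finite_M test_functions_in_L2(2)[OF open_domain bounded_domain \<phi>]])
        \<comment> \<open>Integration by parts moves the gradient onto the test function, after
          which only the continuity of \<open>w\<close> in time matters.\<close>
        have parts: "(\<integral>x. \<phi> x * (D (x, r) \<bullet> i) \<partial>M) = - (\<integral>x. w (x, r) *\<^sub>R (grad \<phi> x \<bullet> i) \<partial>M)" if r: "r \<in> G" for r
        proof -
          have rT: "r \<in> {0..T}" and wg: "has_weak_gradient \<Omega> (\<lambda>x. w (x, r)) (\<lambda>x. D (x, r))"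
            using r by (auto simp: G_def)
          have i1: "integrable M (\<lambda>x. \<phi> x *\<^sub>R D (x, r))"
            by (rule test_functions_integrable_mult[OF open_domain \<phi> in_L2_integrable[OF finite_M DL2[OF r]]])
          have i2: "integrable M (\<lambda>x. w (x, r) *\<^sub>R grad \<phi> x)"
          proof (rule Bochner_Integration.integrable_bound)
            show "integrable M (\<lambda>x. B *\<^sub>R grad \<phi> x)" using gradi by simp
            show "(\<lambda>x. w (x, r) *\<^sub>R grad \<phi> x) \<in> borel_measurable M"
              using wm[OF rT] gradi by (intro borel_measurable_scaleR) auto
            show "AE x in M. norm (w (x, r) *\<^sub>R grad \<phi> x) \<le> norm (B *\<^sub>R grad \<phi> x)"
              using wB[OF _ rT] by (intro AE_I2) (auto intro!: mult_right_mono order_trans[OF _ abs_ge_self])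
          qed
          have "(\<integral>x. \<phi> x *\<^sub>R D (x, r) \<partial>M) \<bullet> i = - (\<integral>x. w (x, r) *\<^sub>R grad \<phi> x \<partial>M) \<bullet> i"
            using wg \<phi> by (simp add: has_weak_gradient_def)
          then show ?thesis
            using integral_inner_left[OF i1, of i] integral_inner_left[OF i2, of i] by simp
        qed
        have "(\<lambda>n. \<integral>x. w (x, s n) *\<^sub>R (grad \<phi> x \<bullet> i) \<partial>M) \<longlonglongrightarrow> (\<integral>x. w (x, t) *\<^sub>R (grad \<phi> x \<bullet> i) \<partial>M)"
          by (rule integral_bounded_convergence[where K=B])
             (use gradi wB sT wm wlim in \<open>auto intro!: AE_I2\<close>)
        then show "(\<lambda>n. \<integral>x. \<phi> x * (D (x, s n) \<bullet> i) \<partial>M) \<longlonglongrightarrow> (\<integral>x. \<phi> x * (D (x, t) \<bullet> i) \<partial>M)"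
          unfolding parts[OF sG] parts[OF elim(4)] by (rule tendsto_minus)
      qed
    qed
    have expand: "(\<integral>x. w (x, t) * (b (x, t) \<bullet> D (x, r)) \<partial>M) = (\<Sum>i\<in>Basis. \<integral>x. (w (x, t) * (b (x, t) \<bullet> i)) * (D (x, r) \<bullet> i) \<partial>M)"
      if "r \<in> G" for r
    proof -
      have "w (x, t) * (b (x, t) \<bullet> D (x, r)) = (\<Sum>i\<in>Basis. (w (x, t) * (b (x, t) \<bullet> i)) * (D (x, r) \<bullet> i))" for x
        by (subst euclidean_inner) (simp only: sum_distrib_left mult.assoc)
      then have "(\<integral>x. w (x, t) * (b (x, t) \<bullet> D (x, r)) \<partial>M) = (\<integral>x. (\<Sum>i\<in>Basis. (w (x, t) * (b (x, t) \<bullet> i)) * (D (x, r) \<bullet> i)) \<partial>M)"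
        by (simp only:)
      also have "\<dots> = (\<Sum>i\<in>Basis. \<integral>x. (w (x, t) * (b (x, t) \<bullet> i)) * (D (x, r) \<bullet> i) \<partial>M)"
        by (rule Bochner_Integration.integral_sum) (rule T5i[OF _ that])
      finally show ?thesis .
    qed
    have T6: "(\<lambda>n. \<integral>x. w (x, t) * (b (x, t) \<bullet> D (x, s n)) \<partial>M) \<longlonglongrightarrow> (\<integral>x. w (x, t) * (b (x, t) \<bullet> D (x, t)) \<partial>M)"
      unfolding expand[OF sG] expand[OF elim(4)] by (intro tendsto_sum T5)
    have split: "(\<integral>x. w (x, s n) * (b (x, t) \<bullet> D (x, s n)) \<partial>M)
        = (\<integral>x. (w (x, s n) - w (x, t)) * (b (x, t) \<bullet> D (x, s n)) \<partial>M) + (\<integral>x. w (x, t) * (b (x, t) \<bullet> D (x, s n)) \<partial>M)" for n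
      using wbD[OF sG[of n] sT(1)[of n]] wbD[OF sG[of n] sT(2)] by (simp add: left_diff_distrib mult.commute)
    have T7: "(\<lambda>n. \<integral>x. w (x, s n) * (b (x, t) \<bullet> D (x, s n)) \<partial>M) \<longlonglongrightarrow> (\<integral>x. w (x, t) * (b (x, t) \<bullet> D (x, t)) \<partial>M)"
      unfolding split using tendsto_add[OF T4 T6] by simp
    have "l * (\<integral>x. (w (x, t))\<^sup>2 *\<^sub>R (1::real) \<partial>M)
      \<le> (\<integral>x. (w (x, t))\<^sup>2 *\<^sub>R c (x, t) \<partial>M) + (\<integral>x. w (x, t) * (b (x, t) \<bullet> D (x, t)) \<partial>M)"
    proof (rule LIMSEQ_le)
      show "(\<lambda>n. l * (\<integral>x. (w (x, s n))\<^sup>2 *\<^sub>R (1::real) \<partial>M)) \<longlonglongrightarrow> l * (\<integral>x. (w (x, t))\<^sup>2 *\<^sub>R (1::real) \<partial>M)"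
        by (intro tendsto_intros T2)
      show "(\<lambda>n. (\<integral>x. (w (x, s n))\<^sup>2 *\<^sub>R c (x, t) \<partial>M) + (\<integral>x. w (x, s n) * (b (x, t) \<bullet> D (x, s n)) \<partial>M))
        \<longlonglongrightarrow> (\<integral>x. (w (x, t))\<^sup>2 *\<^sub>R c (x, t) \<partial>M) + (\<integral>x. w (x, t) * (b (x, t) \<bullet> D (x, t)) \<partial>M)"
        by (intro tendsto_intros T1 T7)
      show "\<exists>N. \<forall>n\<ge>N. l * (\<integral>x. (w (x, s n))\<^sup>2 *\<^sub>R (1::real) \<partial>M)
        \<le> (\<integral>x. (w (x, s n))\<^sup>2 *\<^sub>R c (x, t) \<partial>M) + (\<integral>x. w (x, s n) * (b (x, t) \<bullet> D (x, s n)) \<partial>M)"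
        using elim(1) s(1) by (auto simp: mult.commute)
    qed
    then show ?case by (simp add: mult.commute)
  qed
qed

end

section \<open>The stability estimate\<close>

lemma AE_le_imp_le_of_continuous:
  fixes f :: "'a::euclidean_space \<Rightarrow> real"
  assumes "open U" and f: "continuous_on U f" and ae: "AE x in lebesgue_on U. f x \<le> c" and "x \<in> U"
  shows "f x \<le> c"
proof (rule ccontr)
  assume "\<not> f x \<le> c"
  \<comment> \<open>The set where \<open>f\<close> exceeds \<open>c\<close> is open and null, hence
    empty.\<close>
  define V where "V = U \<inter> f -` {c<..}"
  have "open V" unfolding V_def using f \<open>open U\<close> by (intro continuous_open_preimage) auto
  have "x \<in> V" using \<open>\<not> f x \<le> c\<close> \<open>x \<in> U\<close> by (simp add: V_def)
  have "AE x in lebesgue. x \<in> U \<longrightarrow> f x \<le> c"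
    using ae \<open>open U\<close> by (simp add: AE_restrict_space_iff)
  then have "AE x in lebesgue. x \<notin> V"
    by eventually_elim (auto simp: V_def)
  moreover have "V \<in> sets lebesgue" using \<open>open V\<close> by auto
  ultimately have "V \<in> null_sets lebesgue"
    using AE_iff_null_sets by blast
  then have "negligible V" by (simp add: negligible_iff_null_sets)
  with open_not_negligible[OF \<open>open V\<close>] \<open>x \<in> V\<close> show False by blast
qed

text \<open>Let \<open>B\<close> be the maximum of \<open>y\<close> weighted with
  \<open>exp (- (2 * K * s))\<close>, attained at \<open>s\<close>. The integral of the majorant
  \<open>B * exp (2 * K * r)\<close>, multiplied by \<open>K\<close>, is at most half of
  \<open>B * exp (2 * K * s)\<close>, which is half of \<open>y s\<close>, and can be absorbed. The
  resulting constants \<open>2 * A\<close> and \<open>2 * K\<close> are not sharp but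
  sufficient.\<close>

lemma gronwall_integral:
  fixes y :: "real \<Rightarrow> real"
  assumes y: "continuous_on {0..T} y" "\<And>t. t \<in> {0..T} \<Longrightarrow> 0 \<le> y t" and "0 \<le> K" "0 \<le> T"
    and le: "\<And>t. t \<in> {0..T} \<Longrightarrow> y t \<le> A + K * integral {0..t} y" and t: "t \<in> {0..T}"
  shows "y t \<le> 2 * A * exp (2 * K * t)"
proof -
  define z where "z s = y s * exp (- (2 * K * s))" for s
  have "continuous_on {0..T} z" unfolding z_def by (intro continuous_intros y)
  then obtain s where s: "s \<in> {0..T}" "\<And>r. r \<in> {0..T} \<Longrightarrow> z r \<le> z s"
    using continuous_attains_sup[of "{0..T}" z] \<open>0 \<le> T\<close> by auto
  define B where "B = z s"
  have "0 \<le> B" using y(2)[OF s(1)] by (simp add: B_def z_def)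
  have yz: "y r = z r * exp (2 * K * r)" for r
    by (simp add: z_def exp_minus)
  have yB: "y r \<le> B * exp (2 * K * r)" if "r \<in> {0..T}" for r
    unfolding yz[of r] B_def using s(2)[OF that] by (intro mult_right_mono) auto
  have E: "((\<lambda>r. K * (B * exp (2 * K * r))) has_integral (B * exp (2 * K * s) / 2 - B * exp (2 * K * 0) / 2)) {0..s}"
    using s(1) by (intro fundamental_theorem_of_calculus)
      (auto simp: has_real_derivative_iff_has_vector_derivative[symmetric] intro!: derivative_eq_intros)
  have "y integrable_on {0..s}"
    by (rule integrable_continuous_interval[OF continuous_on_subset[OF y(1)]]) (use s(1) in auto)
  then have Y: "((\<lambda>r. K * y r) has_integral K * integral {0..s} y) {0..s}"
    by (intro has_integral_mult_right integrable_integral)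
  have "K * integral {0..s} y \<le> B * exp (2 * K * s) / 2 - B * exp (2 * K * 0) / 2"
    by (rule has_integral_le[OF Y E]) (use yB s(1) \<open>0 \<le> K\<close> in \<open>auto intro!: mult_left_mono\<close>)
  then have "y s \<le> A + B * exp (2 * K * s) / 2"
    using le[OF s(1)] \<open>0 \<le> B\<close> by simp
  then have 1: "B * exp (2 * K * s) \<le> 2 * A" using yz[of s] by (simp add: B_def)
  have "1 \<le> exp (2 * K * s)" using s(1) \<open>0 \<le> K\<close> by simp
  then have "B * 1 \<le> B * exp (2 * K * s)" using \<open>0 \<le> B\<close> by (intro mult_left_mono)
  with 1 have "B \<le> 2 * A" by simp
  then have "B * exp (2 * K * t) \<le> 2 * A * exp (2 * K * t)" by (intro mult_right_mono) auto
  then show ?thesis by (rule order_trans[OF yB[OF t]])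
qed

text \<open>From \<open>2 * r \<le> 1 + r\<^sup>2\<close>. It bounds the L1 norms of the data, which
  occur with the factor \<open>1 - \<alpha>\<close>, by \<open>R\<close> and the volume; the factor
  \<open>2\<close> is kept because the norms of two data sets will be added.\<close>

lemma L1_le_L2:
  fixes h :: "'a \<Rightarrow> 'b::euclidean_space"
  assumes "finite_measure N" "in_L2 N h" "L2_norm N h \<le> R"
  shows "2 * (\<integral>x. norm (h x) \<partial>N) \<le> measure N (space N) + R\<^sup>2"
proof -
  have i: "integrable N (\<lambda>x. (norm (h x))\<^sup>2)" "integrable N (\<lambda>x. norm (h x))" "integrable N (\<lambda>x. 1::real)"
    using assms in_L2_integrable[OF assms(1,2)] finite_measure.integrable_const[OF assms(1)] by (auto simp: in_L2_def)
  have "2 * norm (h x) \<le> 1 + (norm (h x))\<^sup>2" for x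
    using sum_squares_bound[of 1 "norm (h x)"] by simp
  then have "(\<integral>x. 2 * norm (h x) \<partial>N) \<le> (\<integral>x. 1 + (norm (h x))\<^sup>2 \<partial>N)"
    using i by (intro integral_mono) auto
  also have "\<dots> = measure N (space N) + (L2_norm N h)\<^sup>2"
    using i by (simp add: L2_norm_def)
  also have "(L2_norm N h)\<^sup>2 \<le> R\<^sup>2"
    using assms(3) by (intro power_mono) (auto simp: L2_norm_def)
  finally show ?thesis by simp
qed

text \<open>With \<open>\<gamma> = 1 - \<alpha>\<close> and \<open>w = u\<^sub>1 - u\<^sub>2\<close>, the sum of the two variational inequalities, tested with
  \<open>\<alpha> u\<^sub>2\<close> and \<open>\<alpha> u\<^sub>1\<close>, is the coercive form of \<open>w\<close> up to an error that is linear in the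
  differences of the data and in \<open>\<gamma>\<close>.\<close>

lemma perturbation_bound:
  fixes b1 b2 D1 D2 :: "'a::real_inner" and c1 c2 f1 f2 u1 u2 :: real
  assumes u: "\<bar>u1\<bar> \<le> B" "\<bar>u2\<bar> \<le> B" and D: "norm D1 \<le> R" "norm D2 \<le> R" and \<alpha>: "\<alpha> \<le> 1"
  shows "(b1 \<bullet> D1) * (\<alpha> * u2 - u1) + c1 * u1 * (\<alpha> * u2 - u1) - f1 * (\<alpha> * u2 - u1)
      + ((b2 \<bullet> D2) * (\<alpha> * u1 - u2) + c2 * u2 * (\<alpha> * u1 - u2) - f2 * (\<alpha> * u1 - u2))
      \<le> - (c1 * (u1 - u2)\<^sup>2 + (u1 - u2) * (b1 \<bullet> (D1 - D2)))
        + (2 * B * R * norm (b1 - b2) + 2 * B * B * \<bar>c1 - c2\<bar> + 2 * B * \<bar>f1 - f2\<bar>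
          + (1 - \<alpha>) * (B * R * (norm b1 + norm b2) + B * B * (\<bar>c1\<bar> + \<bar>c2\<bar>) + B * (\<bar>f1\<bar> + \<bar>f2\<bar>)))"
proof -
  define g where "g = 1 - \<alpha>"
  have g: "0 \<le> g" and \<alpha>g: "\<alpha> = 1 - g" using \<alpha> by (auto simp: g_def)
  have B: "0 \<le> B" and R: "0 \<le> R" using u(1) D(1) norm_ge_zero[of D1] by linarith+
  define w where "w = u1 - u2"
  have w: "\<bar>w\<bar> \<le> 2 * B" using u by (simp add: w_def)
  \<comment> \<open>An exact rearrangement: the coefficients with index 1 are kept in the quadratic
    form, so the differences of the coefficients meet \<open>w\<close> and \<open>D2\<close> or
    \<open>u2\<close>, and every term with \<open>g\<close> comes from the scaling.\<close>
  have id: "(b1 \<bullet> D1) * (\<alpha> * u2 - u1) + c1 * u1 * (\<alpha> * u2 - u1) - f1 * (\<alpha> * u2 - u1)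
      + ((b2 \<bullet> D2) * (\<alpha> * u1 - u2) + c2 * u2 * (\<alpha> * u1 - u2) - f2 * (\<alpha> * u1 - u2))
    = - (c1 * w\<^sup>2 + w * (b1 \<bullet> (D1 - D2)))
      + (- (w * ((b1 - b2) \<bullet> D2)) + (- (w * u2 * (c1 - c2))) + w * (f1 - f2)
        + g * (- (u2 * (b1 \<bullet> D1)) + (- (u1 * (b2 \<bullet> D2))) + (- (u1 * u2 * c1)) + (- (u1 * u2 * c2)) + u2 * f1 + u1 * f2))"
    by (simp add: \<alpha>g w_def inner_diff_left inner_diff_right power2_eq_square algebra_simps)
  have inner: "\<bar>b \<bullet> D\<bar> \<le> R * norm b" if "norm D \<le> R" for b D :: 'a
    using Cauchy_Schwarz_ineq2[of b D] mult_left_mono[OF that norm_ge_zero[of b]] by (simp add: mult.commute)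
  have prod: "\<bar>p * q\<bar> \<le> P * Q" if "\<bar>p\<bar> \<le> P" "\<bar>q\<bar> \<le> Q" for p q P Q :: real
    unfolding abs_mult using that by (intro mult_mono) auto
  have 1: "\<bar>w * ((b1 - b2) \<bullet> D2)\<bar> \<le> 2 * B * R * norm (b1 - b2)"
    unfolding mult.assoc[of "2 * B"] by (rule prod[OF w inner[OF D(2)]])
  have 2: "\<bar>w * u2 * (c1 - c2)\<bar> \<le> 2 * B * B * \<bar>c1 - c2\<bar>" by (rule prod[OF prod[OF w u(2)]]) simp
  have 3: "\<bar>w * (f1 - f2)\<bar> \<le> 2 * B * \<bar>f1 - f2\<bar>" by (rule prod[OF w]) simp
  have 4: "\<bar>u2 * (b1 \<bullet> D1)\<bar> \<le> B * R * norm b1" unfolding mult.assoc[of B] by (rule prod[OF u(2) inner[OF D(1)]])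
  have 5: "\<bar>u1 * (b2 \<bullet> D2)\<bar> \<le> B * R * norm b2" unfolding mult.assoc[of B] by (rule prod[OF u(1) inner[OF D(2)]])
  have 6: "\<bar>u1 * u2 * c1\<bar> \<le> B * B * \<bar>c1\<bar>" by (rule prod[OF prod[OF u]]) simp
  have 7: "\<bar>u1 * u2 * c2\<bar> \<le> B * B * \<bar>c2\<bar>" by (rule prod[OF prod[OF u]]) simp
  have 8: "\<bar>u2 * f1\<bar> \<le> B * \<bar>f1\<bar>" by (rule prod[OF u(2)]) simp
  have 9: "\<bar>u1 * f2\<bar> \<le> B * \<bar>f2\<bar>" by (rule prod[OF u(1)]) simp
  have "- (u2 * (b1 \<bullet> D1)) + (- (u1 * (b2 \<bullet> D2))) + (- (u1 * u2 * c1)) + (- (u1 * u2 * c2)) + u2 * f1 + u1 * f2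
      \<le> B * R * (norm b1 + norm b2) + B * B * (\<bar>c1\<bar> + \<bar>c2\<bar>) + B * (\<bar>f1\<bar> + \<bar>f2\<bar>)"
    using abs_le_D2[OF 4] abs_le_D2[OF 5] abs_le_D2[OF 6] abs_le_D2[OF 7] abs_le_D1[OF 8] abs_le_D1[OF 9]
    unfolding distrib_left by linarith
  then have "g * (- (u2 * (b1 \<bullet> D1)) + (- (u1 * (b2 \<bullet> D2))) + (- (u1 * u2 * c1)) + (- (u1 * u2 * c2)) + u2 * f1 + u1 * f2)
      \<le> g * (B * R * (norm b1 + norm b2) + B * B * (\<bar>c1\<bar> + \<bar>c2\<bar>) + B * (\<bar>f1\<bar> + \<bar>f2\<bar>))"
    by (rule mult_left_mono[OF _ g])
  then show ?thesis
    unfolding id w_def[symmetric] g_def[symmetric]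
    by (rule add_left_mono[OF add_mono[OF add_mono[OF add_mono[OF abs_le_D2[OF 1] abs_le_D2[OF 2]] abs_le_D1[OF 3]]]])
qed

section \<open>The estimate for two solutions\<close>

context cylinder_domain
begin

text \<open>Collects what the comparison needs from one solution. Its bounds involve only
  \<open>R\<close> and \<open>\<rho>\<close>: the norm of \<open>g\<close> bounds the gradient, and
  the sup bound then follows from the boundary condition contained in \<open>H10\<close>.\<close>

lemma solution_properties:
  assumes sol: "is_solution \<Omega> T b c f g u0 u" and adm: "admissible_data \<Omega> T l m b c f g u0"
    and data: "data_bounded_by \<Omega> T R b c f g" and \<rho>: "\<Omega> \<subseteq> ball 0 \<rho>" "0 < \<rho>"
  obtains ut Du where "time_regular u ut" "0 \<le> R"
    "Du \<in> borel_measurable (lebesgue_on Q)"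
    "\<And>x t. x \<in> \<Omega> \<Longrightarrow> t \<in> {0..T} \<Longrightarrow> \<bar>u (x, t)\<bar> \<le> 2 * \<rho> * R"
    "AE t in I. (\<exists>\<phi>. H10_approximation \<Omega> (\<lambda>x. u (x, t)) (\<lambda>x. Du (x, t)) \<phi>) \<and>
       has_weak_gradient \<Omega> (\<lambda>x. u (x, t)) (\<lambda>x. Du (x, t)) \<and> (AE x in M. norm (Du (x, t)) \<le> R)"
    "AE t in I. (\<lambda>x. u (x, t)) \<in> gradient_constraint \<Omega> (\<lambda>x. g (x, t))"
    "AE t in I. \<forall>v\<in>gradient_constraint \<Omega> (\<lambda>x. g (x, t)).
          (\<integral>x. f (x, t) * (v x - u (x, t)) \<partial>M) \<le>
          (\<integral>x. ut (x, t) * (v x - u (x, t)) \<partial>M) +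
          (\<integral>x. (b (x, t) \<bullet> Du (x, t)) * (v x - u (x, t)) \<partial>M) +
          (\<integral>x. c (x, t) * u (x, t) * (v x - u (x, t)) \<partial>M)"
proof -
  obtain ut Du where s: "in_L2 (lebesgue_on Q) ut" "has_weak_time_deriv \<Omega> T u ut" "Linf_W1inf0 \<Omega> T u Du"
    "AE t in I. \<forall>v\<in>gradient_constraint \<Omega> (\<lambda>x. g (x, t)).
          (\<integral>x. f (x, t) * (v x - u (x, t)) \<partial>M) \<le>
          (\<integral>x. ut (x, t) * (v x - u (x, t)) \<partial>M) +
          (\<integral>x. (b (x, t) \<bullet> Du (x, t)) * (v x - u (x, t)) \<partial>M) +
          (\<integral>x. c (x, t) * u (x, t) * (v x - u (x, t)) \<partial>M)"
    using sol unfolding is_solution_def by blast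
  have cu: "continuous_on (closure Q) u" and K: "AE t in I. (\<lambda>x. u (x, t)) \<in> gradient_constraint \<Omega> (\<lambda>x. g (x, t))"
    using sol by (auto simp: is_solution_def)
  have reg: "time_regular u ut" using cu s by (simp add: time_regular_def)
  have Dum: "Du \<in> borel_measurable (lebesgue_on Q)"
    and wg: "AE t in I. has_weak_gradient \<Omega> (\<lambda>x. u (x, t)) (\<lambda>x. Du (x, t))"
    using s(3) by (auto simp: Linf_W1inf0_def in_Linf_def elim: eventually_mono)
  have gL: "in_Linf (lebesgue_on Q) g" using adm by (simp add: admissible_data_def time_W1inf_def)
  obtain g' :: "'a \<times> real \<Rightarrow> real" where g': "in_Linf (lebesgue_on Q) g'" "Linf_norm (lebesgue_on Q) g + Linf_norm (lebesgue_on Q) g' \<le> R"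
    using data by (auto simp: data_bounded_by_def time_W1inf_norm_le_def)
  \<comment> \<open>\<open>R\<close> is not assumed nonnegative; it is so because it bounds a sum of
    norms.\<close>
  have gR: "Linf_norm (lebesgue_on Q) g \<le> R" "0 \<le> R"
    using g' in_Linf_AE_le_norm(2)[OF gL] in_Linf_AE_le_norm(2)[OF g'(1)] by auto
  have "AE z in lebesgue_on Q. norm (g z) \<le> R"
    using in_Linf_AE_le_norm(1)[OF gL] by eventually_elim (use gR in linarith)
  then have gR': "AE t in I. AE x in M. norm (g (x, t)) \<le> R" by (rule AE_Q(2))
  have good: "AE t in I. (\<exists>\<phi>. H10_approximation \<Omega> (\<lambda>x. u (x, t)) (\<lambda>x. Du (x, t)) \<phi>) \<and>
       has_weak_gradient \<Omega> (\<lambda>x. u (x, t)) (\<lambda>x. Du (x, t)) \<and> (AE x in M. norm (Du (x, t)) \<le> R)"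
    using K wg gR'
  proof eventually_elim
    case (elim t)
    have "(\<lambda>x. u (x, t)) \<in> H10 \<Omega>" using elim(1) by (simp add: gradient_constraint_def)
    then obtain \<phi> where "H10_approximation \<Omega> (\<lambda>x. u (x, t)) (\<lambda>x. Du (x, t)) \<phi>"
      using H10_approximation_exists[OF open_domain _ elim(2)] by blast
    moreover have "AE x in M. norm (Du (x, t)) \<le> R"
      using gradient_constraint_bound[OF open_domain elim(1,2)] elim(3)
      by eventually_elim (simp add: abs_le_iff)
    ultimately show ?case using elim(2) by blast
  qed
  \<comment> \<open>The bound is lifted from almost every to every point in two rounds, by
    continuity in \<open>x\<close> at almost every time and then by continuity in \<open>t\<close>
    up to the endpoints.\<close>
  have slices: "AE t in I. \<forall>x\<in>\<Omega>. \<bar>u (x, t)\<bar> \<le> 2 * \<rho> * R"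
  proof -
    have "AE t in I. t \<in> {0<..<T}" by (rule AE_I2) simp
    with good show ?thesis
    proof eventually_elim
      case (elim t)
      then obtain \<phi> where \<phi>: "H10_approximation \<Omega> (\<lambda>x. u (x, t)) (\<lambda>x. Du (x, t)) \<phi>" by blast
      have ae: "AE x in M. \<bar>u (x, t)\<bar> \<le> 2 * \<rho> * R"
        by (rule H10_sup_bound[OF open_domain \<rho> gR(2) \<phi>]) (use elim in blast)
      show ?case
      proof
        fix x assume "x \<in> \<Omega>"
        have "continuous_on \<Omega> (\<lambda>x. \<bar>u (x, t)\<bar>)"
          using continuous_Q_slice[OF cu, of t] elim(2) by (intro continuous_intros) auto
        from AE_le_imp_le_of_continuous[OF open_domain this ae \<open>x \<in> \<Omega>\<close>] show "\<bar>u (x, t)\<bar> \<le> 2 * \<rho> * R" .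
      qed
    qed
  qed
  have bound: "\<bar>u (x, t)\<bar> \<le> 2 * \<rho> * R" if "x \<in> \<Omega>" "t \<in> {0..T}" for x t
  proof -
    have c: "continuous_on {0..T} (\<lambda>t. \<bar>u (x, t)\<bar>)"
      using that(1) closure_subset[of \<Omega>]
      by (intro continuous_intros continuous_on_compose2[OF cu]) (auto simp: closure_cylinder intro!: continuous_intros)
    have ae: "AE t in I. \<bar>u (x, t)\<bar> \<le> 2 * \<rho> * R"
      using slices by eventually_elim (use that(1) in blast)
    have open_bd: "\<bar>u (x, t)\<bar> \<le> 2 * \<rho> * R" if "t \<in> {0<..<T}" for t
      by (rule AE_le_imp_le_of_continuous[OF open_greaterThanLessThan continuous_on_subset[OF c] ae that]) auto
    have cl: "closure {0<..<T} = {0..T}" using T_pos by simp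
    show ?thesis
      by (rule continuous_le_on_closure[of "{0<..<T}" "\<lambda>t. \<bar>u (x, t)\<bar>"]) (use c that(2) open_bd cl in auto)
  qed
  show thesis by (rule that[OF reg gR(2) Dum bound good K s(4)])
qed

text \<open>The constants enter as named hypotheses to keep the estimate explicit. \<open>B\<close>
  is the sup bound of the solutions, \<open>\<kappa>\<close> bounds the sum of the L1 norms of two
  corresponding data, and \<open>A\<close> is the squared initial difference plus twice the bound of
  the integrated error plus the contribution of the mixed term.\<close>

lemma stability:
  assumes sol1: "is_solution \<Omega> T b1 c1 f1 g1 u01 u1" and adm1: "admissible_data \<Omega> T l m b1 c1 f1 g1 u01"
    and data1: "data_bounded_by \<Omega> T R b1 c1 f1 g1"
    and sol2: "is_solution \<Omega> T b2 c2 f2 g2 u02 u2" and adm2: "admissible_data \<Omega> T l m b2 c2 f2 g2 u02"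
    and data2: "data_bounded_by \<Omega> T R b2 c2 f2 g2"
    and "0 < m" and \<rho>: "\<Omega> \<subseteq> ball 0 \<rho>" "0 < \<rho>"
    and B_def: "B = 2 * \<rho> * R" and \<kappa>_def: "\<kappa> = measure lebesgue Q + R\<^sup>2"
    and \<beta>_def: "\<beta> = Linf_norm (lebesgue_on Q) (\<lambda>z. g1 z - g2 z)"
    and A_def: "A = (L2_norm M (\<lambda>x. u01 x - u02 x))\<^sup>2
      + 4 * B * R * L1_norm (lebesgue_on Q) (\<lambda>z. b1 z - b2 z)
      + 4 * B * B * L1_norm (lebesgue_on Q) (\<lambda>z. c1 z - c2 z)
      + 4 * B * L1_norm (lebesgue_on Q) (\<lambda>z. f1 z - f2 z)
      + \<beta> / m * (4 * B * B * measure lebesgue \<Omega> + 2 * \<kappa> * (B * R + B * B + B))"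
  shows "(Linf_L2_norm \<Omega> T (\<lambda>z. u1 z - u2 z))\<^sup>2 \<le> 2 * A * exp (4 * \<bar>l\<bar> * T)" and "0 \<le> R" and "0 \<le> \<beta>"
proof -
  let ?LQ = "lebesgue_on Q"
  obtain ut1 Du1 where s1: "time_regular u1 ut1" "0 \<le> R" "Du1 \<in> borel_measurable ?LQ"
    "\<And>x t. x \<in> \<Omega> \<Longrightarrow> t \<in> {0..T} \<Longrightarrow> \<bar>u1 (x, t)\<bar> \<le> 2 * \<rho> * R"
    "AE t in I. (\<exists>\<phi>. H10_approximation \<Omega> (\<lambda>x. u1 (x, t)) (\<lambda>x. Du1 (x, t)) \<phi>) \<and>
       has_weak_gradient \<Omega> (\<lambda>x. u1 (x, t)) (\<lambda>x. Du1 (x, t)) \<and> (AE x in M. norm (Du1 (x, t)) \<le> R)"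
    "AE t in I. (\<lambda>x. u1 (x, t)) \<in> gradient_constraint \<Omega> (\<lambda>x. g1 (x, t))"
    "AE t in I. \<forall>v\<in>gradient_constraint \<Omega> (\<lambda>x. g1 (x, t)).
          (\<integral>x. f1 (x, t) * (v x - u1 (x, t)) \<partial>M) \<le>
          (\<integral>x. ut1 (x, t) * (v x - u1 (x, t)) \<partial>M) +
          (\<integral>x. (b1 (x, t) \<bullet> Du1 (x, t)) * (v x - u1 (x, t)) \<partial>M) +
          (\<integral>x. c1 (x, t) * u1 (x, t) * (v x - u1 (x, t)) \<partial>M)"
    using solution_properties[OF sol1 adm1 data1 \<rho>] by blast
  obtain ut2 Du2 where s2: "time_regular u2 ut2" "0 \<le> R" "Du2 \<in> borel_measurable ?LQ"
    "\<And>x t. x \<in> \<Omega> \<Longrightarrow> t \<in> {0..T} \<Longrightarrow> \<bar>u2 (x, t)\<bar> \<le> 2 * \<rho> * R"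
    "AE t in I. (\<exists>\<phi>. H10_approximation \<Omega> (\<lambda>x. u2 (x, t)) (\<lambda>x. Du2 (x, t)) \<phi>) \<and>
       has_weak_gradient \<Omega> (\<lambda>x. u2 (x, t)) (\<lambda>x. Du2 (x, t)) \<and> (AE x in M. norm (Du2 (x, t)) \<le> R)"
    "AE t in I. (\<lambda>x. u2 (x, t)) \<in> gradient_constraint \<Omega> (\<lambda>x. g2 (x, t))"
    "AE t in I. \<forall>v\<in>gradient_constraint \<Omega> (\<lambda>x. g2 (x, t)).
          (\<integral>x. f2 (x, t) * (v x - u2 (x, t)) \<partial>M) \<le>
          (\<integral>x. ut2 (x, t) * (v x - u2 (x, t)) \<partial>M) +
          (\<integral>x. (b2 (x, t) \<bullet> Du2 (x, t)) * (v x - u2 (x, t)) \<partial>M) +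
          (\<integral>x. c2 (x, t) * u2 (x, t) * (v x - u2 (x, t)) \<partial>M)"
    using solution_properties[OF sol2 adm2 data2 \<rho>] by blast
  show "0 \<le> R" by (rule s1(2))
  have "0 \<le> B" using \<open>0 \<le> R\<close> \<rho>(2) by (simp add: B_def)
  have u1B: "\<bar>u1 (x, t)\<bar> \<le> B" and u2B: "\<bar>u2 (x, t)\<bar> \<le> B" if "x \<in> \<Omega>" "t \<in> {0..T}" for x t
    using s1(4) s2(4) that by (auto simp: B_def)
  have cu1: "continuous_on (closure Q) u1" and cu2: "continuous_on (closure Q) u2"
    using s1(1) s2(1) by (auto simp: time_regular_def)
  define w where "w z = u1 z - u2 z" for z
  define Dw where "Dw z = Du1 z - Du2 z" for z
  have cw: "continuous_on (closure Q) w" unfolding w_def by (intro continuous_intros cu1 cu2)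
  define y where "y t = (\<integral>x. (w (x, t))\<^sup>2 \<partial>M)" for t
  have cy: "continuous_on {0..T} y"
  proof -
    have "continuous_on (closure Q) (\<lambda>z. (w z)\<^sup>2)" by (intro continuous_intros cw)
    from continuous_integral_slices[OF this] show ?thesis by (simp add: y_def[abs_def])
  qed
  have y0: "0 \<le> y t" for t unfolding y_def by simp
  have bL2: "in_L2 ?LQ b1" "in_L2 ?LQ b2" and cL2: "in_L2 ?LQ c1" "in_L2 ?LQ c2" and fL2: "in_L2 ?LQ f1" "in_L2 ?LQ f2"
    using adm1 adm2 by (auto simp: admissible_data_def)
  note intb = in_L2_integrable[OF finite_Q bL2(1)] in_L2_integrable[OF finite_Q bL2(2)]
  note intc = in_L2_integrable[OF finite_Q cL2(1)] in_L2_integrable[OF finite_Q cL2(2)]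
  note intf = in_L2_integrable[OF finite_Q fL2(1)] in_L2_integrable[OF finite_Q fL2(2)]
  have gL: "in_Linf ?LQ g1" "in_Linf ?LQ g2" using adm1 adm2 by (auto simp: admissible_data_def time_W1inf_def)
  have "in_Linf ?LQ (\<lambda>z. g1 z - g2 z)"
  proof -
    obtain k1 k2 where "AE z in ?LQ. norm (g1 z) \<le> k1" "AE z in ?LQ. norm (g2 z) \<le> k2"
      using gL by (auto simp: in_Linf_def)
    then have "AE z in ?LQ. norm (g1 z - g2 z) \<le> k1 + k2"
      by eventually_elim (simp add: abs_le_iff)
    with gL show ?thesis by (auto simp: in_Linf_def)
  qed
  note \<beta> = in_Linf_AE_le_norm[OF this, folded \<beta>_def]
  show "0 \<le> \<beta>" by (rule \<beta>(2))
  define \<alpha> where "\<alpha> = m / (m + \<beta>)"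
  have \<alpha>: "0 \<le> \<alpha>" "\<alpha> \<le> 1" "1 - \<alpha> \<le> \<beta> / m"
  proof -
    show "0 \<le> \<alpha>" "\<alpha> \<le> 1" using \<open>0 < m\<close> \<beta>(2) by (auto simp: \<alpha>_def)
    have "1 - \<alpha> = \<beta> / (m + \<beta>)" using \<open>0 < m\<close> \<beta>(2) by (simp add: \<alpha>_def field_simps)
    also have "\<dots> \<le> \<beta> / m" using \<open>0 < m\<close> \<beta>(2) by (intro divide_left_mono) auto
    finally show "1 - \<alpha> \<le> \<beta> / m" .
  qed
  have scale: "\<alpha> * q \<le> p" if "m \<le> p" "q \<le> p + \<beta>" for p q
  proof -
    have "m * q \<le> m * (p + \<beta>)" using that \<open>0 < m\<close> by simp
    also have "\<dots> \<le> p * (m + \<beta>)" using mult_right_mono[OF that(1) \<beta>(2)] by (simp add: algebra_simps)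
    finally show ?thesis using \<open>0 < m\<close> \<beta>(2) by (simp add: \<alpha>_def pos_divide_le_eq)
  qed
  have gm: "AE z in ?LQ. m \<le> g1 z" "AE z in ?LQ. m \<le> g2 z" using adm1 adm2 by (auto simp: admissible_data_def)
  have "AE z in ?LQ. \<alpha> * g2 z \<le> g1 z"
    using gm(1) \<beta>(1) by eventually_elim (rule scale, auto simp: abs_le_iff)
  then have g21: "AE t in I. AE x in M. \<alpha> * g2 (x, t) \<le> g1 (x, t)" by (rule AE_Q(2))
  have "AE z in ?LQ. \<alpha> * g1 z \<le> g2 z"
    using gm(2) \<beta>(1) by eventually_elim (rule scale, auto simp: abs_le_iff)
  then have g12: "AE t in I. AE x in M. \<alpha> * g1 (x, t) \<le> g2 (x, t)" by (rule AE_Q(2))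
  have K1: "AE t in I. (\<lambda>x. \<alpha> * u2 (x, t)) \<in> gradient_constraint \<Omega> (\<lambda>x. g1 (x, t))"
    using s2(6) g21 by eventually_elim (rule gradient_constraint_cmult[OF _ \<alpha>(1)])
  have K2: "AE t in I. (\<lambda>x. \<alpha> * u1 (x, t)) \<in> gradient_constraint \<Omega> (\<lambda>x. g2 (x, t))"
    using s1(6) g12 by eventually_elim (rule gradient_constraint_cmult[OF _ \<alpha>(1)])
  \<comment> \<open>The error term of \<open>perturbation_bound\<close>, as a function on the
    cylinder.\<close>
  define N where "N z = 2 * B * R * norm (b1 z - b2 z) + 2 * B * B * \<bar>c1 z - c2 z\<bar> + 2 * B * \<bar>f1 z - f2 z\<bar>
      + (1 - \<alpha>) * (B * R * (norm (b1 z) + norm (b2 z)) + B * B * (\<bar>c1 z\<bar> + \<bar>c2 z\<bar>) + B * (\<bar>f1 z\<bar> + \<bar>f2 z\<bar>))" for z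
  have N: "integrable ?LQ N" unfolding N_def using intb intc intf by auto
  have N0: "0 \<le> N z" for z
    unfolding N_def using \<open>0 \<le> B\<close> \<open>0 \<le> R\<close> \<alpha>(2) by (intro add_nonneg_nonneg mult_nonneg_nonneg) auto
  define n where "n t = (\<integral>x. N (x, t) \<partial>M)" for t
  have n: "integrable I n" "(\<integral>t. n t \<partial>I) = (\<integral>z. N z \<partial>?LQ)"
    unfolding n_def by (rule Fubini_Q(2)[OF N], rule Fubini_Q(3)[OF N])
  have n0: "0 \<le> n t" for t unfolding n_def using N0 by simp
  \<comment> \<open>By the product rule these are the time derivatives of the integrals of
    \<open>u1 * u1\<close>, \<open>u2 * u2\<close> and \<open>u1 * u2\<close>; the repeated summand
    in the two pure cases explains the halves in \<open>h\<close>.\<close>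
  define P11 where "P11 t = (\<integral>x. ut1 (x, t) * u1 (x, t) + ut1 (x, t) * u1 (x, t) \<partial>M)" for t
  define P22 where "P22 t = (\<integral>x. ut2 (x, t) * u2 (x, t) + ut2 (x, t) * u2 (x, t) \<partial>M)" for t
  define P12 where "P12 t = (\<integral>x. ut1 (x, t) * u2 (x, t) + ut2 (x, t) * u1 (x, t) \<partial>M)" for t
  \<comment> \<open>Nonnegativity of \<open>h\<close> is the energy inequality before integration in
    time: the first three terms stem from the time derivatives, \<open>l * y t\<close> from
    coercivity and \<open>n t\<close> from the error.\<close>
  define h where "h t = \<alpha> * P12 t - P11 t / 2 - P22 t / 2 - l * y t + n t" for t
  have coercive: "AE t in I. l * y t \<le> (\<integral>x. c1 (x, t) * (w (x, t))\<^sup>2 \<partial>M) + (\<integral>x. w (x, t) * (b1 (x, t) \<bullet> Dw (x, t)) \<partial>M)"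
    unfolding y_def
  proof (rule coercivity_time_dependent[where R="2 * R"])
    show "coercivity_condition \<Omega> T l b1 c1" using adm1 by (simp add: admissible_data_def)
    show "AE t in I. (\<exists>\<phi>. H10_approximation \<Omega> (\<lambda>x. w (x, t)) (\<lambda>x. Dw (x, t)) \<phi>) \<and>
       has_weak_gradient \<Omega> (\<lambda>x. w (x, t)) (\<lambda>x. Dw (x, t)) \<and> (AE x in M. norm (Dw (x, t)) \<le> 2 * R)"
      using s1(5) s2(5)
    proof eventually_elim
      case (elim t)
      from elim obtain \<phi> \<psi> where "H10_approximation \<Omega> (\<lambda>x. u1 (x, t)) (\<lambda>x. Du1 (x, t)) \<phi>"
        "H10_approximation \<Omega> (\<lambda>x. u2 (x, t)) (\<lambda>x. Du2 (x, t)) \<psi>" by blast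
      from H10_approximation_diff[OF open_domain bounded_domain this]
      have "\<exists>\<phi>. H10_approximation \<Omega> (\<lambda>x. w (x, t)) (\<lambda>x. Dw (x, t)) \<phi>" unfolding w_def Dw_def by blast
      moreover have "has_weak_gradient \<Omega> (\<lambda>x. w (x, t)) (\<lambda>x. Dw (x, t))"
        unfolding w_def Dw_def by (rule has_weak_gradient_diff[OF open_domain]) (use elim in auto)
      moreover have "AE x in M. norm (Dw (x, t)) \<le> 2 * R"
      proof -
        have "AE x in M. norm (Du1 (x, t)) \<le> R" "AE x in M. norm (Du2 (x, t)) \<le> R" using elim by auto
        then show ?thesis
          by eventually_elim (use norm_triangle_ineq4 in \<open>fastforce simp: Dw_def intro: order_trans\<close>)
      qed
      ultimately show ?case by blast
    qed
  qed (use bL2 cL2 cw in auto)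
  have h0: "AE t in I. 0 \<le> h t"
  proof -
    have slT: "AE t in I. integrable M (\<lambda>x. ut1 (x, t))" "AE t in I. integrable M (\<lambda>x. ut2 (x, t))"
      using Fubini_Q(1) time_regular_integrable s1(1) s2(1) by auto
    have slb: "AE t in I. in_L2 M (\<lambda>x. b1 (x, t))" "AE t in I. in_L2 M (\<lambda>x. b2 (x, t))"
      and slc: "AE t in I. in_L2 M (\<lambda>x. c1 (x, t))" "AE t in I. in_L2 M (\<lambda>x. c2 (x, t))"
      and slf: "AE t in I. in_L2 M (\<lambda>x. f1 (x, t))" "AE t in I. in_L2 M (\<lambda>x. f2 (x, t))"
      using in_L2_slice[OF open_domain _ bounded_domain, of "{0<..<T}"] bL2 cL2 fL2 by (auto simp: cylinder_def)
    have slN: "AE t in I. integrable M (\<lambda>x. N (x, t))" by (rule Fubini_Q(1)[OF N])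
    have tI: "AE t in I. t \<in> {0..T}" by (rule AE_I2) auto
    show ?thesis
      using K1 K2 s1(7) s2(7) s1(5) s2(5) coercive slT slb slc slf slN tI
    proof eventually_elim
      case (elim t)
      have t: "t \<in> {0..T}" by (rule elim)
      have um: "(\<lambda>x. u1 (x, t)) \<in> borel_measurable M" "(\<lambda>x. u2 (x, t)) \<in> borel_measurable M"
        using continuous_Q_slice_measurable(1)[OF cu1 t] continuous_Q_slice_measurable(1)[OF cu2 t] by auto
      define k1 where "k1 x = \<alpha> * u2 (x, t) - u1 (x, t)" for x
      define k2 where "k2 x = \<alpha> * u1 (x, t) - u2 (x, t)" for x
      have km[measurable]: "k1 \<in> borel_measurable M" "k2 \<in> borel_measurable M"
        unfolding k1_def[abs_def] k2_def[abs_def] using um by auto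
      have \<alpha>B: "\<bar>\<alpha> * r\<bar> \<le> B" if "\<bar>r\<bar> \<le> B" for r
        using mult_mono[OF \<alpha>(2) that] \<alpha>(1) by (simp add: abs_mult)
      have kB: "\<bar>k1 x\<bar> \<le> 2 * B" "\<bar>k2 x\<bar> \<le> 2 * B" if "x \<in> \<Omega>" for x
        using \<alpha>B[OF u1B[OF that t]] \<alpha>B[OF u2B[OF that t]] u1B[OF that t] u2B[OF that t]
        unfolding k1_def k2_def by linarith+
      have mk: "integrable M (\<lambda>x. p x * k1 x)" "integrable M (\<lambda>x. p x * k2 x)" if "integrable M p" for p
        using kB by (auto intro!: integrable_mult_bounded[OF that, where K="2 * B"] AE_I2)
      have mu: "integrable M (\<lambda>x. p x * u1 (x, t))" "integrable M (\<lambda>x. p x * u2 (x, t))" if "integrable M p" for p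
        using u1B u2B t um by (auto intro!: integrable_mult_bounded[OF that, where K=B] AE_I2)
      have DL2: "in_L2 M (\<lambda>x. Du1 (x, t))" "in_L2 M (\<lambda>x. Du2 (x, t))"
        using elim(5,6) by (auto simp: H10_approximation_def)
      have ibD: "integrable M (\<lambda>x. b1 (x, t) \<bullet> Du1 (x, t))" "integrable M (\<lambda>x. b2 (x, t) \<bullet> Du2 (x, t))"
        "integrable M (\<lambda>x. b1 (x, t) \<bullet> Dw (x, t))"
        using in_L2_mult_integrable(1) elim DL2 in_L2_diff[OF DL2] unfolding Dw_def by auto
      have ic: "integrable M (\<lambda>x. c1 (x, t))" "integrable M (\<lambda>x. c2 (x, t))"
        and if': "integrable M (\<lambda>x. f1 (x, t))" "integrable M (\<lambda>x. f2 (x, t))"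
        using in_L2_integrable[OF finite_M] elim by auto
      have iut: "integrable M (\<lambda>x. ut1 (x, t))" "integrable M (\<lambda>x. ut2 (x, t))" by (rule elim)+
      have wx: "w (x, t) = u1 (x, t) - u2 (x, t)" for x by (simp add: w_def)
      have icw: "integrable M (\<lambda>x. c1 (x, t) * (w (x, t))\<^sup>2)"
      proof -
        have "integrable M (\<lambda>x. (c1 (x, t) * w (x, t)) * w (x, t))"
        proof -
          have cwi: "integrable M (\<lambda>x. p x * w (x, t))" if "integrable M p" for p
            using mu[OF that] by (simp add: wx right_diff_distrib)
          show ?thesis by (intro cwi ic)
        qed
        then show ?thesis by (simp add: power2_eq_square mult.assoc)
      qed
      have ibw: "integrable M (\<lambda>x. w (x, t) * (b1 (x, t) \<bullet> Dw (x, t)))"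
        using mu[OF ibD(3)] by (simp add: wx left_diff_distrib mult.commute)
      define S where "S x = ((b1 (x, t) \<bullet> Du1 (x, t)) * k1 x + c1 (x, t) * u1 (x, t) * k1 x - f1 (x, t) * k1 x)
        + ((b2 (x, t) \<bullet> Du2 (x, t)) * k2 x + c2 (x, t) * u2 (x, t) * k2 x - f2 (x, t) * k2 x)" for x
      note ints = mk(1)[OF ibD(1)] mk(2)[OF ibD(2)] mk(1)[OF mu(1)[OF ic(1)]] mk(2)[OF mu(2)[OF ic(2)]]
        mk(1)[OF if'(1)] mk(2)[OF if'(2)] mk(1)[OF iut(1)] mk(2)[OF iut(2)]
      have iS: "integrable M S" unfolding S_def using ints by simp
      \<comment> \<open>The two variational inequalities are added; \<open>S\<close> holds all terms
        without time derivatives, and \<open>k1\<close>, \<open>k2\<close> are the differences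
        between competitor and solution.\<close>
      have "0 \<le> (\<integral>x. ut1 (x, t) * k1 x \<partial>M) + (\<integral>x. ut2 (x, t) * k2 x \<partial>M) + (\<integral>x. S x \<partial>M)"
        using bspec[OF elim(3) elim(1)] bspec[OF elim(4) elim(2)] ints
        unfolding S_def k1_def[symmetric] k2_def[symmetric] by simp
      also have "(\<integral>x. ut1 (x, t) * k1 x \<partial>M) + (\<integral>x. ut2 (x, t) * k2 x \<partial>M) = \<alpha> * P12 t - P11 t / 2 - P22 t / 2"
      proof -
        have "(\<integral>x. ut1 (x, t) * k1 x \<partial>M) = (\<integral>x. \<alpha> * (ut1 (x, t) * u2 (x, t)) - ut1 (x, t) * u1 (x, t) \<partial>M)"
          by (rule Bochner_Integration.integral_cong) (auto simp: k1_def algebra_simps)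
        moreover have "(\<integral>x. ut2 (x, t) * k2 x \<partial>M) = (\<integral>x. \<alpha> * (ut2 (x, t) * u1 (x, t)) - ut2 (x, t) * u2 (x, t) \<partial>M)"
          by (rule Bochner_Integration.integral_cong) (auto simp: k2_def algebra_simps)
        moreover have "P11 t = (\<integral>x. ut1 (x, t) * u1 (x, t) \<partial>M) + (\<integral>x. ut1 (x, t) * u1 (x, t) \<partial>M)"
          unfolding P11_def by (intro Bochner_Integration.integral_add mu iut)
        moreover have "P22 t = (\<integral>x. ut2 (x, t) * u2 (x, t) \<partial>M) + (\<integral>x. ut2 (x, t) * u2 (x, t) \<partial>M)"
          unfolding P22_def by (intro Bochner_Integration.integral_add mu iut)
        moreover have "P12 t = (\<integral>x. ut1 (x, t) * u2 (x, t) \<partial>M) + (\<integral>x. ut2 (x, t) * u1 (x, t) \<partial>M)"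
          unfolding P12_def by (intro Bochner_Integration.integral_add mu iut)
        ultimately show ?thesis
          using mu[OF iut(1)] mu[OF iut(2)] by (simp add: distrib_left)
      qed
      also have "(\<integral>x. S x \<partial>M) \<le> (\<integral>x. - (c1 (x, t) * (w (x, t))\<^sup>2 + w (x, t) * (b1 (x, t) \<bullet> Dw (x, t))) + N (x, t) \<partial>M)"
      proof (rule integral_mono_AE[OF iS])
        show "integrable M (\<lambda>x. - (c1 (x, t) * (w (x, t))\<^sup>2 + w (x, t) * (b1 (x, t) \<bullet> Dw (x, t))) + N (x, t))"
          using icw ibw elim by auto
        have "AE x in M. norm (Du1 (x, t)) \<le> R" "AE x in M. norm (Du2 (x, t)) \<le> R" "AE x in M. x \<in> \<Omega>"
          using elim(5,6) by auto
        then show "AE x in M. S x \<le> - (c1 (x, t) * (w (x, t))\<^sup>2 + w (x, t) * (b1 (x, t) \<bullet> Dw (x, t))) + N (x, t)"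
        proof eventually_elim
          case (elim x)
          show ?case
            unfolding S_def N_def w_def Dw_def k1_def k2_def
            by (rule perturbation_bound[OF u1B[OF elim(3) t] u2B[OF elim(3) t] elim(1,2) \<alpha>(2)])
        qed
      qed
      also have "\<dots> = - ((\<integral>x. c1 (x, t) * (w (x, t))\<^sup>2 \<partial>M) + (\<integral>x. w (x, t) * (b1 (x, t) \<bullet> Dw (x, t)) \<partial>M)) + n t"
        using icw ibw elim by (simp add: n_def)
      also have "\<dots> \<le> - (l * y t) + n t" using elim(7) by simp
      finally show "0 \<le> h t" by (simp add: h_def)
    qed
  qed
  have reg: "time_regular u1 ut1" "time_regular u2 ut2" using s1 s2 by auto
  have iP: "integrable I P11" "integrable I P22" "integrable I P12"
    unfolding P11_def P22_def P12_def
    using weak_product_rule(1)[OF reg(1) reg(1), of 0] weak_product_rule(1)[OF reg(2) reg(2), of 0]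
      weak_product_rule(1)[OF reg(1) reg(2), of 0] T_pos by auto
  have iy: "integrable I y" by (rule continuous_imp_integrable_Ioo[OF cy])
  have ih: "integrable I h" unfolding h_def using iP iy n(1) by auto
  define Y11 where "Y11 t = (\<integral>x. u1 (x, t) * u1 (x, t) \<partial>M)" for t
  define Y22 where "Y22 t = (\<integral>x. u2 (x, t) * u2 (x, t) \<partial>M)" for t
  define Y12 where "Y12 t = (\<integral>x. u1 (x, t) * u2 (x, t) \<partial>M)" for t
  have yY: "y t = Y11 t + Y22 t - 2 * Y12 t" if "t \<in> {0..T}" for t
  proof -
    have "continuous_on (closure Q) (\<lambda>z. u1 z * u1 z)" "continuous_on (closure Q) (\<lambda>z. u2 z * u2 z)"
      "continuous_on (closure Q) (\<lambda>z. u1 z * u2 z)" by (intro continuous_intros cu1 cu2)+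
    note int = continuous_Q_slice_measurable(2)[OF this(1) that] continuous_Q_slice_measurable(2)[OF this(2) that]
      continuous_Q_slice_measurable(2)[OF this(3) that]
    have "y t = (\<integral>x. u1 (x, t) * u1 (x, t) + u2 (x, t) * u2 (x, t) - 2 * (u1 (x, t) * u2 (x, t)) \<partial>M)"
      unfolding y_def w_def by (rule Bochner_Integration.integral_cong) (auto simp: power2_eq_square algebra_simps)
    also have "\<dots> = Y11 t + Y22 t - 2 * Y12 t" unfolding Y11_def Y22_def Y12_def using int by simp
    finally show ?thesis .
  qed
  have Y12B: "\<bar>Y12 t\<bar> \<le> B * B * measure lebesgue \<Omega>" if "t \<in> {0..T}" for t
  proof -
    have c: "continuous_on (closure Q) (\<lambda>z. u1 z * u2 z)" by (intro continuous_intros cu1 cu2)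
    have "\<bar>Y12 t\<bar> \<le> (B * B) * (\<integral>x. 1 \<partial>M)"
      unfolding Y12_def
    proof (rule uniform_bound_integral[OF continuous_Q_slice_measurable(2)[OF c that]])
      show "integrable M (\<lambda>x. 1::real)" by (rule finite_measure.integrable_const[OF finite_M])
      show "AE x in M. \<bar>u1 (x, t) * u2 (x, t)\<bar> \<le> B * B * 1"
      proof (rule AE_I2)
        fix x assume "x \<in> space M"
        then show "\<bar>u1 (x, t) * u2 (x, t)\<bar> \<le> B * B * 1"
          using u1B[of x t] u2B[of x t] that \<open>0 \<le> B\<close> by (auto simp: abs_mult intro!: mult_mono)
      qed
    qed
    moreover have "(\<integral>x. 1 \<partial>M) = measure lebesgue \<Omega>"
      using open_domain by (simp add: measure_restrict_space)
    ultimately show ?thesis by simp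
  qed
  \<comment> \<open>The norms of the data themselves occur only with the factor
    \<open>1 - \<alpha>\<close>; they are bounded through \<open>\<kappa>\<close>, and
    \<open>1 - \<alpha> \<le> \<beta> / m\<close> makes their contribution proportional to
    \<open>\<beta>\<close>.\<close>
  have Nint: "(\<integral>z. N z \<partial>?LQ) \<le> 2 * B * R * L1_norm ?LQ (\<lambda>z. b1 z - b2 z) + 2 * B * B * L1_norm ?LQ (\<lambda>z. c1 z - c2 z)
      + 2 * B * L1_norm ?LQ (\<lambda>z. f1 z - f2 z) + \<beta> / m * (\<kappa> * (B * R + B * B + B))"
  proof -
    let ?n = "\<lambda>h. \<integral>z. norm (h z) \<partial>?LQ"
    have eq: "(\<integral>z. N z \<partial>?LQ) = 2 * B * R * ?n (\<lambda>z. b1 z - b2 z) + 2 * B * B * ?n (\<lambda>z. c1 z - c2 z) + 2 * B * ?n (\<lambda>z. f1 z - f2 z)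
      + (1 - \<alpha>) * (B * R * (?n b1 + ?n b2) + B * B * (?n c1 + ?n c2) + B * (?n f1 + ?n f2))"
      unfolding N_def using intb intc intf by simp
    have sp: "measure ?LQ (space ?LQ) = measure lebesgue Q"
      using open_cylinder by (simp add: measure_restrict_space)
    have half: "?n b1 + ?n b2 \<le> \<kappa>" "?n c1 + ?n c2 \<le> \<kappa>" "?n f1 + ?n f2 \<le> \<kappa>"
      using L1_le_L2[OF finite_Q bL2(1), of R] L1_le_L2[OF finite_Q bL2(2), of R] L1_le_L2[OF finite_Q cL2(1), of R]
        L1_le_L2[OF finite_Q cL2(2), of R] L1_le_L2[OF finite_Q fL2(1), of R] L1_le_L2[OF finite_Q fL2(2), of R] data1 data2
      unfolding sp \<kappa>_def data_bounded_by_def by linarith+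
    have BR: "0 \<le> B * R" "0 \<le> B * B" using \<open>0 \<le> B\<close> \<open>0 \<le> R\<close> by auto
    have "B * R * (?n b1 + ?n b2) + B * B * (?n c1 + ?n c2) + B * (?n f1 + ?n f2) \<le> B * R * \<kappa> + B * B * \<kappa> + B * \<kappa>"
      using mult_left_mono[OF half(1) BR(1)] mult_left_mono[OF half(2) BR(2)] mult_left_mono[OF half(3) \<open>0 \<le> B\<close>] by linarith
    also have "\<dots> = \<kappa> * (B * R + B * B + B)" by (simp add: algebra_simps)
    finally have le: "B * R * (?n b1 + ?n b2) + B * B * (?n c1 + ?n c2) + B * (?n f1 + ?n f2) \<le> \<kappa> * (B * R + B * B + B)" .
    have "0 \<le> B * R * (?n b1 + ?n b2) + B * B * (?n c1 + ?n c2) + B * (?n f1 + ?n f2)"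
      using \<open>0 \<le> R\<close> \<open>0 \<le> B\<close> by (intro add_nonneg_nonneg mult_nonneg_nonneg) auto
    then have "(1 - \<alpha>) * (B * R * (?n b1 + ?n b2) + B * B * (?n c1 + ?n c2) + B * (?n f1 + ?n f2)) \<le> \<beta> / m * (\<kappa> * (B * R + B * B + B))"
      using \<alpha>(3) le \<beta>(2) \<open>0 < m\<close> by (intro mult_mono) auto
    then show ?thesis unfolding eq L1_norm_def by simp
  qed
  \<comment> \<open>Integrating \<open>0 \<le> h\<close> controls \<open>y \<tau> / 2\<close>;
    clearing this half doubles all other terms, in particular the factor of the integral of
    \<open>y\<close>.\<close>
  have yA: "y \<tau> \<le> A + 2 * \<bar>l\<bar> * integral {0..\<tau>} y" if \<tau>: "\<tau> \<in> {0..T}" for \<tau>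
  proof -
    have \<tau>': "0 \<le> \<tau>" "\<tau> \<le> T" using \<tau> by auto
    have subI: "{0<..<\<tau>} \<subseteq> {0<..<T}" "{0<..<T} \<in> sets lebesgue" "{0<..<\<tau>} \<in> sets lebesgue" using \<tau>' by auto
    have sub: "integrable (lebesgue_on {0<..<\<tau>}) p" if "integrable I p" for p :: "real \<Rightarrow> real"
      by (rule integrable_lebesgue_on_subset[OF that subI])
    note HK = lebesgue_on_Ioo_eq_integral[OF sub]
    have "AE t in lebesgue_on {0<..<\<tau>}. 0 \<le> h t"
      using h0 subI by (auto simp: AE_restrict_space_iff elim!: eventually_mono)
    then have "0 \<le> integral {0..\<tau>} h"
      using HK(2)[OF ih] integral_nonneg_AE by metis
    also have "integral {0..\<tau>} h = \<alpha> * integral {0..\<tau>} P12 - integral {0..\<tau>} P11 / 2 - integral {0..\<tau>} P22 / 2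
        - l * integral {0..\<tau>} y + integral {0..\<tau>} n"
    proof -
      have "(h has_integral (\<alpha> * integral {0..\<tau>} P12 - integral {0..\<tau>} P11 / 2 - integral {0..\<tau>} P22 / 2
        - l * integral {0..\<tau>} y + integral {0..\<tau>} n)) {0..\<tau>}"
        unfolding h_def
        by (intro has_integral_add has_integral_diff has_integral_mult_right has_integral_divide integrable_integral HK(1) iP iy n(1))
      then show ?thesis by (rule integral_unique)
    qed
    also have "integral {0..\<tau>} P12 = Y12 \<tau> - Y12 0"
      using weak_product_rule(2)[OF reg(1) reg(2) \<tau>'] by (simp add: P12_def[abs_def] Y12_def)
    also have "integral {0..\<tau>} P11 = Y11 \<tau> - Y11 0"
      using weak_product_rule(2)[OF reg(1) reg(1) \<tau>'] by (simp add: P11_def[abs_def] Y11_def)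
    also have "integral {0..\<tau>} P22 = Y22 \<tau> - Y22 0"
      using weak_product_rule(2)[OF reg(2) reg(2) \<tau>'] by (simp add: P22_def[abs_def] Y22_def)
    finally have main: "0 \<le> \<alpha> * (Y12 \<tau> - Y12 0) - (Y11 \<tau> - Y11 0) / 2 - (Y22 \<tau> - Y22 0) / 2
        - l * integral {0..\<tau>} y + integral {0..\<tau>} n" .
    have nle: "integral {0..\<tau>} n \<le> (\<integral>z. N z \<partial>?LQ)"
    proof -
      have "integral {0..\<tau>} n \<le> integral {0..T} n"
        using \<tau>' n0 HK(1)[OF n(1)] lebesgue_on_Ioo_eq_integral(1)[OF n(1)] by (intro integral_subset_le) auto
      then show ?thesis using lebesgue_on_Ioo_eq_integral(2)[OF n(1)] n(2) by simp
    qed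
    have "0 \<le> integral {0..\<tau>} y" using y0 HK(1)[OF iy] by (intro Henstock_Kurzweil_Integration.integral_nonneg) auto
    \<comment> \<open>The sign of \<open>l\<close> is arbitrary, hence the absolute value.\<close>
    then have ly: "- (l * integral {0..\<tau>} y) \<le> \<bar>l\<bar> * integral {0..\<tau>} y"
      unfolding mult_minus_left[symmetric] by (intro mult_right_mono) auto
    \<comment> \<open>The surplus \<open>(1 - \<alpha>) * (Y12 \<tau> - Y12 0)\<close> involves only
      values at the two end times, which the sup bound controls.\<close>
    have \<alpha>Y: "\<alpha> * (Y12 \<tau> - Y12 0) = (Y12 \<tau> - Y12 0) - (1 - \<alpha>) * (Y12 \<tau> - Y12 0)" by (simp add: algebra_simps)
    have \<gamma>Y: "- ((1 - \<alpha>) * (Y12 \<tau> - Y12 0)) \<le> \<beta> / m * (2 * (B * B * measure lebesgue \<Omega>))"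
    proof -
      have "\<bar>Y12 \<tau> - Y12 0\<bar> \<le> 2 * (B * B * measure lebesgue \<Omega>)"
        using Y12B[OF \<tau>] Y12B[of 0] T_pos by auto
      then have "\<bar>(1 - \<alpha>) * (Y12 \<tau> - Y12 0)\<bar> \<le> \<beta> / m * (2 * (B * B * measure lebesgue \<Omega>))"
        unfolding abs_mult using \<alpha> by (intro mult_mono) auto
      then show ?thesis by linarith
    qed
    have y\<tau>: "y \<tau> = Y11 \<tau> + Y22 \<tau> - 2 * Y12 \<tau>" "y 0 = Y11 0 + Y22 0 - 2 * Y12 0"
      using yY[OF \<tau>] yY[of 0] T_pos by auto
    \<comment> \<open>A linear fact about real numbers; stating it for variables keeps the integrals
      and products out of the arithmetic.\<close>
    have "yt \<le> y0 + 2 * s + 2 * p + 2 * N'"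
      if "0 \<le> a - (A1 - A0) / 2 - (B1 - B0) / 2 - L + n'" "n' \<le> N'" "- L \<le> p" "a = (C1 - C0) - e" "- e \<le> s"
        "yt = A1 + B1 - 2 * C1" "y0 = A0 + B0 - 2 * C0"
      for yt y0 s p N' a A1 A0 B1 B0 L n' C1 C0 e :: real
      using that by (simp add: field_simps)
    from this[OF main nle ly \<alpha>Y \<gamma>Y y\<tau>] have yle: "y \<tau> \<le> y 0 + 2 * (\<beta> / m * (2 * (B * B * measure lebesgue \<Omega>))) + 2 * (\<bar>l\<bar> * integral {0..\<tau>} y) + 2 * (\<integral>z. N z \<partial>?LQ)"
      .
    have yzero: "y 0 = (L2_norm M (\<lambda>x. u01 x - u02 x))\<^sup>2"
    proof -
      have ae: "AE x in M. u1 (x, 0) = u01 x" "AE x in M. u2 (x, 0) = u02 x"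
        using sol1 sol2 by (auto simp: is_solution_def)
      have [measurable]: "u01 \<in> borel_measurable M" "u02 \<in> borel_measurable M"
        using adm1 adm2 by (auto simp: admissible_data_def gradient_constraint_def H10_def in_L2_def)
      have [measurable]: "(\<lambda>x. w (x, 0)) \<in> borel_measurable M"
        using continuous_Q_slice_measurable(1)[OF cw, of 0] T_pos by simp
      have "y 0 = (\<integral>x. (norm (u01 x - u02 x))\<^sup>2 \<partial>M)"
        unfolding y_def
      proof (rule integral_cong_AE)
        show "AE x in M. (w (x, 0))\<^sup>2 = (norm (u01 x - u02 x))\<^sup>2"
          using ae by eventually_elim (simp add: w_def)
      qed measurable
      then show ?thesis by (simp add: L2_norm_def)
    qed
    show ?thesis
    proof -
      have "\<beta> / m * (4 * B * B * measure lebesgue \<Omega> + 2 * \<kappa> * (B * R + B * B + B))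
          = 2 * (\<beta> / m * (2 * (B * B * measure lebesgue \<Omega>))) + 2 * (\<beta> / m * (\<kappa> * (B * R + B * B + B)))"
        by (simp only: distrib_left mult_ac) simp
      then show ?thesis using Nint yle yzero unfolding A_def by linarith
    qed
  qed
  \<comment> \<open>Gronwall's inequality with rate \<open>2 * \<bar>l\<bar>\<close>, which its
    exponent doubles once more.\<close>
  have bound: "y t \<le> 2 * A * exp (4 * \<bar>l\<bar> * T)" if t: "t \<in> {0..T}" for t
  proof -
    have "y t \<le> 2 * A * exp (2 * (2 * \<bar>l\<bar>) * t)"
      by (rule gronwall_integral[OF cy y0 _ _ yA t]) (use T_pos in auto)
    moreover have "0 \<le> A" using yA[of 0] y0[of 0] T_pos by simp
    moreover have "exp (2 * (2 * \<bar>l\<bar>) * t) \<le> exp (4 * \<bar>l\<bar> * T)"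
      using t by (simp add: mult_left_mono)
    ultimately show ?thesis
      by (meson mult_left_mono order_trans mult_nonneg_nonneg zero_le_numeral)
  qed
  define E where "E = 2 * A * exp (4 * \<bar>l\<bar> * T)"
  have "0 \<le> E" using bound[of 0] y0[of 0] T_pos by (simp add: E_def)
  have norm_y: "L2_norm M (\<lambda>x. u1 (x, t) - u2 (x, t)) = sqrt (y t)" for t
    by (simp add: L2_norm_def y_def w_def)
  have m: "(\<lambda>t. sqrt (y t)) \<in> borel_measurable I"
    by (intro lebesgue_on_continuous_measurable continuous_intros continuous_on_subset[OF cy]) auto
  have ae: "AE t in I. norm (sqrt (y t)) \<le> sqrt E"
    using bound y0 by (intro AE_I2) (auto simp: E_def real_sqrt_abs2)
  have Linf: "in_Linf I (\<lambda>t. sqrt (y t))" using m ae by (auto simp: in_Linf_def)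
  have "Linf_norm I (\<lambda>t. sqrt (y t)) \<le> sqrt E"
    by (rule Linf_norm_le[OF m ae]) (use \<open>0 \<le> E\<close> in simp)
  then have "(Linf_norm I (\<lambda>t. sqrt (y t)))\<^sup>2 \<le> (sqrt E)\<^sup>2"
    using in_Linf_AE_le_norm(2)[OF Linf] by (rule power_mono)
  then show "(Linf_L2_norm \<Omega> T (\<lambda>z. u1 z - u2 z))\<^sup>2 \<le> 2 * A * exp (4 * \<bar>l\<bar> * T)"
    using \<open>0 \<le> E\<close> by (simp add: Linf_L2_norm_def norm_y E_def)
qed

end

section \<open>The constant, uniform in the data\<close>

theorem theorem3p2:
  fixes \<Omega> :: "'a::euclidean_space set" and T l m R :: real
  assumes "open \<Omega>" and "bounded \<Omega>" and "lipschitz_boundary \<Omega>" and "T > 0" and "m > 0"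
  shows "\<exists>C>0. \<forall>b1 c1 f1 g1 u01 u1 b2 c2 f2 g2 u02 u2.
    admissible_data \<Omega> T l m b1 c1 f1 g1 u01 \<and> data_bounded_by \<Omega> T R b1 c1 f1 g1 \<and>
    admissible_data \<Omega> T l m b2 c2 f2 g2 u02 \<and> data_bounded_by \<Omega> T R b2 c2 f2 g2 \<and>
    is_solution \<Omega> T b1 c1 f1 g1 u01 u1 \<and> is_solution \<Omega> T b2 c2 f2 g2 u02 u2 \<longrightarrow>
    (Linf_L2_norm \<Omega> T (\<lambda>z. u1 z - u2 z))\<^sup>2 \<le>
      C * ((L2_norm (lebesgue_on \<Omega>) (\<lambda>x. u01 x - u02 x))\<^sup>2
         + L1_norm (lebesgue_on (cylinder \<Omega> T)) (\<lambda>z. b1 z - b2 z)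
         + L1_norm (lebesgue_on (cylinder \<Omega> T)) (\<lambda>z. c1 z - c2 z)
         + L1_norm (lebesgue_on (cylinder \<Omega> T)) (\<lambda>z. f1 z - f2 z)
         + Linf_norm (lebesgue_on (cylinder \<Omega> T)) (\<lambda>z. g1 z - g2 z))"
proof -
  interpret cylinder_domain \<Omega> T
    using assms by unfold_locales auto
  obtain \<rho> where \<rho>: "0 < \<rho>" "\<Omega> \<subseteq> ball 0 \<rho>"
    using bounded_subset_ballD[OF \<open>bounded \<Omega>\<close>, of 0] by blast
  \<comment> \<open>\<open>R\<close> may be negative, in which case no data satisfy the bound; the
    absolute value lets \<open>C\<close> be chosen and shown positive before any data are
    given.\<close>
  define r where "r = \<bar>R\<bar>"
  define B where "B = 2 * \<rho> * r"
  define \<kappa> where "\<kappa> = measure lebesgue Q + r\<^sup>2"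
  define D where "D = (4 * B * B * measure lebesgue \<Omega> + 2 * \<kappa> * (B * r + B * B + B)) / m"
  \<comment> \<open>A sum of nonnegative numbers that dominates every coefficient of the estimate at
    once; the \<open>1\<close> serves the initial data and makes \<open>C\<close> positive.\<close>
  define K where "K = 1 + 4 * B * r + 4 * B * B + 4 * B + D"
  have pos: "0 \<le> r" "0 \<le> B" "0 \<le> \<kappa>" using \<rho>(1) by (auto simp: r_def B_def \<kappa>_def)
  have BB: "0 \<le> 4 * B * r" "0 \<le> 4 * B * B" using pos by auto
  have "0 \<le> D" unfolding D_def using pos \<open>m > 0\<close>
    by (intro divide_nonneg_pos add_nonneg_nonneg mult_nonneg_nonneg) auto
  have K: "1 \<le> K" "4 * B * r \<le> K" "4 * B * B \<le> K" "4 * B \<le> K" "D \<le> K"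
    using \<open>0 \<le> D\<close> BB pos(2) unfolding K_def by linarith+
  define C where "C = 2 * K * exp (4 * \<bar>l\<bar> * T)"
  show ?thesis
  proof (intro exI[of _ C] conjI allI impI; (elim conjE)?)
    show "0 < C" using K(1) by (simp add: C_def)
    fix b1 c1 f1 g1 u01 u1 b2 c2 f2 g2 u02 u2
    assume a: "admissible_data \<Omega> T l m b1 c1 f1 g1 u01" "data_bounded_by \<Omega> T R b1 c1 f1 g1"
      "admissible_data \<Omega> T l m b2 c2 f2 g2 u02" "data_bounded_by \<Omega> T R b2 c2 f2 g2"
      "is_solution \<Omega> T b1 c1 f1 g1 u01 u1" "is_solution \<Omega> T b2 c2 f2 g2 u02 u2"
    note stab = stability[OF a(5,1,2,6,3,4) \<open>m > 0\<close> \<rho>(2,1)]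
    have "0 \<le> R" by (rule stab(2)) (rule refl)+
    then have rR: "r = R" by (simp add: r_def)
    let ?X0 = "(L2_norm M (\<lambda>x. u01 x - u02 x))\<^sup>2"
    let ?Xb = "L1_norm (lebesgue_on Q) (\<lambda>z. b1 z - b2 z)"
    let ?Xc = "L1_norm (lebesgue_on Q) (\<lambda>z. c1 z - c2 z)"
    let ?Xf = "L1_norm (lebesgue_on Q) (\<lambda>z. f1 z - f2 z)"
    let ?Xg = "Linf_norm (lebesgue_on Q) (\<lambda>z. g1 z - g2 z)"
    have X: "0 \<le> ?X0" "0 \<le> ?Xb" "0 \<le> ?Xc" "0 \<le> ?Xf" "0 \<le> ?Xg"
      using stab(3)[OF refl refl refl refl] by (simp_all add: L1_norm_def)
    have main: "(Linf_L2_norm \<Omega> T (\<lambda>z. u1 z - u2 z))\<^sup>2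
      \<le> 2 * (?X0 + 4 * B * R * ?Xb + 4 * B * B * ?Xc + 4 * B * ?Xf
        + ?Xg / m * (4 * B * B * measure lebesgue \<Omega> + 2 * \<kappa> * (B * R + B * B + B))) * exp (4 * \<bar>l\<bar> * T)"
      by (rule stab(1)[OF _ _ refl refl]) (simp_all add: B_def \<kappa>_def rR)
    have D: "?Xg / m * (4 * B * B * measure lebesgue \<Omega> + 2 * \<kappa> * (B * R + B * B + B)) = D * ?Xg"
      by (simp add: D_def rR)
    have "?X0 + 4 * B * R * ?Xb + 4 * B * B * ?Xc + 4 * B * ?Xf + D * ?Xg
        \<le> K * ?X0 + K * ?Xb + K * ?Xc + K * ?Xf + K * ?Xg"
      using mult_right_mono[OF K(1) X(1)] mult_right_mono[OF K(2) X(2)] mult_right_mono[OF K(3) X(3)]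
        mult_right_mono[OF K(4) X(4)] mult_right_mono[OF K(5) X(5)] unfolding rR by linarith
    also have "\<dots> = K * (?X0 + ?Xb + ?Xc + ?Xf + ?Xg)" by (simp add: distrib_left)
    finally have "2 * (?X0 + 4 * B * R * ?Xb + 4 * B * B * ?Xc + 4 * B * ?Xf + D * ?Xg) * exp (4 * \<bar>l\<bar> * T)
        \<le> 2 * (K * (?X0 + ?Xb + ?Xc + ?Xf + ?Xg)) * exp (4 * \<bar>l\<bar> * T)"
      by (intro mult_right_mono mult_left_mono) auto
    also have "\<dots> = C * (?X0 + ?Xb + ?Xc + ?Xf + ?Xg)"
      by (simp only: C_def mult.assoc mult.commute[of "exp _"])
    finally show "(Linf_L2_norm \<Omega> T (\<lambda>z. u1 z - u2 z))\<^sup>2 \<le> C * (?X0 + ?Xb + ?Xc + ?Xf + ?Xg)"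
      by (rule order_trans[OF main[unfolded D]])
  qed
qed

end
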